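(* Let $d\ge 1$, let $F$ be a probability distribution on $\mathbb{R}^d$, and let $X_1,X_2,\dots$ be i.i.d. random vectors with distribution $F$. For each $n$ let $n=n_1+n_2$ with positive integers $n_1=n_1(n)$, $n_2=n_2(n)$, and let $l=l_n$ be the jackknife empirical log-likelihood ratio (defined in the context) computed from the sample $X_1,\dots,X_n$ split into the first $n_1$ observations and the last $n_2$ observations. Assume: (C1) $0<\sigma_{g_k}<\infty$ for $k=1,2$, where $\sigma_{g_k}^2=\operatorname{Var}(g_k(X_1))$, $g_1(x)=\mathbb{E}\|x+X_2\|-\theta_0$, $g_2(x)=\mathbb{E}\|x-X_2\|-\theta_0$ for $x\in\mathbb{R}^d$, and $\theta_0=\mathbb{E}\|X_1-X_2\|$; (C2) $n_k/n\to\alpha_k>0$ as $n\to\infty$ for $k=1,2$, with $\alpha_1+\alpha_2=1$. If the null hypothesis $H_0$ holds, i.e. $X_1$ and $-X_1$ have the same distribution, then $$ l_n\ \xrightarrow{\ d\ }\ \chi^2_1\qquad\text{as } n\to\infty, $$ where $\chi^2_1$ is the chi-square distribution with one degree of freedom.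
   Context: $\|\cdot\|$ is the Euclidean norm on $\mathbb{R}^d$. Given the sample $X_1,\dots,X_n$, put $Y_i=X_{n_1+i}$ for $i=1,\dots,n_2$, and let $h_1(s,t)=\|s+t\|$, $h_2(s,t)=\|s-t\|$. Define the U-statistics $$U_1=\binom{n_1}{2}^{-1}\sum_{1\le j<k\le n_1}h_1(X_j,X_k),\qquad U_2=\binom{n_2}{2}^{-1}\sum_{1\le j<k\le n_2}h_2(Y_j,Y_k),$$ the leave-one-out versions $$U^{(-i)}_{1,n_1-1}=\binom{n_1-1}{2}^{-1}\sum_{\substack{1\le j<k\le n_1\\ j,k\ne i}}h_1(X_j,X_k),\qquad U^{(-i)}_{2,n_2-1}=\binom{n_2-1}{2}^{-1}\sum_{\substack{1\le j<k\le n_2\\ j,k\ne i}}h_2(Y_j,Y_k),$$ and the jackknife pseudo-values $$\hat V^{(1)}_i=n_1U_1-(n_1-1)U^{(-i)}_{1,n_1-1}\ (i=1,\dots,n_1),\qquad \hat V^{(2)}_j=n_2U_2-(n_2-1)U^{(-j)}_{2,n_2-1}\ (j=1,\dots,n_2).$$ (These are defined once $n_1,n_2\ge 3$, which holds for all large $n$ under (C2).) The maximum constrained jackknife empirical likelihood is $$L=\max_{p,q,\theta}\Big(\prod_{i=1}^{n_1}p_i\Big)\Big(\prod_{j=1}^{n_2}q_j\Big),$$ where the maximum is over $p\in\mathbb{R}^{n_1}$, $q\in\mathbb{R}^{n_2}$, $\theta\in\mathbb{R}$ subject to $p_i\ge0$, $\sum_{i}p_i=1$, $\sum_{i}p_i(\hat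 V^{(1)}_i-\theta)=0$, $q_j\ge0$, $\sum_{j}q_j=1$, $\sum_{j}q_j(\hat V^{(2)}_j-\theta)=0$, with the convention $L=0$ if no $(p,q,\theta)$ satisfies the constraints. The jackknife empirical log-likelihood ratio is $$l=-2\log\big(n_1^{n_1}n_2^{n_2}L\big)\in[0,\infty]$$ (with $l=+\infty$ if $L=0$). Equivalently, by Lagrange multipliers, $$l=2\sum_{i=1}^{n_1}\log\{1+\lambda_1(\hat V^{(1)}_i-\theta)\}+2\sum_{j=1}^{n_2}\log\{1+\lambda_2(\hat V^{(2)}_j-\theta)\},$$ where $(\lambda_1,\lambda_2,\theta)$ (with all terms $1+\lambda_1(\hat V^{(1)}_i-\theta)$ and $1+\lambda_2(\hat V^{(2)}_j-\theta)$ positive) solves $$\sum_{i=1}^{n_1}\frac{\hat V^{(1)}_i-\theta}{1+\lambda_1(\hat V^{(1)}_i-\theta)}=0,\qquad \sum_{j=1}^{n_2}\frac{\hat V^{(2)}_j-\theta}{1+\lambda_2(\hat V^{(2)}_j-\theta)}=0,$$ $$\lambda_1\sum_{i=1}^{n_1}\frac{-1}{1+\lambda_1(\hat V^{(1)}_i-\theta)}+\lambda_2\sum_{j=1}^{n_2}\frac{-1}{1+\lambda_2(\hat V^{(2)}_j-\theta)}=0,$$ whenever such a solution exists. *)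

theory Defs
  imports "HOL-Probability.Probability"
begin

definition h1 :: "'a::real_normed_vector \<Rightarrow> 'a \<Rightarrow> real" where
  "h1 s t = norm (s + t)"

definition h2 :: "'a::real_normed_vector \<Rightarrow> 'a \<Rightarrow> real" where
  "h2 s t = norm (s - t)"

text \<open>Samples are indexed from 1. The U-statistic is taken over an arbitrary finite index set
  \<open>I\<close>, so that \<open>I = {1..m}\<close> gives \<open>U\<close> and \<open>I = {1..m} - {i}\<close>, of cardinality \<open>m - 1\<close>, gives the
  leave-one-out version.\<close>

definition U_stat :: "('a \<Rightarrow> 'a \<Rightarrow> real) \<Rightarrow> (nat \<Rightarrow> 'a) \<Rightarrow> nat set \<Rightarrow> real" where
  "U_stat h x I = (\<Sum>(j, k) \<in> {(j, k). j \<in> I \<and> k \<in> I \<and> j < k}. h (x j) (x k)) / real (card I choose 2)"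

definition pseudo_value :: "('a \<Rightarrow> 'a \<Rightarrow> real) \<Rightarrow> (nat \<Rightarrow> 'a) \<Rightarrow> nat \<Rightarrow> nat \<Rightarrow> real" where
  "pseudo_value h x m i = real m * U_stat h x {1..m} - (real m - 1) * U_stat h x ({1..m} - {i})"

text \<open>Weight vectors are functions on \<open>nat\<close> of which only the values on \<open>{1..m}\<close> matter.\<close>

definition feasible_weights :: "nat \<Rightarrow> (nat \<Rightarrow> real) \<Rightarrow> real \<Rightarrow> (nat \<Rightarrow> real) \<Rightarrow> bool" where
  "feasible_weights m V \<theta> p \<longleftrightarrow>
     (\<forall>i\<in>{1..m}. 0 \<le> p i) \<and> (\<Sum>i=1..m. p i) = 1 \<and> (\<Sum>i=1..m. p i * (V i - \<theta>)) = 0"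

definition likelihood_values ::
    "nat \<Rightarrow> nat \<Rightarrow> (nat \<Rightarrow> real) \<Rightarrow> (nat \<Rightarrow> real) \<Rightarrow> real set" where
  "likelihood_values m1 m2 V W =
     {(\<Prod>i=1..m1. p i) * (\<Prod>j=1..m2. q j) | p q \<theta>.
        feasible_weights m1 V \<theta> p \<and> feasible_weights m2 W \<theta> q}"

text \<open>The supremum below is a maximum: the weights range over a product of simplices, \<open>\<theta>\<close> is
  determined by \<open>p\<close>, and the constraints are closed, so the set of values is compact.\<close>

definition max_likelihood ::
    "nat \<Rightarrow> nat \<Rightarrow> (nat \<Rightarrow> real) \<Rightarrow> (nat \<Rightarrow> real) \<Rightarrow> real" where
  "max_likelihood m1 m2 V W =
     (if likelihood_values m1 m2 V W = {} then 0 else Sup (likelihood_values m1 m2 V W))"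

definition log_likelihood_ratio ::
    "nat \<Rightarrow> nat \<Rightarrow> (nat \<Rightarrow> real) \<Rightarrow> (nat \<Rightarrow> real) \<Rightarrow> ereal" where
  "log_likelihood_ratio m1 m2 V W =
     (if max_likelihood m1 m2 V W = 0 then \<infinity>
      else ereal (- 2 * ln (real m1 ^ m1 * real m2 ^ m2 * max_likelihood m1 m2 V W)))"

text \<open>Computed from \<open>x 1, \<dots>, x (m1 + m2)\<close>. For \<open>m1 < 3\<close> or \<open>m2 < 3\<close> the binomial denominators
  vanish and the value is a convention without meaning.\<close>

definition jel_ratio :: "nat \<Rightarrow> nat \<Rightarrow> (nat \<Rightarrow> 'a::real_normed_vector) \<Rightarrow> ereal" where
  "jel_ratio m1 m2 x =
     log_likelihood_ratio m1 m2 (pseudo_value h1 x m1) (pseudo_value h2 (\<lambda>i. x (m1 + i)) m2)"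

definition theta0 :: "'w measure \<Rightarrow> (nat \<Rightarrow> 'w \<Rightarrow> 'a::euclidean_space) \<Rightarrow> real" where
  "theta0 M X = (\<integral>\<omega>. norm (X 1 \<omega> - X 2 \<omega>) \<partial>M)"

definition g1 :: "'w measure \<Rightarrow> (nat \<Rightarrow> 'w \<Rightarrow> 'a::euclidean_space) \<Rightarrow> 'a \<Rightarrow> real" where
  "g1 M X x = (\<integral>\<omega>. norm (x + X 2 \<omega>) \<partial>M) - theta0 M X"

definition g2 :: "'w measure \<Rightarrow> (nat \<Rightarrow> 'w \<Rightarrow> 'a::euclidean_space) \<Rightarrow> 'a \<Rightarrow> real" where
  "g2 M X x = (\<integral>\<omega>. norm (x - X 2 \<omega>) \<partial>M) - theta0 M X"

text \<open>Chi-square distribution: the law of the sum of squares of \<open>k\<close> independent standard normal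
  variables.\<close>

definition chi_square :: "nat \<Rightarrow> real measure" where
  "chi_square k =
     distr (\<Pi>\<^sub>M i\<in>{..<k}. density lborel (\<lambda>x. ennreal (std_normal_density x))) borel
       (\<lambda>z. \<Sum>i<k. (z i)\<^sup>2)"

text \<open>Convergence in distribution of extended-real random variables to a law \<open>N\<close> on the reals.
  The law \<open>N\<close> gives no mass to \<open>\<plusminus>\<infinity>\<close>, so it suffices to test the distribution functions at
  real points; an atom of \<open>Z n\<close> at \<open>\<infinity>\<close> is counted at none of them.\<close>

definition converges_in_distr :: "'w measure \<Rightarrow> (nat \<Rightarrow> 'w \<Rightarrow> ereal) \<Rightarrow> real measure \<Rightarrow> bool" where
  "converges_in_distr M Z N \<longleftrightarrow>
     (\<forall>n. Z n \<in> borel_measurable M) \<and>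
     weak_conv (\<lambda>n x. measure M {\<omega> \<in> space M. Z n \<omega> \<le> ereal x}) (cdf N)"

end

theory Submission
  imports Defs "HOL-Real_Asymp.Real_Asymp"
begin

text \<open>Let \<open>V\<close>, \<open>W\<close> be the pseudo-values with means \<open>U1\<close>, \<open>U2\<close> and empirical variances \<open>S1\<close>, \<open>S2\<close>,
  and put \<open>s = S1/n1 + S2/n2\<close>, \<open>t = (U1 - U2)/s\<close>, \<open>Q = (U1 - U2)\<^sup>2/s\<close>. The Lagrange system need not be
  solved. The linear weights \<open>(1 - t (V i - U1)/n1)/n1\<close> and \<open>(1 + t (W j - U2)/n2)/n2\<close> have a common
  mean and bound \<open>l\<close> from above; the multipliers \<open>t/n1\<close> and \<open>-t/n2\<close>, inserted in the dual problem,
  bound \<open>l\<close> from below, and the unknown \<open>\<theta>\<close> cancels. Both bounds equal \<open>Q\<close> up to a relative error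
  controlled by \<open>max \<bar>V i - U1\<bar> / sqrt n1\<close> and \<open>max \<bar>W j - U2\<bar> / sqrt n2\<close>.

  Under the null hypothesis both kernels have the same projection \<open>g\<close>. The Hoeffding decomposition
  and the orthogonality of degenerate kernels show that \<open>U1 - U2\<close> is twice the difference of the two
  sample means of \<open>g\<close> up to a negligible error, that \<open>S1\<close> and \<open>S2\<close> tend to \<open>4 \<sigma>\<^sup>2\<close> in probability, and
  that the maximal deviations are negligible. So \<open>Q\<close> is asymptotically the square of a standardized
  difference of means, which is asymptotically standard normal.\<close>

section \<open>Deterministic bounds for the empirical likelihood ratio\<close>

text \<open>The number t is forced: \<open>t * s\<close> must be the difference of the two means for
  the tilted means to agree. To second order the tilting costs Q/2 in the log-likelihood; on the
  dual side the linear terms give -Q and the quadratic ones Q/2, so both sides meet at -Q/2, and -2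
  log turns this into Q. Three obstacles shape the rest. The ratio is a supremum over uncountably
  many weights and may be infinite, so its measurability rests on compactness and the final limit
  argument has to admit extended-real values. The second sample starts at an index that moves with
  n, so laws of large numbers are stated for arrays and in probability. Assumption (C1) gives two
  moments to the projections only, whereas the orthogonality arguments need square-integrable
  kernels; these moments are recovered from the projection. The standardized difference of means
  converges in law but not in probability. Its products with vanishing factors are therefore
  controlled through its bounded second moment.\<close>

lemma ln_one_plus_lower_bound:
  fixes x d :: real
  assumes x: "\<bar>x\<bar> \<le> d" and d: "d \<le> 1/2"
  shows "x - (1/2 + d) * x\<^sup>2 \<le> ln (1 + x)"
proof -
  have pos: "x - x\<^sup>2 / 2 \<le> ln (1 + x)" if "0 \<le> x" for x :: real
  proof -
    have "(\<lambda>x. ln (1 + x) - (x - x\<^sup>2 / 2)) 0 \<le> (\<lambda>x. ln (1 + x) - (x - x\<^sup>2 / 2)) x"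
    proof (rule DERIV_nonneg_imp_nondecreasing[OF that])
      fix y :: real assume y: "0 \<le> y" "y \<le> x"
      have "((\<lambda>x. ln (1 + x) - (x - x\<^sup>2 / 2)) has_real_derivative (1 / (1 + y) - (1 - y))) (at y)"
        using y by (auto intro!: derivative_eq_intros)
      moreover have "1 / (1 + y) - (1 - y) = y\<^sup>2 / (1 + y)"
        using y by (simp add: field_simps power2_eq_square)
      moreover have "0 \<le> y\<^sup>2 / (1 + y)"
        using y by simp
      ultimately show "\<exists>D. ((\<lambda>x. ln (1 + x) - (x - x\<^sup>2 / 2)) has_real_derivative D) (at y) \<and> 0 \<le> D"
        by (intro exI conjI) auto
    qed
    then show ?thesis by simp
  qed
  \<comment> \<open>The difference of the two sides has derivative
    \<open>y^2 * (2 - 3 * y) / (1 - y)\<close>, which is nonnegative for \<open>y \<le> 1/2\<close>.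
    The cubic term is needed on the negative side and is later absorbed into \<open>d\<close> times
    the square.\<close>
  have neg: "- x - x\<^sup>2 / 2 - x ^ 3 \<le> ln (1 - x)" if "0 \<le> x" "x \<le> 1/2" for x :: real
  proof -
    have "(\<lambda>x. ln (1 - x) - (- x - x\<^sup>2 / 2 - x ^ 3)) 0 \<le> (\<lambda>x. ln (1 - x) - (- x - x\<^sup>2 / 2 - x ^ 3)) x"
    proof (rule DERIV_nonneg_imp_nondecreasing[OF that(1)])
      fix y :: real assume y: "0 \<le> y" "y \<le> x"
      have "((\<lambda>x. ln (1 - x) - (- x - x\<^sup>2 / 2 - x ^ 3)) has_real_derivative (- 1 / (1 - y) + (1 + y + 3 * y\<^sup>2))) (at y)"
        using y that by (auto intro!: derivative_eq_intros)
      moreover have "- 1 / (1 - y) + (1 + y + 3 * y\<^sup>2) = y\<^sup>2 * (2 - 3 * y) / (1 - y)"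
        using y that by (simp add: field_simps power2_eq_square)
      moreover have "0 \<le> y\<^sup>2 * (2 - 3 * y) / (1 - y)"
        using y that by simp
      ultimately show "\<exists>D. ((\<lambda>x. ln (1 - x) - (- x - x\<^sup>2 / 2 - x ^ 3)) has_real_derivative D) (at y) \<and> 0 \<le> D"
        by (intro exI conjI) auto
    qed
    then show ?thesis by simp
  qed
  show ?thesis
  proof (cases "0 \<le> x")
    case True
    then have "0 \<le> d * x\<^sup>2" using x by simp
    with pos[OF True] show ?thesis by (simp add: algebra_simps)
  next
    case False
    have "(- x) * x\<^sup>2 \<le> d * x\<^sup>2" using x by (intro mult_right_mono) auto
    with neg[of "- x"] False x d show ?thesis
      by (simp add: algebra_simps power3_eq_cube power2_eq_square)
  qed
qed

lemma mean_deviation_zero: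
  fixes V :: "nat \<Rightarrow> real"
  assumes "m \<ge> 1" "c = (\<Sum>i=1..m. V i) / real m"
  shows "(\<Sum>i=1..m. V i - c) = 0"
  using assms by (simp add: sum_subtractf)

text \<open>Linear tilting of the uniform weights: a witness for the upper bound on the ratio.\<close>

lemma tilted_weights:
  fixes V :: "nat \<Rightarrow> real"
  assumes m: "m \<ge> 1" and c: "c = (\<Sum>i=1..m. V i) / real m"
    and small: "\<And>i. i \<in> {1..m} \<Longrightarrow> \<bar>a * (V i - c)\<bar> \<le> d" and d: "d \<le> 1/2"
  defines "p \<equiv> \<lambda>i. (1 + a * (V i - c)) / real m"
    and "S \<equiv> (\<Sum>i=1..m. (V i - c)\<^sup>2) / real m"
  shows "feasible_weights m V (c + a * S) p"
    and "exp (- ((1/2 + d) * a\<^sup>2 * real m * S)) \<le> real m ^ m * (\<Prod>i=1..m. p i)"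
proof -
  note z = mean_deviation_zero[OF m c]
  have pos: "0 < 1 + a * (V i - c)" if "i \<in> {1..m}" for i
    using small[OF that] d by linarith
  have 1: "(\<Sum>i=1..m. p i) = 1"
    using m z by (simp add: p_def flip: sum_divide_distrib)
      (simp add: sum.distrib flip: sum_distrib_left)
  have "(\<Sum>i=1..m. p i * (V i - c)) = ((\<Sum>i=1..m. V i - c) + a * (\<Sum>i=1..m. (V i - c)\<^sup>2)) / real m"
    by (simp add: p_def sum_divide_distrib sum_distrib_left add_divide_distrib power2_eq_square
        algebra_simps diff_divide_distrib sum.distrib sum_subtractf)
  then have 2: "(\<Sum>i=1..m. p i * (V i - c)) = a * S"
    using z by (simp add: S_def)
  have "(\<Sum>i=1..m. p i * (V i - (c + a * S))) = (\<Sum>i=1..m. p i * (V i - c)) - a * S * (\<Sum>i=1..m. p i)"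
    by (simp add: sum_distrib_left sum_subtractf[symmetric] algebra_simps)
  then show "feasible_weights m V (c + a * S) p"
    using 1 2 pos by (auto simp: feasible_weights_def p_def less_imp_le)
  have "(1/2 + d) * a\<^sup>2 * real m * S = (1/2 + d) * (\<Sum>i=1..m. (a * (V i - c))\<^sup>2)"
    using m by (simp add: S_def power_mult_distrib mult.assoc flip: sum_distrib_left)
  \<comment> \<open>The first-order terms cancel because the deviations from the mean sum to zero,
    so only a quadratic loss remains.\<close>
  then have "- ((1/2 + d) * a\<^sup>2 * real m * S) = (\<Sum>i=1..m. a * (V i - c) - (1/2 + d) * (a * (V i - c))\<^sup>2)"
    using z by (simp add: sum_subtractf flip: sum_distrib_left)
  also have "\<dots> \<le> (\<Sum>i=1..m. ln (1 + a * (V i - c)))"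
    by (intro sum_mono ln_one_plus_lower_bound small d)
  finally have "exp (- ((1/2 + d) * a\<^sup>2 * real m * S)) \<le> exp (\<Sum>i=1..m. ln (1 + a * (V i - c)))"
    by simp
  also have "\<dots> = (\<Prod>i=1..m. 1 + a * (V i - c))"
    using pos by (simp add: exp_sum)
  also have "\<dots> = real m ^ m * (\<Prod>i=1..m. p i)"
    using m by (simp add: p_def prod_dividef)
  finally show "exp (- ((1/2 + d) * a\<^sup>2 * real m * S)) \<le> real m ^ m * (\<Prod>i=1..m. p i)" .
qed

text \<open>Weak duality: \<open>a\<close> plays the role of the Lagrange multiplier, and \<open>y \<le> exp (y - 1)\<close> replaces
  the first-order conditions.\<close>

lemma feasible_weights_prod_le:
  fixes V :: "nat \<Rightarrow> real"
  assumes m: "m \<ge> 1" and c: "c = (\<Sum>i=1..m. V i) / real m"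
    and small: "\<And>i. i \<in> {1..m} \<Longrightarrow> \<bar>a * (V i - c)\<bar> \<le> d" and d: "d \<le> 1/2"
    and p: "feasible_weights m V \<theta> p"
  defines "S \<equiv> (\<Sum>i=1..m. (V i - c)\<^sup>2) / real m"
  shows "real m ^ m * (\<Prod>i=1..m. p i) \<le> exp (real m * a * (\<theta> - c) + (1/2 + d) * a\<^sup>2 * real m * S)"
proof -
  define T where "T = (\<Prod>i=1..m. 1 + a * (V i - c))"
  have pos: "0 < 1 + a * (V i - c)" if "i \<in> {1..m}" for i
    using small[OF that] d by linarith
  have p0: "0 \<le> p i" if "i \<in> {1..m}" for i using p that by (auto simp: feasible_weights_def)
  have p1: "(\<Sum>i=1..m. p i) = 1" and p2: "(\<Sum>i=1..m. p i * (V i - \<theta>)) = 0"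
    using p by (auto simp: feasible_weights_def)
  have T: "exp (- ((1/2 + d) * a\<^sup>2 * real m * S)) \<le> T"
    using tilted_weights(2)[OF m c small d] m
    by (simp add: T_def S_def prod_dividef)
  have "(\<Sum>i=1..m. p i * (V i - c)) = (\<Sum>i=1..m. p i * (V i - \<theta>)) + (\<theta> - c) * (\<Sum>i=1..m. p i)"
    by (simp add: sum_distrib_left sum.distrib[symmetric] algebra_simps)
  then have pc: "(\<Sum>i=1..m. p i * (V i - c)) = \<theta> - c" using p1 p2 by simp
  \<comment> \<open>Pairing with the factors \<open>1 + a * (V i - c)\<close> is what makes the
    exponent depend on \<open>p\<close> only through its total mass and its mean, both of which the
    constraints fix. The product \<open>T\<close> of these factors is then divided out by its lower
    bound.\<close>
  have "real m ^ m * (\<Prod>i=1..m. p i) * T = (\<Prod>i=1..m. real m * p i * (1 + a * (V i - c)))"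
    by (simp add: T_def prod.distrib)
  also have "\<dots> \<le> (\<Prod>i=1..m. exp (real m * p i * (1 + a * (V i - c)) - 1))"
  proof (rule prod_mono, safe)
    fix i assume i: "i \<in> {1..m}"
    show "0 \<le> real m * p i * (1 + a * (V i - c))" using pos[OF i] p0[OF i] by simp
    show "real m * p i * (1 + a * (V i - c)) \<le> exp (real m * p i * (1 + a * (V i - c)) - 1)"
      using exp_ge_add_one_self[of "real m * p i * (1 + a * (V i - c)) - 1"] by simp
  qed
  also have "\<dots> = exp (\<Sum>i=1..m. (real m * p i * (1 + a * (V i - c)) - 1))"
    by (simp add: exp_sum)
  also have "(\<Sum>i=1..m. (real m * p i * (1 + a * (V i - c)) - 1))
      = real m * (\<Sum>i=1..m. p i) + real m * a * (\<Sum>i=1..m. p i * (V i - c)) - real m"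
    by (simp add: sum_subtractf) (simp add: sum_distrib_left sum.distrib[symmetric] algebra_simps)
  also have "\<dots> = real m * a * (\<theta> - c)" using p1 pc by simp
  finally have *: "real m ^ m * (\<Prod>i=1..m. p i) * T \<le> exp (real m * a * (\<theta> - c))" .
  have "0 \<le> real m ^ m * (\<Prod>i=1..m. p i)"
    using p0 by (intro mult_nonneg_nonneg prod_nonneg) auto
  from mult_left_mono[OF T this] *
  have "real m ^ m * (\<Prod>i=1..m. p i) * exp (- ((1/2 + d) * a\<^sup>2 * real m * S)) \<le> exp (real m * a * (\<theta> - c))"
    by linarith
  then show ?thesis
    unfolding exp_minus exp_add by (simp only: divide_inverse[symmetric] pos_divide_le_eq[OF exp_gt_zero])
qed

lemma feasible_weights_prod_bounds:
  assumes "feasible_weights m V \<theta> p"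
  shows "0 \<le> (\<Prod>i=1..m. p i)" "(\<Prod>i=1..m. p i) \<le> 1"
proof -
  have p0: "\<And>i. i \<in> {1..m} \<Longrightarrow> 0 \<le> p i" and p1: "(\<Sum>i=1..m. p i) = 1"
    using assms by (auto simp: feasible_weights_def)
  have "p i \<le> 1" if "i \<in> {1..m}" for i
    using member_le_sum[OF that, of p] p0 p1 by auto
  with p0 show "0 \<le> (\<Prod>i=1..m. p i)" "(\<Prod>i=1..m. p i) \<le> 1"
    by (auto intro!: prod_nonneg prod_le_1)
qed

lemma likelihood_values_bounds:
  assumes "x \<in> likelihood_values m1 m2 V W"
  shows "0 \<le> x" "x \<le> 1"
  using assms by (auto simp: likelihood_values_def intro!: mult_nonneg_nonneg mult_le_one
      dest: feasible_weights_prod_bounds)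

lemma bdd_above_likelihood_values: "bdd_above (likelihood_values m1 m2 V W)"
  using likelihood_values_bounds(2) by (meson bdd_above.I)

text \<open>The error \<open>d\<close> enters only through the quadratic terms, whose total is
  \<open>(1/2 + d) * Q\<close> in the primal and in the dual alike. With the linear dual terms
  \<open>- Q\<close> this encloses the logarithm between \<open>- (1/2 + d) * Q\<close> and
  \<open>- (1/2 - d) * Q\<close>. Finiteness of the ratio comes from the exhibited feasible point,
  whose likelihood is positive.\<close>

lemma log_likelihood_ratio_approx:
  fixes V W :: "nat \<Rightarrow> real"
  assumes m: "m1 \<ge> 1" "m2 \<ge> 1"
    and c1: "c1 = (\<Sum>i=1..m1. V i) / real m1" and c2: "c2 = (\<Sum>i=1..m2. W i) / real m2"
    and S1: "S1 = (\<Sum>i=1..m1. (V i - c1)\<^sup>2) / real m1" and S2: "S2 = (\<Sum>i=1..m2. (W i - c2)\<^sup>2) / real m2"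
    and s: "s = S1 / real m1 + S2 / real m2" "s > 0"
    and t: "t = (c1 - c2) / s" and Q: "Q = (c1 - c2)\<^sup>2 / s"
    and d1: "\<And>i. i \<in> {1..m1} \<Longrightarrow> \<bar>t / real m1 * (V i - c1)\<bar> \<le> d"
    and d2: "\<And>i. i \<in> {1..m2} \<Longrightarrow> \<bar>t / real m2 * (W i - c2)\<bar> \<le> d"
    and d: "d \<le> 1/2"
  shows "\<exists>l. log_likelihood_ratio m1 m2 V W = ereal l \<and> \<bar>l - Q\<bar> \<le> 2 * d * Q"
proof -
  define N where "N = real m1 ^ m1 * real m2 ^ m2"
  have N: "N > 0" using m by (simp add: N_def)
  have d1': "\<bar>- t / real m1 * (V i - c1)\<bar> \<le> d" if "i \<in> {1..m1}" for i
    using d1[OF that] by (simp add: abs_mult)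
  have d2': "\<bar>- t / real m2 * (W i - c2)\<bar> \<le> d" if "i \<in> {1..m2}" for i
    using d2[OF that] by (simp add: abs_mult)
  have q1: "(1/2 + d) * (t / real m1)\<^sup>2 * real m1 * S1 + (1/2 + d) * (t / real m2)\<^sup>2 * real m2 * S2 = (1/2 + d) * Q"
  proof -
    have "(1/2 + d) * (t / real m1)\<^sup>2 * real m1 * S1 + (1/2 + d) * (t / real m2)\<^sup>2 * real m2 * S2 = (1/2 + d) * (t\<^sup>2 * s)"
      using m by (simp add: s(1) field_simps power2_eq_square)
    also have "t\<^sup>2 * s = Q" using s(2) by (simp add: t Q power2_eq_square)
    finally show ?thesis .
  qed
  \<comment> \<open>Optimal weights have the form
    \<open>1 / (m * (1 + \<lambda> * (V i - \<theta>)))\<close>, so to first order the tilt is minus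
    the multiplier. Hence the first sample carries \<open>- t / m1\<close> here and
    \<open>t / m1\<close> in the dual bound, and the second sample has the opposite signs.\<close>
  define p where "p = (\<lambda>i. (1 + (- t / real m1) * (V i - c1)) / real m1)"
  define q where "q = (\<lambda>i. (1 + t / real m2 * (W i - c2)) / real m2)"
  note A = tilted_weights[OF m(1) c1 d1' d, folded S1 p_def, simplified]
  note B = tilted_weights[OF m(2) c2 d2 d, folded S2 q_def, simplified]
  have "c1 + (- t / real m1) * S1 = c2 + t / real m2 * S2"
  proof -
    have "t * s = c1 - c2" using s(2) by (simp add: t)
    then show ?thesis by (simp add: s(1) algebra_simps)
  qed
  then have mem: "(\<Prod>i=1..m1. p i) * (\<Prod>i=1..m2. q i) \<in> likelihood_values m1 m2 V W"
    using A(1) B(1) unfolding likelihood_values_def by auto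
  have "exp (- ((1/2 + d) * (t / real m1)\<^sup>2 * real m1 * S1)) * exp (- ((1/2 + d) * (t / real m2)\<^sup>2 * real m2 * S2))
      \<le> (real m1 ^ m1 * (\<Prod>i=1..m1. p i)) * (real m2 ^ m2 * (\<Prod>i=1..m2. q i))"
    using A(2) B(2) by (intro mult_mono) (auto intro: order_trans[OF exp_ge_zero])
  then have low: "exp (- ((1/2 + d) * Q)) \<le> N * ((\<Prod>i=1..m1. p i) * (\<Prod>i=1..m2. q i))"
    unfolding N_def exp_add[symmetric] q1[symmetric] by (simp add: algebra_simps)
  have up: "N * x \<le> exp (- ((1/2 - d) * Q))" if "x \<in> likelihood_values m1 m2 V W" for x
  proof -
    from that obtain p q \<theta> where x: "x = (\<Prod>i=1..m1. p i) * (\<Prod>j=1..m2. q j)"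
      and f: "feasible_weights m1 V \<theta> p" "feasible_weights m2 W \<theta> q"
      by (auto simp: likelihood_values_def)
    note C = feasible_weights_prod_le[OF m(1) c1 d1 d f(1), folded S1, simplified]
    note D = feasible_weights_prod_le[OF m(2) c2 d2' d f(2), folded S2, simplified]
    have "N * x = (real m1 ^ m1 * (\<Prod>i=1..m1. p i)) * (real m2 ^ m2 * (\<Prod>i=1..m2. q i))"
      by (simp add: N_def x)
    also have "\<dots> \<le> exp (real m1 * (t / real m1) * (\<theta> - c1) + (1/2 + d) * (t / real m1)\<^sup>2 * real m1 * S1)
        * exp (real m2 * (- t / real m2) * (\<theta> - c2) + (1/2 + d) * (- t / real m2)\<^sup>2 * real m2 * S2)"
      using C D m feasible_weights_prod_bounds(1)[OF f(2)] by (intro mult_mono) auto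
    also have "\<dots> = exp (t * (\<theta> - c1) - t * (\<theta> - c2)
        + ((1/2 + d) * (t / real m1)\<^sup>2 * real m1 * S1 + (1/2 + d) * (t / real m2)\<^sup>2 * real m2 * S2))"
      using m by (simp add: exp_add[symmetric])
    also have "\<dots> = exp (- ((1/2 - d) * Q))"
    proof -
      have "t * (\<theta> - c1) - t * (\<theta> - c2) = - Q"
        by (simp add: t Q power2_eq_square algebra_simps diff_divide_distrib add_divide_distrib)
      then show ?thesis unfolding q1 by (simp add: algebra_simps)
    qed
    finally show ?thesis .
  qed
  have ne: "likelihood_values m1 m2 V W \<noteq> {}" using mem by auto
  define L where "L = max_likelihood m1 m2 V W"
  have L: "L = Sup (likelihood_values m1 m2 V W)" using ne by (simp add: L_def max_likelihood_def)
  have "(\<Prod>i=1..m1. p i) * (\<Prod>i=1..m2. q i) \<le> L"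
    unfolding L by (intro cSup_upper mem bdd_above_likelihood_values)
  then have lowL: "exp (- ((1/2 + d) * Q)) \<le> N * L"
    using low N by (meson mult_left_mono order_trans less_imp_le)
  have "L \<le> exp (- ((1/2 - d) * Q)) / N"
    unfolding L using up N by (intro cSup_least ne) (simp add: field_simps)
  then have upL: "N * L \<le> exp (- ((1/2 - d) * Q))" using N by (simp add: field_simps)
  have NL: "N * L > 0" using lowL exp_gt_zero less_le_trans by blast
  then have "log_likelihood_ratio m1 m2 V W = ereal (- 2 * ln (N * L))"
    by (auto simp: log_likelihood_ratio_def L_def N_def)
  moreover have "- ((1/2 + d) * Q) \<le> ln (N * L)" "ln (N * L) \<le> - ((1/2 - d) * Q)"
    using lowL upL NL by (simp_all add: ln_ge_iff) (metis exp_gt_zero ln_exp ln_le_cancel_iff)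
  then have "\<bar>- 2 * ln (N * L) - Q\<bar> \<le> 2 * d * Q"
    by (simp add: abs_le_iff algebra_simps)
  ultimately show ?thesis by blast
qed

lemma max_likelihood_nonneg: "0 \<le> max_likelihood m1 m2 V W"
  using likelihood_values_bounds(1) bdd_above_likelihood_values
  by (auto simp: max_likelihood_def intro: cSup_upper2)

section \<open>Measurability of the ratio\<close>

text \<open>Prepares the measurability of a supremum over uncountably many weights:
  \<open>\<theta>\<close> disappears into the equality of two weighted means, the slack
  \<open>1 / real (Suc k)\<close> replaces the strict inequality by countably many closed
  conditions, and the weights are confined to a compact cube.\<close>

lemma likelihood_values_gt_iff:
  "(\<exists>x\<in>likelihood_values m1 m2 V W. c < x) \<longleftrightarrow>
     (\<exists>k::nat. \<exists>p\<in>(UNIV \<rightarrow> {0..1}). \<exists>q\<in>(UNIV \<rightarrow> {0..1}). (\<Sum>i=1..m1. p i) = 1 \<and> (\<Sum>i=1..m2. q i) = 1 \<and>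
        (\<Sum>i=1..m1. p i * V i) = (\<Sum>i=1..m2. q i * W i) \<and>
        c + 1 / real (Suc k) \<le> (\<Prod>i=1..m1. p i) * (\<Prod>i=1..m2. q i))" (is "?L \<longleftrightarrow> ?R")
proof
  assume ?L
  then obtain p q \<theta> where f: "feasible_weights m1 V \<theta> p" "feasible_weights m2 W \<theta> q"
    and c: "c < (\<Prod>i=1..m1. p i) * (\<Prod>j=1..m2. q j)"
    by (auto simp: likelihood_values_def)
  have le1: "p i \<le> 1" if "feasible_weights m V \<theta> p" "i \<in> {1..m}" for m V p and i :: nat
    using member_le_sum[OF that(2), of p] that(1) by (auto simp: feasible_weights_def)
  have mean: "(\<Sum>i=1..m. p i * V i) = \<theta>" if "feasible_weights m V \<theta> p" for m V p
  proof -
    have "(\<Sum>i=1..m. p i * (V i - \<theta>)) = (\<Sum>i=1..m. p i * V i) - \<theta> * (\<Sum>i=1..m. p i)"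
      by (simp add: sum_distrib_left sum_subtractf[symmetric] algebra_simps)
    with that show ?thesis by (simp add: feasible_weights_def)
  qed
  obtain k where "1 / real (Suc k) < (\<Prod>i=1..m1. p i) * (\<Prod>j=1..m2. q j) - c"
    using c nat_approx_posE[of "(\<Prod>i=1..m1. p i) * (\<Prod>j=1..m2. q j) - c"] by auto
  then have k: "c + 1 / real (Suc k) \<le> (\<Prod>i=1..m1. p i) * (\<Prod>j=1..m2. q j)" by simp
  \<comment> \<open>Feasibility says nothing about entries outside the index ranges; setting them to
    0 puts the weights into the cube.\<close>
  define p' q' where "p' = (\<lambda>i. if i \<in> {1..m1} then p i else 0)" and "q' = (\<lambda>i. if i \<in> {1..m2} then q i else 0)"
  have "(\<Sum>i=1..m1. p' i) = 1" "(\<Sum>i=1..m2. q' i) = 1"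
    "(\<Sum>i=1..m1. p' i * V i) = (\<Sum>i=1..m2. q' i * W i)"
    "c + 1 / real (Suc k) \<le> (\<Prod>i=1..m1. p' i) * (\<Prod>i=1..m2. q' i)"
    using f k mean[OF f(1)] mean[OF f(2)] by (simp_all add: p'_def q'_def feasible_weights_def)
  moreover have "p' \<in> UNIV \<rightarrow> {0..1}" "q' \<in> UNIV \<rightarrow> {0..1}"
    using f le1[OF f(1)] le1[OF f(2)] by (auto simp: p'_def q'_def feasible_weights_def)
  ultimately show ?R by (intro exI[of _ k] bexI[of _ p'] bexI[of _ q'] conjI)
next
  assume ?R
  then obtain k p q where *: "p \<in> UNIV \<rightarrow> {0..1}" "q \<in> UNIV \<rightarrow> {0..1}"
    "(\<Sum>i=1..m1. p i) = 1" "(\<Sum>i=1..m2. q i) = 1"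
    "(\<Sum>i=1..m1. p i * V i) = (\<Sum>i=1..m2. q i * W i)"
    "c + 1 / real (Suc k) \<le> (\<Prod>i=1..m1. p i) * (\<Prod>i=1..m2. q i)" by blast
  define \<theta> where "\<theta> = (\<Sum>i=1..m1. p i * V i)"
  have "(\<Sum>i=1..m. p i * (V i - \<theta>)) = (\<Sum>i=1..m. p i * V i) - \<theta> * (\<Sum>i=1..m. p i)" for m V p
    by (simp add: sum_distrib_left sum_subtractf[symmetric] algebra_simps)
  from this[of p V m1] this[of q W m2]
  have "(\<Sum>i=1..m1. p i * (V i - \<theta>)) = 0" "(\<Sum>i=1..m2. q i * (W i - \<theta>)) = 0"
    using * by (simp_all add: \<theta>_def)
  then have fw: "feasible_weights m1 V \<theta> p" "feasible_weights m2 W \<theta> q"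
    using * by (auto simp: feasible_weights_def Pi_iff)
  have "(\<Prod>i=1..m1. p i) * (\<Prod>i=1..m2. q i) \<in> likelihood_values m1 m2 V W"
    unfolding likelihood_values_def by (intro CollectI exI conjI, rule refl) (rule fw)+
  moreover have "c < c + 1 / real (Suc k)" by simp
  then have "c < (\<Prod>i=1..m1. p i) * (\<Prod>i=1..m2. q i)" using *(6) by linarith
  ultimately show ?L by (rule bexI[rotated])
qed

lemma compact_unit_cube: "compact (UNIV \<rightarrow> {0..1} :: (nat \<Rightarrow> real) set)"
proof -
  have "compactin (product_topology (\<lambda>_::nat. euclidean :: real topology) UNIV) (PiE UNIV (\<lambda>_. {0..1}))"
    by (subst compactin_PiE) auto
  then show ?thesis
    by (simp add: euclidean_product_topology PiE_UNIV_domain)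
qed

text \<open>The projection of a closed set along a compact factor is closed. The compact factor
  consists of the weights, the remaining coordinates are the data, and a limit of data points keeps
  a witness because the witnesses have a convergent subsequence.\<close>

lemma closed_likelihood_level:
  "closed {(V :: nat \<Rightarrow> real, W :: nat \<Rightarrow> real). \<exists>p\<in>(UNIV \<rightarrow> {0..1}). \<exists>q\<in>(UNIV \<rightarrow> {0..1}).
     (\<Sum>i=1..m1. p i) = 1 \<and> (\<Sum>i=1..m2. q i) = 1 \<and>
     (\<Sum>i=1..m1. p i * V i) = (\<Sum>i=1..m2. q i * W i) \<and>
     c \<le> (\<Prod>i=1..m1. p i) * (\<Prod>i=1..m2. q i)}" (is "closed ?E")
proof -
  define C where "C = {z :: ((nat \<Rightarrow> real) \<times> (nat \<Rightarrow> real)) \<times> ((nat \<Rightarrow> real) \<times> (nat \<Rightarrow> real)).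
      (\<Sum>i=1..m1. fst (snd z) i) = 1 \<and> (\<Sum>i=1..m2. snd (snd z) i) = 1 \<and>
      (\<Sum>i=1..m1. fst (snd z) i * fst (fst z) i) = (\<Sum>i=1..m2. snd (snd z) i * snd (fst z) i) \<and>
      c \<le> (\<Prod>i=1..m1. fst (snd z) i) * (\<Prod>i=1..m2. snd (snd z) i)}"
  have ev: "continuous_on UNIV (\<lambda>z::'z::topological_space. f z (i::nat) :: real)" if "continuous_on UNIV f" for f i
    using that by (rule continuous_on_product_then_coordinatewise)
  have clo: "closed C" unfolding C_def
    by (intro closed_Collect_conj closed_Collect_eq closed_Collect_le continuous_intros ev)
  show ?thesis
  proof (unfold closed_sequential_limits, intro allI impI)
    fix z and v :: "(nat \<Rightarrow> real) \<times> (nat \<Rightarrow> real)"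
    obtain V W where v: "v = (V, W)" by (cases v)
    assume "(\<forall>n. z n \<in> ?E) \<and> z \<longlonglongrightarrow> v"
    then have z: "\<forall>n. z n \<in> ?E" "z \<longlonglongrightarrow> (V, W)"
      unfolding v by (rule conjunct1, rule conjunct2)
    let ?K = "(UNIV \<rightarrow> {0..1} :: (nat \<Rightarrow> real) set) \<times> (UNIV \<rightarrow> {0..1} :: (nat \<Rightarrow> real) set)"
    have "\<exists>k\<in>?K. (z n, k) \<in> C" for n
    proof -
      obtain V' W' where zn: "z n = (V', W')" by (cases "z n")
      have "(V', W') \<in> ?E" using z(1)[rule_format, of n] unfolding zn .
      then obtain p q where "p \<in> UNIV \<rightarrow> {0..1}" "q \<in> UNIV \<rightarrow> {0..1}"
        "(\<Sum>i=1..m1. p i) = 1" "(\<Sum>i=1..m2. q i) = 1"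
        "(\<Sum>i=1..m1. p i * V' i) = (\<Sum>i=1..m2. q i * W' i)"
        "c \<le> (\<Prod>i=1..m1. p i) * (\<Prod>i=1..m2. q i)"
        by (clarsimp simp only: mem_Collect_eq prod.case)
      then show ?thesis unfolding zn C_def by (intro bexI[of _ "(p, q)"]) simp_all
    qed
    then obtain k where k: "\<And>n. k n \<in> ?K" "\<And>n. (z n, k n) \<in> C" by metis
    have "seq_compact ?K"
      by (intro compact_imp_seq_compact compact_Times compact_unit_cube)
    then obtain l r where l: "l \<in> ?K" "strict_mono (r :: nat \<Rightarrow> nat)" "(k \<circ> r) \<longlonglongrightarrow> l"
      using k(1) by (blast elim: seq_compactE)
    have "(\<lambda>n. (z (r n), k (r n))) \<longlonglongrightarrow> ((V, W), l)"
      using LIMSEQ_subseq_LIMSEQ[OF z(2) l(2)] l(3) by (intro tendsto_Pair) (auto simp: o_def)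
    then have C: "((V, W), l) \<in> C"
      by (rule closed_sequentially[OF clo k(2)])
    obtain p q where pq: "l = (p, q)" by (cases l)
    then have "p \<in> UNIV \<rightarrow> {0..1}" "q \<in> UNIV \<rightarrow> {0..1}" using l(1) by simp_all
    with C show "v \<in> ?E"
      unfolding C_def pq v by (simp only: mem_Collect_eq prod.case fst_conv snd_conv) blast
  qed
qed

lemma borel_measurable_max_likelihood:
  assumes V: "\<And>i. (\<lambda>\<omega>. V \<omega> i) \<in> borel_measurable M" and W: "\<And>i. (\<lambda>\<omega>. W \<omega> i) \<in> borel_measurable M"
  shows "(\<lambda>\<omega>. max_likelihood m1 m2 (V \<omega>) (W \<omega>)) \<in> borel_measurable M"
proof (rule borel_measurable_iff_greater[THEN iffD2], rule allI)
  fix c :: real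
  define E where "E = (\<lambda>k. {(V :: nat \<Rightarrow> real, W :: nat \<Rightarrow> real). \<exists>p\<in>(UNIV \<rightarrow> {0..1}). \<exists>q\<in>(UNIV \<rightarrow> {0..1}).
     (\<Sum>i=1..m1. p i) = 1 \<and> (\<Sum>i=1..m2. q i) = 1 \<and>
     (\<Sum>i=1..m1. p i * V i) = (\<Sum>i=1..m2. q i * W i) \<and>
     c + 1 / real (Suc k) \<le> (\<Prod>i=1..m1. p i) * (\<Prod>i=1..m2. q i)})"
  have VW: "(\<lambda>\<omega>. (V \<omega>, W \<omega>)) \<in> borel_measurable M"
    by (intro borel_measurable_Pair measurable_coordinatewise_then_product V W)
  show "{\<omega> \<in> space M. c < max_likelihood m1 m2 (V \<omega>) (W \<omega>)} \<in> sets M"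
  proof (cases "c < 0")
    case True
    then have "c < max_likelihood m1 m2 v w" for v w
      using max_likelihood_nonneg[of m1 m2 v w] by linarith
    then show ?thesis by simp
  next
    case False
    \<comment> \<open>For nonnegative \<open>c\<close> the conventional value 0 at an empty set
      agrees with the absence of a value above \<open>c\<close>.\<close>
    have "c < max_likelihood m1 m2 v w \<longleftrightarrow> (\<exists>x\<in>likelihood_values m1 m2 v w. c < x)" for v w
      using False bdd_above_likelihood_values[of m1 m2 v w]
      by (cases "likelihood_values m1 m2 v w = {}") (auto simp: max_likelihood_def less_cSup_iff)
    then have "c < max_likelihood m1 m2 v w \<longleftrightarrow> (\<exists>k. (v, w) \<in> E k)" for v w
      by (simp only: likelihood_values_gt_iff E_def mem_Collect_eq prod.case)
    then have "{\<omega> \<in> space M. c < max_likelihood m1 m2 (V \<omega>) (W \<omega>)}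
      = (\<Union>k. (\<lambda>\<omega>. (V \<omega>, W \<omega>)) -` E k \<inter> space M)"
      by auto
    also have "\<dots> \<in> sets M"
      unfolding E_def
      by (intro sets.countable_UN image_subsetI measurable_sets[OF VW] borel_closed closed_likelihood_level)
    finally show ?thesis .
  qed
qed

lemma borel_measurable_log_likelihood_ratio:
  assumes "\<And>i. (\<lambda>\<omega>. V \<omega> i) \<in> borel_measurable M" "\<And>i. (\<lambda>\<omega>. W \<omega> i) \<in> borel_measurable M"
  shows "(\<lambda>\<omega>. log_likelihood_ratio m1 m2 (V \<omega>) (W \<omega>)) \<in> borel_measurable M"
proof -
  note [measurable] = borel_measurable_max_likelihood[OF assms]
  show ?thesis unfolding log_likelihood_ratio_def by measurable
qed

lemma borel_measurable_pseudo_value: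
  fixes h :: "'a::second_countable_topology \<Rightarrow> 'a \<Rightarrow> real"
  assumes [measurable]: "(\<lambda>(x, y). h x y) \<in> borel_measurable (borel \<Otimes>\<^sub>M borel)"
    and X: "\<And>i. i \<ge> 1 \<Longrightarrow> X i \<in> borel_measurable M"
  shows "(\<lambda>\<omega>. pseudo_value h (\<lambda>i. X i \<omega>) m i) \<in> borel_measurable M"
proof -
  have "(\<lambda>\<omega>. U_stat h (\<lambda>i. X i \<omega>) I) \<in> borel_measurable M" if "I \<subseteq> {1..m}" for I
    unfolding U_stat_def split_def
  proof (intro borel_measurable_divide borel_measurable_sum borel_measurable_const)
    fix p assume "p \<in> {p. fst p \<in> I \<and> snd p \<in> I \<and> fst p < snd p}"
    with that have "fst p \<ge> 1" "snd p \<ge> 1" by auto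
    note [measurable] = this[THEN X]
    show "(\<lambda>\<omega>. h (X (fst p) \<omega>) (X (snd p) \<omega>)) \<in> borel_measurable M" by measurable
  qed
  then show ?thesis
    unfolding pseudo_value_def by (intro borel_measurable_diff borel_measurable_times borel_measurable_const) auto
qed

section \<open>Convergence in probability as convergence along a filter\<close>

text \<open>Convergence in probability of a sequence of random elements \<open>f n\<close> is convergence of
  \<open>\<lambda>(n, \<omega>). f n \<omega>\<close> along the following filter. Exceptional sets are only required to be covered by
  measurable sets of small measure.\<close>

definition in_prob :: "'w measure \<Rightarrow> (nat \<times> 'w) filter" where
  "in_prob M = Abs_filter (\<lambda>P. \<forall>e>0. \<forall>\<^sub>F n in sequentially.
     \<exists>A\<in>sets M. measure M A \<le> e \<and> (\<forall>\<omega>\<in>space M - A. P (n, \<omega>)))"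

lemma (in prob_space) eventually_in_prob:
  "eventually P (in_prob M) \<longleftrightarrow> (\<forall>e>0. \<forall>\<^sub>F n in sequentially.
     \<exists>A\<in>sets M. prob A \<le> e \<and> (\<forall>\<omega>\<in>space M - A. P (n, \<omega>)))"
  unfolding in_prob_def
proof (rule eventually_Abs_filter, rule is_filter.intro, goal_cases)
  case 1
  show ?case by (auto intro!: bexI[of _ "{}"])
next
  case (2 P Q)
  show ?case
  proof (intro allI impI)
    fix e :: real assume "e > 0"
    then have "e / 2 > 0" by simp
    with 2 have "\<forall>\<^sub>F n in sequentially. \<exists>A\<in>sets M. prob A \<le> e / 2 \<and> (\<forall>\<omega>\<in>space M - A. P (n, \<omega>))"
      "\<forall>\<^sub>F n in sequentially. \<exists>A\<in>sets M. prob A \<le> e / 2 \<and> (\<forall>\<omega>\<in>space M - A. Q (n, \<omega>))" by blast+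
    then show "\<forall>\<^sub>F n in sequentially. \<exists>A\<in>sets M. prob A \<le> e \<and> (\<forall>\<omega>\<in>space M - A. P (n, \<omega>) \<and> Q (n, \<omega>))"
    proof eventually_elim
      case (elim n)
      then obtain A B where A: "A \<in> sets M" "prob A \<le> e / 2" "\<forall>\<omega>\<in>space M - A. P (n, \<omega>)"
        and B: "B \<in> sets M" "prob B \<le> e / 2" "\<forall>\<omega>\<in>space M - B. Q (n, \<omega>)" by blast
      then have "prob (A \<union> B) \<le> e"
        using measure_Un_le[of A M B] by linarith
      with A B show ?case by (intro bexI[of _ "A \<union> B"]) auto
    qed
  qed
next
  case (3 P Q)
  show ?case
  proof (intro allI impI)
    fix e :: real assume "e > 0"
    with 3(2) have "\<forall>\<^sub>F n in sequentially. \<exists>A\<in>sets M. prob A \<le> e \<and> (\<forall>\<omega>\<in>space M - A. P (n, \<omega>))" by blast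
    then show "\<forall>\<^sub>F n in sequentially. \<exists>A\<in>sets M. prob A \<le> e \<and> (\<forall>\<omega>\<in>space M - A. Q (n, \<omega>))"
      by eventually_elim (use 3(1) in blast)
  qed
qed

context prob_space
begin

lemma filterlim_fst_in_prob: "filterlim fst sequentially (in_prob M)"
  unfolding filterlim_iff
proof (intro allI impI)
  fix P :: "nat \<Rightarrow> bool" assume "eventually P sequentially"
  then show "\<forall>\<^sub>F x in in_prob M. P (fst x)"
    unfolding eventually_in_prob by (auto elim!: eventually_mono intro!: bexI[of _ "{}"])
qed

lemma tendsto_in_prob_deterministic:
  "a \<longlonglongrightarrow> c \<Longrightarrow> ((\<lambda>x. a (fst x)) \<longlongrightarrow> c) (in_prob M)"
  by (rule filterlim_compose[OF _ filterlim_fst_in_prob])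

lemma eventually_in_probI:
  assumes "\<And>n. {\<omega>\<in>space M. \<not> P (n, \<omega>)} \<in> sets M"
    and "(\<lambda>n. prob {\<omega>\<in>space M. \<not> P (n, \<omega>)}) \<longlonglongrightarrow> 0"
  shows "eventually P (in_prob M)"
  unfolding eventually_in_prob
proof (intro allI impI)
  fix e :: real assume "e > 0"
  with assms(2) have "\<forall>\<^sub>F n in sequentially. prob {\<omega>\<in>space M. \<not> P (n, \<omega>)} < e"
    by (simp add: order_tendstoD(2))
  then show "\<forall>\<^sub>F n in sequentially. \<exists>A\<in>sets M. prob A \<le> e \<and> (\<forall>\<omega>\<in>space M - A. P (n, \<omega>))"
    by eventually_elim (use assms(1) in \<open>auto intro!: bexI[of _ "{\<omega>\<in>space M. \<not> P (_, \<omega>)}"]\<close>)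
qed

lemma tendsto_in_prob_of_L1:
  fixes f :: "nat \<Rightarrow> 'a \<Rightarrow> real"
  assumes int: "\<forall>\<^sub>F n in sequentially. integrable M (f n)"
    and lim: "\<forall>\<^sub>F n in sequentially. expectation (\<lambda>\<omega>. \<bar>f n \<omega>\<bar>) \<le> b n" "b \<longlonglongrightarrow> 0"
  shows "((\<lambda>x. f (fst x) (snd x)) \<longlongrightarrow> 0) (in_prob M)"
proof (rule tendstoI)
  fix d :: real assume d: "d > 0"
  show "\<forall>\<^sub>F x in in_prob M. dist (f (fst x) (snd x)) 0 < d"
    unfolding eventually_in_prob
  proof (intro allI impI)
    fix e :: real assume e: "e > 0"
    with d lim(2) have "\<forall>\<^sub>F n in sequentially. b n < e * d"
      by (simp add: order_tendstoD(2))
    with int lim(1) show "\<forall>\<^sub>F n in sequentially. \<exists>A\<in>sets M. prob A \<le> e \<and>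
        (\<forall>\<omega>\<in>space M - A. dist (f (fst (n, \<omega>)) (snd (n, \<omega>))) 0 < d)"
    proof eventually_elim
      case (elim n)
      have [measurable]: "f n \<in> borel_measurable M" using elim(1) by simp
      have "prob {\<omega>\<in>space M. d \<le> \<bar>f n \<omega>\<bar>} \<le> expectation (\<lambda>\<omega>. \<bar>f n \<omega>\<bar>) / d"
        by (rule integral_Markov_inequality_measure[where A = "{}"]) (use d elim in auto)
      also have "\<dots> \<le> e" using d elim by (simp add: field_simps)
      finally show ?case
        by (intro bexI[of _ "{\<omega>\<in>space M. d \<le> \<bar>f n \<omega>\<bar>}"]) auto
    qed
  qed
qed

lemma tendsto_in_prob_of_L2:
  fixes f :: "nat \<Rightarrow> 'a \<Rightarrow> real"
  assumes int: "\<forall>\<^sub>F n in sequentially. integrable M (\<lambda>\<omega>. (f n \<omega>)\<^sup>2)"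
    and lim: "\<forall>\<^sub>F n in sequentially. expectation (\<lambda>\<omega>. (f n \<omega>)\<^sup>2) \<le> b n" "b \<longlonglongrightarrow> 0"
  shows "((\<lambda>x. f (fst x) (snd x)) \<longlongrightarrow> 0) (in_prob M)"
proof -
  have "((\<lambda>x. (f (fst x) (snd x))\<^sup>2) \<longlongrightarrow> 0) (in_prob M)"
    using int lim(1) by (intro tendsto_in_prob_of_L1[OF _ _ lim(2)]) simp_all
  then have "((\<lambda>x. sqrt ((f (fst x) (snd x))\<^sup>2)) \<longlongrightarrow> sqrt 0) (in_prob M)"
    by (rule tendsto_real_sqrt)
  then show ?thesis by (simp add: tendsto_rabs_zero_iff)
qed

text \<open>Bounded second moments make the sequence \<open>Z\<close> tight, by Chebyshev's
  inequality, and a tight factor times a null factor is null. This is the form in which Slutsky's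
  argument is applied to the standardized difference of means.\<close>

lemma tendsto_in_prob_L2_bounded_mult:
  fixes Z :: "nat \<Rightarrow> 'a \<Rightarrow> real"
  assumes f: "(f \<longlongrightarrow> 0) (in_prob M)"
    and [measurable]: "\<And>n. Z n \<in> borel_measurable M"
    and Z: "\<And>n. integrable M (\<lambda>\<omega>. (Z n \<omega>)\<^sup>2)" "\<And>n. expectation (\<lambda>\<omega>. (Z n \<omega>)\<^sup>2) \<le> C"
  shows "((\<lambda>x. Z (fst x) (snd x) * f x) \<longlongrightarrow> 0) (in_prob M)"
proof (rule tendstoI)
  fix d :: real assume d: "d > 0"
  show "\<forall>\<^sub>F x in in_prob M. dist (Z (fst x) (snd x) * f x) 0 < d"
    unfolding eventually_in_prob
  proof (intro allI impI)
    fix e :: real assume e: "e > 0"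
    \<comment> \<open>Chosen so that Chebyshev's inequality at level \<open>K\<close> leaves exactly
      \<open>e / 2\<close>; the summand 1 keeps \<open>K\<close> positive whatever the value of
      \<open>C\<close>.\<close>
    define K where "K = sqrt (2 * (\<bar>C\<bar> + 1) / e)"
    have K: "K > 0" "K\<^sup>2 = 2 * (\<bar>C\<bar> + 1) / e" using e by (auto simp: K_def)
    have "\<forall>\<^sub>F x in in_prob M. dist (f x) 0 < d / K"
      using f d K by (intro tendstoD) auto
    then have "\<forall>\<^sub>F n in sequentially. \<exists>A\<in>sets M. prob A \<le> e / 2 \<and> (\<forall>\<omega>\<in>space M - A. dist (f (n, \<omega>)) 0 < d / K)"
      using e unfolding eventually_in_prob by (meson half_gt_zero)
    then show "\<forall>\<^sub>F n in sequentially. \<exists>A\<in>sets M. prob A \<le> e \<and>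
        (\<forall>\<omega>\<in>space M - A. dist (Z (fst (n, \<omega>)) (snd (n, \<omega>)) * f (n, \<omega>)) 0 < d)"
    proof eventually_elim
      case (elim n)
      then obtain A where A: "A \<in> sets M" "prob A \<le> e / 2" "\<forall>\<omega>\<in>space M - A. dist (f (n, \<omega>)) 0 < d / K" by blast
      define B where "B = {\<omega>\<in>space M. K\<^sup>2 \<le> (Z n \<omega>)\<^sup>2}"
      have [measurable]: "B \<in> sets M" unfolding B_def by measurable
      have "prob B \<le> expectation (\<lambda>\<omega>. (Z n \<omega>)\<^sup>2) / K\<^sup>2"
        unfolding B_def by (rule integral_Markov_inequality_measure[where A = "{}"]) (use K(1) Z in auto)
      also have "\<dots> \<le> (\<bar>C\<bar> + 1) / K\<^sup>2" using Z(2)[of n] by (intro divide_right_mono) auto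
      also have "\<dots> = e / 2" unfolding K(2) using e by (simp add: field_simps)
      finally have "prob (A \<union> B) \<le> e"
        using A measure_Un_le[of A M B] by simp
      moreover have "dist (Z n \<omega> * f (n, \<omega>)) 0 < d" if "\<omega> \<in> space M - (A \<union> B)" for \<omega>
      proof -
        have "(Z n \<omega>)\<^sup>2 < K\<^sup>2" using that by (auto simp: B_def)
        then have "\<bar>Z n \<omega>\<bar> < K" using K by (metis abs_of_pos power2_less_imp_less power2_abs less_imp_le)
        moreover have "\<bar>f (n, \<omega>)\<bar> < d / K" using A(3) that by auto
        ultimately have "\<bar>Z n \<omega>\<bar> * \<bar>f (n, \<omega>)\<bar> < K * (d / K)"
          by (intro mult_strict_mono) (use K in auto)
        then show ?thesis using K by (simp add: abs_mult)
      qed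
      ultimately show ?case using A(1) by (intro bexI[of _ "A \<union> B"]) auto
    qed
  qed
qed

text \<open>Outside a set of small probability \<open>Y n\<close> is finite and within
  \<open>h\<close> of \<open>T n\<close>, so its distribution function at \<open>y\<close> is
  squeezed between those of \<open>T n\<close> at \<open>y - h\<close> and \<open>y + h\<close>.
  Since \<open>lim\<close> is available at every point, only continuity of \<open>G\<close> at
  \<open>y\<close> itself restricts \<open>h\<close>.\<close>

lemma cdf_tendsto_of_in_prob:
  fixes Y :: "nat \<Rightarrow> 'a \<Rightarrow> ereal" and T :: "nat \<Rightarrow> 'a \<Rightarrow> real" and G :: "real \<Rightarrow> real"
  assumes Y [measurable]: "\<And>n. Y n \<in> borel_measurable M" and T [measurable]: "\<And>n. T n \<in> borel_measurable M"
    and fin: "\<forall>\<^sub>F x in in_prob M. Y (fst x) (snd x) = ereal (r x)"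
    and diff: "((\<lambda>x. r x - T (fst x) (snd x)) \<longlongrightarrow> 0) (in_prob M)"
    and lim: "\<And>y. (\<lambda>n. prob {\<omega>\<in>space M. T n \<omega> \<le> y}) \<longlonglongrightarrow> G y"
    and cont: "isCont G y"
  shows "(\<lambda>n. prob {\<omega>\<in>space M. Y n \<omega> \<le> ereal y}) \<longlonglongrightarrow> G y"
proof (rule tendstoI)
  fix e :: real assume e: "e > 0"
  then have "\<exists>d>0. \<forall>z. \<bar>z - y\<bar> < d \<longrightarrow> \<bar>G z - G y\<bar> < e / 3"
    using cont[unfolded continuous_at_eps_delta dist_real_def, rule_format, of "e / 3"] by simp
  then obtain d where d: "d > 0" "\<And>z. \<bar>z - y\<bar> < d \<Longrightarrow> \<bar>G z - G y\<bar> < e / 3" by blast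
  define h where "h = d / 2"
  have h: "h > 0" "\<bar>G (y + h) - G y\<bar> < e / 3" "\<bar>G (y - h) - G y\<bar> < e / 3"
    using d by (auto simp: h_def)
  have "\<forall>\<^sub>F x in in_prob M. dist (r x - T (fst x) (snd x)) 0 < h"
    using diff h by (intro tendstoD)
  with fin have "\<forall>\<^sub>F x in in_prob M. Y (fst x) (snd x) = ereal (r x) \<and> dist (r x - T (fst x) (snd x)) 0 < h"
    by eventually_elim auto
  then have bad: "\<forall>\<^sub>F n in sequentially. \<exists>A\<in>sets M. prob A \<le> e / 3 \<and>
      (\<forall>\<omega>\<in>space M - A. Y n \<omega> = ereal (r (n, \<omega>)) \<and> \<bar>r (n, \<omega>) - T n \<omega>\<bar> < h)"
    using e unfolding eventually_in_prob by (auto dest: spec[of _ "e / 3"])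
  have up: "\<forall>\<^sub>F n in sequentially. \<bar>prob {\<omega>\<in>space M. T n \<omega> \<le> y + h} - G (y + h)\<bar> < e / 3"
    using tendstoD[OF lim, of "e / 3" "y + h"] e by (simp add: dist_real_def)
  have lo: "\<forall>\<^sub>F n in sequentially. \<bar>prob {\<omega>\<in>space M. T n \<omega> \<le> y - h} - G (y - h)\<bar> < e / 3"
    using tendstoD[OF lim, of "e / 3" "y - h"] e by (simp add: dist_real_def)
  from bad up lo show "\<forall>\<^sub>F n in sequentially. dist (prob {\<omega>\<in>space M. Y n \<omega> \<le> ereal y}) (G y) < e"
  proof eventually_elim
    case (elim n)
    then obtain A where A [measurable]: "A \<in> sets M" and pA: "prob A \<le> e / 3"
      and good: "\<And>\<omega>. \<omega>\<in>space M - A \<Longrightarrow> Y n \<omega> = ereal (r (n, \<omega>)) \<and> \<bar>r (n, \<omega>) - T n \<omega>\<bar> < h" by blast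
    have "prob {\<omega>\<in>space M. Y n \<omega> \<le> ereal y} \<le> prob ({\<omega>\<in>space M. T n \<omega> \<le> y + h} \<union> A)"
      using good by (intro finite_measure_mono) fastforce+
    also have "\<dots> \<le> prob {\<omega>\<in>space M. T n \<omega> \<le> y + h} + prob A"
      by (intro measure_Un_le) auto
    finally have 1: "prob {\<omega>\<in>space M. Y n \<omega> \<le> ereal y} \<le> prob {\<omega>\<in>space M. T n \<omega> \<le> y + h} + e / 3"
      using pA by simp
    have "prob {\<omega>\<in>space M. T n \<omega> \<le> y - h} \<le> prob ({\<omega>\<in>space M. Y n \<omega> \<le> ereal y} \<union> A)"
      using good by (intro finite_measure_mono) fastforce+
    also have "\<dots> \<le> prob {\<omega>\<in>space M. Y n \<omega> \<le> ereal y} + prob A"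
      by (intro measure_Un_le) auto
    finally have 2: "prob {\<omega>\<in>space M. T n \<omega> \<le> y - h} \<le> prob {\<omega>\<in>space M. Y n \<omega> \<le> ereal y} + e / 3"
      using pA by simp
    show ?case
      using 1 2 elim(2,3) h(2,3) unfolding dist_real_def by argo
  qed
qed

end

section \<open>Jackknife pseudo-values\<close>

text \<open>Empirical counterpart of the conditional mean of the kernel given the observation
  \<open>x i\<close>. Pseudo-values are affine functions of it, so the jackknife in effect estimates
  the projection at each observation.\<close>

definition leave_one_mean :: "('a \<Rightarrow> 'a \<Rightarrow> real) \<Rightarrow> (nat \<Rightarrow> 'a) \<Rightarrow> nat \<Rightarrow> nat \<Rightarrow> real" where
  "leave_one_mean h x m i = (\<Sum>k\<in>{1..m} - {i}. h (x i) (x k)) / (real m - 1)"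

text \<open>The off-diagonal part of the square is the disjoint union of the triangle and its mirror
  image. Constant \<open>f\<close> counts the pairs, and \<open>f\<close> depending on one index
  sums the projections.\<close>

lemma sum_ordered_pairs:
  fixes f :: "nat \<Rightarrow> nat \<Rightarrow> real"
  assumes "finite I"
  shows "(\<Sum>(j, k)\<in>{(j, k). j \<in> I \<and> k \<in> I \<and> j < k}. f j k + f k j) = (\<Sum>j\<in>I. \<Sum>k\<in>I - {j}. f j k)"
proof -
  let ?P = "{(j, k). j \<in> I \<and> k \<in> I \<and> j < k}"
  have fin: "finite ?P" using assms by (auto intro: finite_subset[of _ "I \<times> I"])
  have "(\<Sum>j\<in>I. \<Sum>k\<in>I - {j}. f j k) = (\<Sum>(j, k)\<in>(SIGMA j:I. I - {j}). f j k)"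
    using assms by (subst sum.Sigma) auto
  also have "(SIGMA j:I. I - {j}) = ?P \<union> prod.swap ` ?P"
    by (auto simp: image_iff)
  also have "(\<Sum>(j, k)\<in>?P \<union> prod.swap ` ?P. f j k) = (\<Sum>(j, k)\<in>?P. f j k) + (\<Sum>(j, k)\<in>prod.swap ` ?P. f j k)"
    using fin by (intro sum.union_disjoint) auto
  also have "(\<Sum>(j, k)\<in>prod.swap ` ?P. f j k) = (\<Sum>(j, k)\<in>?P. f k j)"
    by (subst sum.reindex) (auto simp: inj_on_def intro!: sum.cong)
  finally show ?thesis by (simp add: sum.distrib split_def)
qed

lemma real_choose_two: "real (n choose 2) = real n * (real n - 1) / 2"
  by (cases n) (simp_all add: choose_two real_of_nat_div algebra_simps)

lemma U_stat_double_sum: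
  assumes sym: "\<And>x y. h x y = h y x" and "finite I" "card I \<ge> 2"
  shows "U_stat h x I = (\<Sum>j\<in>I. \<Sum>k\<in>I - {j}. h (x j) (x k)) / (real (card I) * (real (card I) - 1))"
proof -
  have "2 * (\<Sum>(j, k)\<in>{(j, k). j \<in> I \<and> k \<in> I \<and> j < k}. h (x j) (x k))
    = (\<Sum>(j, k)\<in>{(j, k). j \<in> I \<and> k \<in> I \<and> j < k}. h (x j) (x k) + h (x k) (x j))"
    by (simp add: sum_distrib_left case_prod_beta sym[of "x (snd _)"])
  also have "\<dots> = (\<Sum>j\<in>I. \<Sum>k\<in>I - {j}. h (x j) (x k))"
    using sum_ordered_pairs[OF assms(2), of "\<lambda>j k. h (x j) (x k)"] .
  finally show ?thesis
    using assms(3) unfolding U_stat_def real_choose_two by (simp add: field_simps)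
qed

lemma U_stat_eq_mean:
  assumes sym: "\<And>x y. h x y = h y x" and m: "m \<ge> 2"
  shows "U_stat h x {1..m} = (\<Sum>i=1..m. leave_one_mean h x m i) / real m"
  using m by (subst U_stat_double_sum[OF sym])
    (simp_all add: leave_one_mean_def flip: sum_divide_distrib)

text \<open>Deleting \<open>i\<close> removes it from both positions of the off-diagonal double sum,
  which costs twice the row sum at \<open>i\<close>. The resulting factor tends to 2, and its square
  is the 4 in the limiting variance; \<open>m \<ge> 3\<close> keeps \<open>real m - 2\<close> away
  from zero.\<close>

lemma pseudo_value_deviation:
  assumes sym: "\<And>x y. h x y = h y x" and m: "m \<ge> 3" and i: "i \<in> {1..m}"
  shows "pseudo_value h x m i - U_stat h x {1..m}
    = 2 * (real m - 1) / (real m - 2) * (leave_one_mean h x m i - U_stat h x {1..m})"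
proof -
  define D where "D = (\<lambda>I. \<Sum>j\<in>I. \<Sum>k\<in>I - {j}. h (x j) (x k))"
  let ?I = "{1..m}" and ?J = "{1..m} - {i}"
  define T where "T = (\<Sum>k\<in>?J. h (x i) (x k))"
  have cJ: "card ?J = m - 1" using i by simp
  have "D ?I = T + (\<Sum>j\<in>?J. \<Sum>k\<in>?I - {j}. h (x j) (x k))"
    unfolding D_def T_def using i by (subst sum.remove[of _ i]) auto
  also have "(\<Sum>j\<in>?J. \<Sum>k\<in>?I - {j}. h (x j) (x k)) = (\<Sum>j\<in>?J. h (x i) (x j) + (\<Sum>k\<in>?J - {j}. h (x j) (x k)))"
  proof (intro sum.cong refl)
    fix j assume "j \<in> ?J"
    then have "(\<Sum>k\<in>?I - {j}. h (x j) (x k)) = h (x j) (x i) + (\<Sum>k\<in>?I - {j} - {i}. h (x j) (x k))"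
      using i by (intro sum.remove) auto
    moreover have "?I - {j} - {i} = ?J - {j}" by auto
    ultimately show "(\<Sum>k\<in>?I - {j}. h (x j) (x k)) = h (x i) (x j) + (\<Sum>k\<in>?J - {j}. h (x j) (x k))"
      using sym by simp
  qed
  finally have D: "D ?J = D ?I - 2 * T" by (simp add: sum.distrib T_def D_def)
  have UI: "U_stat h x ?I = D ?I / (real m * (real m - 1))"
    using m by (subst U_stat_double_sum[OF sym]) (auto simp: D_def)
  have UJ: "U_stat h x ?J = (D ?I - 2 * T) / ((real m - 1) * (real m - 2))"
    using m i unfolding D[symmetric]
    by (subst U_stat_double_sum[OF sym]) (auto simp: D_def of_nat_diff algebra_simps)
  define r where "r = real m"
  have r: "r \<ge> 3" using m by (simp add: r_def)
  have "r * (D ?I / (r * (r - 1))) - D ?I / (r * (r - 1)) = (r - 1) * (D ?I / (r * (r - 1)))"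
    by (simp only: left_diff_distrib mult_1)
  also have "\<dots> = D ?I / r"
    using r by simp
  finally have "r * (D ?I / (r * (r - 1))) - D ?I / (r * (r - 1)) = D ?I / r" .
  moreover have "(r - 1) * ((D ?I - 2 * T) / ((r - 1) * (r - 2))) = (D ?I - 2 * T) / (r - 2)"
    using r by simp
  moreover have "D ?I / r - (D ?I - 2 * T) / (r - 2) = 2 / (r - 2) * (T - D ?I / r)"
    using r by (simp add: field_simps)
  moreover have "(r - 1) * (T / (r - 1)) = T" "(r - 1) * (D ?I / (r * (r - 1))) = D ?I / r"
    using r by simp_all
  then have "(r - 1) * (T / (r - 1) - D ?I / (r * (r - 1))) = T - D ?I / r"
    by (simp only: right_diff_distrib)
  then have "2 / (r - 2) * (T - D ?I / r) = 2 * (r - 1) / (r - 2) * (T / (r - 1) - D ?I / (r * (r - 1)))"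
    by (metis (no_types, lifting) mult.assoc times_divide_eq_left)
  ultimately show ?thesis
    unfolding pseudo_value_def UI UJ leave_one_mean_def T_def[symmetric] r_def[symmetric] by argo
qed

lemma mean_pseudo_value:
  assumes sym: "\<And>x y. h x y = h y x" and m: "m \<ge> 3"
  shows "(\<Sum>i=1..m. pseudo_value h x m i) / real m = U_stat h x {1..m}"
proof -
  let ?U = "U_stat h x {1..m}"
  have "(\<Sum>i=1..m. pseudo_value h x m i - ?U) = 2 * (real m - 1) / (real m - 2) * (\<Sum>i=1..m. leave_one_mean h x m i - ?U)"
    using pseudo_value_deviation[of h, OF sym m] by (simp add: sum_distrib_left)
  also have "(\<Sum>i=1..m. leave_one_mean h x m i - ?U) = 0"
    using U_stat_eq_mean[OF sym, where m = m and x = x] m by (simp add: sum_subtractf)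
  finally show ?thesis using m by (simp add: sum_subtractf)
qed

section \<open>Independent samples and degenerate kernels\<close>

text \<open>Used to extract pairs from the sample and to treat its second block as a sample of its
  own.\<close>

lemma (in prob_space) indep_vars_reindex:
  assumes f: "inj_on f J" "f ` J \<subseteq> I" and X: "indep_vars (\<lambda>_. N) X I"
  shows "indep_vars (\<lambda>_. N) (\<lambda>i. X (f i)) J"
  unfolding indep_vars_def2
proof (intro conjI ballI)
  show "X (f i) \<in> measurable M N" if "i \<in> J" for i
    using X f(2) that unfolding indep_vars_def2 by auto
  have X': "indep_sets (\<lambda>i. {X i -` A \<inter> space M |A. A \<in> sets N}) I"
    using X unfolding indep_vars_def2 by auto
  show "indep_sets (\<lambda>i. {X (f i) -` A \<inter> space M |A. A \<in> sets N}) J"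
  proof (rule indep_setsI)
    fix i assume "i \<in> J"
    with X' f(2) show "{X (f i) -` A \<inter> space M |A. A \<in> sets N} \<subseteq> events"
      unfolding indep_sets_def by (blast dest: bspec)
  next
    fix A K assume K: "K \<noteq> {}" "K \<subseteq> J" "finite K" "\<forall>j\<in>K. A j \<in> {X (f j) -` A \<inter> space M |A. A \<in> sets N}"
    have inj: "inj_on f K" using f(1) K(2) by (rule inj_on_subset)
    \<comment> \<open>The events are relabelled along the inverse of \<open>f\<close>, so that the
      product formula of the original family applies to the image index set.\<close>
    define B where "B = (\<lambda>i. A (the_inv_into K f i))"
    have B: "B (f j) = A j" if "j \<in> K" for j using that inj by (simp add: B_def the_inv_into_f_f)
    have "prob (\<Inter>i\<in>f ` K. B i) = (\<Prod>i\<in>f ` K. prob (B i))"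
    proof (rule indep_setsD[OF X'])
      show "f ` K \<subseteq> I" using K(2) f(2) by blast
      show "\<forall>i\<in>f ` K. B i \<in> {X i -` A \<inter> space M |A. A \<in> sets N}" using K(4) B by auto
    qed (use K in auto)
    then show "prob (\<Inter>j\<in>K. A j) = (\<Prod>j\<in>K. prob (A j))"
      using B inj by (simp add: prod.reindex)
  qed
qed

lemma integrable_mult_of_square_integrable:
  fixes f g :: "'a \<Rightarrow> real"
  assumes [measurable]: "f \<in> borel_measurable M" "g \<in> borel_measurable M"
    and "integrable M (\<lambda>x. (f x)\<^sup>2)" "integrable M (\<lambda>x. (g x)\<^sup>2)"
  shows "integrable M (\<lambda>x. f x * g x)"
proof (rule Bochner_Integration.integrable_bound)
  show "integrable M (\<lambda>x. (f x)\<^sup>2 + (g x)\<^sup>2)" using assms by simp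
  have "\<bar>a * b\<bar> \<le> a\<^sup>2 + b\<^sup>2" for a b :: real
  proof -
    have "2 * \<bar>a * b\<bar> \<le> a\<^sup>2 + b\<^sup>2"
      using sum_squares_bound[of "\<bar>a\<bar>" "\<bar>b\<bar>"] by (simp add: abs_mult)
    then show ?thesis by simp
  qed
  then show "AE x in M. norm (f x * g x) \<le> norm ((f x)\<^sup>2 + (g x)\<^sup>2)" by simp
qed simp

lemma square_integrable_add:
  fixes f g :: "'a \<Rightarrow> real"
  assumes "f \<in> borel_measurable M" "g \<in> borel_measurable M"
    and "integrable M (\<lambda>x. (f x)\<^sup>2)" "integrable M (\<lambda>x. (g x)\<^sup>2)"
  shows "integrable M (\<lambda>x. (f x + g x)\<^sup>2)"
  using assms integrable_mult_of_square_integrable[OF assms]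
  by (simp add: power2_sum mult.assoc)

text \<open>Pythagoras in L2. The variances of centred sums, of leave-one-out means and of the
  Hoeffding remainder are all computed with it.\<close>

lemma integral_sum_orthogonal:
  fixes f :: "'i \<Rightarrow> 'a \<Rightarrow> real"
  assumes S: "finite S" and meas: "\<And>i. i \<in> S \<Longrightarrow> f i \<in> borel_measurable M"
    and sq: "\<And>i. i \<in> S \<Longrightarrow> integrable M (\<lambda>x. (f i x)\<^sup>2)"
    and orth: "\<And>i j. i \<in> S \<Longrightarrow> j \<in> S \<Longrightarrow> i \<noteq> j \<Longrightarrow> (\<integral>x. f i x * f j x \<partial>M) = 0"
  shows "integrable M (\<lambda>x. (\<Sum>i\<in>S. f i x)\<^sup>2)"
    and "(\<integral>x. (\<Sum>i\<in>S. f i x)\<^sup>2 \<partial>M) = (\<Sum>i\<in>S. \<integral>x. (f i x)\<^sup>2 \<partial>M)"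
proof -
  have int: "integrable M (\<lambda>x. f i x * f j x)" if "i \<in> S" "j \<in> S" for i j
    using that by (intro integrable_mult_of_square_integrable meas sq)
  have eq: "(\<Sum>i\<in>S. f i x)\<^sup>2 = (\<Sum>i\<in>S. \<Sum>j\<in>S. f i x * f j x)" for x
    by (simp add: power2_eq_square sum_product)
  show "integrable M (\<lambda>x. (\<Sum>i\<in>S. f i x)\<^sup>2)"
    unfolding eq using int by auto
  have "(\<integral>x. (\<Sum>i\<in>S. f i x)\<^sup>2 \<partial>M) = (\<Sum>i\<in>S. \<Sum>j\<in>S. \<integral>x. f i x * f j x \<partial>M)"
    unfolding eq using int by (simp add: Bochner_Integration.integral_sum)
  also have "\<dots> = (\<Sum>i\<in>S. \<Sum>j\<in>S. if i = j then \<integral>x. (f i x)\<^sup>2 \<partial>M else 0)"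
    using orth by (intro sum.cong refl) (auto simp: power2_eq_square)
  also have "\<dots> = (\<Sum>i\<in>S. \<integral>x. (f i x)\<^sup>2 \<partial>M)"
    using S by simp
  finally show "(\<integral>x. (\<Sum>i\<in>S. f i x)\<^sup>2 \<partial>M) = (\<Sum>i\<in>S. \<integral>x. (f i x)\<^sup>2 \<partial>M)" .
qed

locale iid_sample = prob_space M for M :: "'w measure" +
  fixes X :: "nat \<Rightarrow> 'w \<Rightarrow> 'a::second_countable_topology" and F :: "'a measure"
  assumes indep: "indep_vars (\<lambda>_. borel) X {1..}"
    and ident: "\<And>i. i \<ge> 1 \<Longrightarrow> distr M borel (X i) = F"
begin

lemma measurable_X [measurable (raw)]: "i \<ge> 1 \<Longrightarrow> X i \<in> borel_measurable M"
  using indep unfolding indep_vars_def2 by simp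

lemma sets_F [simp, measurable_cong]: "sets F = sets borel"
  using ident[of 1] by (metis order_refl sets_distr)

lemma space_F [simp]: "space F = UNIV"
  using sets_eq_imp_space_eq[OF sets_F] by simp

lemma prob_space_F: "prob_space F"
  using prob_space_distr[of "X 1" borel] ident[of 1] by simp

sublocale F: prob_space F by (rule prob_space_F)

sublocale FF: pair_prob_space F F ..

lemma shift: "iid_sample M (\<lambda>i. X (k + i)) F"
proof
  show "indep_vars (\<lambda>_. borel) (\<lambda>i. X (k + i)) {1..}"
    by (rule indep_vars_reindex[OF _ _ indep]) auto
  show "distr M borel (X (k + i)) = F" if "i \<ge> 1" for i using that by (intro ident) simp
qed

lemma integrable_X_iff:
  fixes u :: "'a \<Rightarrow> real"
  assumes "u \<in> borel_measurable borel" "i \<ge> 1"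
  shows "integrable M (\<lambda>\<omega>. u (X i \<omega>)) \<longleftrightarrow> integrable F u"
  using integrable_distr_eq[OF measurable_X[OF assms(2)] assms(1)] ident[OF assms(2)] by simp

lemma expectation_X:
  fixes u :: "'a \<Rightarrow> real"
  assumes "u \<in> borel_measurable borel" "i \<ge> 1"
  shows "expectation (\<lambda>\<omega>. u (X i \<omega>)) = (\<integral>x. u x \<partial>F)"
  using integral_distr[OF measurable_X[OF assms(2)] assms(1)] ident[OF assms(2)] by simp

lemma law_pair:
  assumes "i \<ge> 1" "j \<ge> 1" "i \<noteq> j"
  shows "distr M (borel \<Otimes>\<^sub>M borel) (\<lambda>\<omega>. (X i \<omega>, X j \<omega>)) = F \<Otimes>\<^sub>M F"
proof -
  have "indep_var borel (X i) borel (X j)"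
  proof -
    have "indep_vars (\<lambda>_. borel) (\<lambda>b. X (case_bool i j b)) UNIV"
      using assms by (intro indep_vars_reindex[OF _ _ indep]) (auto simp: inj_on_def split: bool.splits)
    moreover have "(\<lambda>b. X (case_bool i j b)) = case_bool (X i) (X j)"
      "(\<lambda>_. borel) = case_bool borel (borel :: 'a measure)"
      by (auto split: bool.splits)
    ultimately show ?thesis unfolding indep_var_def by simp
  qed
  then show ?thesis
    unfolding indep_var_distribution_eq using ident assms by metis
qed

lemma
  fixes u :: "'a \<Rightarrow> 'a \<Rightarrow> real"
  assumes [measurable]: "(\<lambda>(x, y). u x y) \<in> borel_measurable (borel \<Otimes>\<^sub>M borel)"
    and ij: "i \<ge> 1" "j \<ge> 1" "i \<noteq> j"
  shows integrable_pair_iff: "integrable M (\<lambda>\<omega>. u (X i \<omega>) (X j \<omega>)) \<longleftrightarrow> integrable (F \<Otimes>\<^sub>M F) (\<lambda>(x, y). u x y)"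
    and expectation_pair: "expectation (\<lambda>\<omega>. u (X i \<omega>) (X j \<omega>)) = (\<integral>(x, y). u x y \<partial>(F \<Otimes>\<^sub>M F))"
proof -
  note [measurable] = measurable_X[OF ij(1)] measurable_X[OF ij(2)]
  have P: "(\<lambda>\<omega>. (X i \<omega>, X j \<omega>)) \<in> M \<rightarrow>\<^sub>M borel \<Otimes>\<^sub>M borel" by measurable
  show "integrable M (\<lambda>\<omega>. u (X i \<omega>) (X j \<omega>)) \<longleftrightarrow> integrable (F \<Otimes>\<^sub>M F) (\<lambda>(x, y). u x y)"
    unfolding law_pair[OF ij, symmetric] by (subst integrable_distr_eq[OF P]) (use assms in auto)
  show "expectation (\<lambda>\<omega>. u (X i \<omega>) (X j \<omega>)) = (\<integral>(x, y). u x y \<partial>(F \<Otimes>\<^sub>M F))"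
    unfolding law_pair[OF ij, symmetric] by (subst integral_distr[OF P]) (use assms in auto)
qed

text \<open>Integrating out \<open>X j\<close> first. The indices \<open>i\<close>, \<open>a\<close>, \<open>b\<close> need not be distinct.\<close>

lemma expectation_degenerate_mult:
  fixes u v :: "'a \<Rightarrow> 'a \<Rightarrow> real"
  assumes u [measurable]: "(\<lambda>(x, y). u x y) \<in> borel_measurable (borel \<Otimes>\<^sub>M borel)"
    and v [measurable]: "(\<lambda>(x, y). v x y) \<in> borel_measurable (borel \<Otimes>\<^sub>M borel)"
    and idx: "i \<ge> 1" "a \<ge> 1" "b \<ge> 1" "j \<ge> 1" "j \<notin> {i, a, b}"
    and deg: "\<And>x. (\<integral>y. u x y \<partial>F) = 0"
    and int: "integrable M (\<lambda>\<omega>. u (X i \<omega>) (X j \<omega>) * v (X a \<omega>) (X b \<omega>))"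
  shows "expectation (\<lambda>\<omega>. u (X i \<omega>) (X j \<omega>) * v (X a \<omega>) (X b \<omega>)) = 0"
proof -
  \<comment> \<open>Collecting the remaining indices into a set, instead of a triple, absorbs all
    coincidences among \<open>i\<close>, \<open>a\<close> and \<open>b\<close>: \<open>X j\<close>
    is independent of the whole block.\<close>
  define A where "A = {i, a, b}"
  let ?P = "PiM A (\<lambda>_. borel :: 'a measure)"
  let ?W = "\<lambda>\<omega>. \<lambda>i\<in>A. X i \<omega>"
  have W [measurable]: "?W \<in> M \<rightarrow>\<^sub>M ?P"
    by (rule measurable_restrict) (use idx in \<open>auto simp: A_def\<close>)
  note [measurable] = measurable_X[OF idx(4)]
  have iab: "i \<in> A" "a \<in> A" "b \<in> A" by (auto simp: A_def)
  have [measurable]: "(\<lambda>w. w i) \<in> ?P \<rightarrow>\<^sub>M borel" "(\<lambda>w. w a) \<in> ?P \<rightarrow>\<^sub>M borel" "(\<lambda>w. w b) \<in> ?P \<rightarrow>\<^sub>M borel"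
    using iab by (auto intro!: measurable_component_singleton)
  let ?Q = "PiM {j} (\<lambda>_. borel :: 'a measure)"
  let ?V = "\<lambda>\<omega>. \<lambda>i\<in>{j}. X i \<omega>"
  have V [measurable]: "?V \<in> M \<rightarrow>\<^sub>M ?Q"
    by (rule measurable_restrict) (use idx in auto)
  have [measurable]: "(\<lambda>w. w j) \<in> ?Q \<rightarrow>\<^sub>M borel"
    by (rule measurable_component_singleton) simp
  interpret W: prob_space "distr M ?P ?W" by (rule prob_space_distr[OF W])
  interpret V: prob_space "distr M ?Q ?V" by (rule prob_space_distr[OF V])
  interpret WV: pair_prob_space "distr M ?P ?W" "distr M ?Q ?V" ..
  have "indep_var ?P ?W ?Q ?V"
    by (rule indep_var_restrict[OF indep]) (use idx in \<open>auto simp: A_def\<close>)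
  then have law: "distr M ?P ?W \<Otimes>\<^sub>M distr M ?Q ?V = distr M (?P \<Otimes>\<^sub>M ?Q) (\<lambda>\<omega>. (?W \<omega>, ?V \<omega>))"
    unfolding indep_var_distribution_eq by blast
  have WV: "(\<lambda>\<omega>. (?W \<omega>, ?V \<omega>)) \<in> M \<rightarrow>\<^sub>M ?P \<Otimes>\<^sub>M ?Q" by measurable
  let ?f = "\<lambda>z. u (fst z i) (snd z j) * v (fst z a) (fst z b)"
  have f: "?f \<in> borel_measurable (?P \<Otimes>\<^sub>M ?Q)" by measurable
  have int': "integrable (distr M ?P ?W \<Otimes>\<^sub>M distr M ?Q ?V) ?f"
    unfolding law by (subst integrable_distr_eq[OF WV f]) (use int iab in simp)
  have inner: "(\<integral>y. u x (y j) \<partial>distr M ?Q ?V) = 0" for x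
  proof -
    have "(\<integral>y. u x (y j) \<partial>distr M ?Q ?V) = expectation (\<lambda>\<omega>. u x (X j \<omega>))"
      by (subst integral_distr[OF V]) simp_all
    also have "\<dots> = (\<integral>y. u x y \<partial>F)"
      by (rule expectation_X[OF _ idx(4)]) measurable
    finally show ?thesis using deg by simp
  qed
  have "expectation (\<lambda>\<omega>. u (X i \<omega>) (X j \<omega>) * v (X a \<omega>) (X b \<omega>)) = (\<integral>z. ?f z \<partial>(distr M ?P ?W \<Otimes>\<^sub>M distr M ?Q ?V))"
    unfolding law by (subst integral_distr[OF WV f]) (use iab in simp)
  also have "\<dots> = (\<integral>w. (\<integral>y. ?f (w, y) \<partial>distr M ?Q ?V) \<partial>(distr M ?P ?W))"
    using WV.integral_fst'[OF int'] by simp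
  also have "\<dots> = 0" by (simp add: inner)
  finally show ?thesis .
qed

lemma expectation_sum_centered_square:
  fixes u :: "'a \<Rightarrow> real"
  assumes u [measurable]: "u \<in> borel_measurable borel" and sq: "integrable F (\<lambda>x. (u x)\<^sup>2)"
    and mean: "(\<integral>x. u x \<partial>F) = 0" and S: "finite S" "S \<subseteq> {1..}"
  shows "integrable M (\<lambda>\<omega>. (\<Sum>i\<in>S. c i * u (X i \<omega>))\<^sup>2)"
    and "expectation (\<lambda>\<omega>. (\<Sum>i\<in>S. c i * u (X i \<omega>))\<^sup>2) = (\<Sum>i\<in>S. (c i)\<^sup>2) * (\<integral>x. (u x)\<^sup>2 \<partial>F)"
proof -
  have m: "(\<lambda>\<omega>. u (X i \<omega>)) \<in> borel_measurable M" if "i \<in> S" for i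
    using measurable_X[of i] S that by (auto intro!: measurable_compose[OF _ u])
  have m': "(\<lambda>\<omega>. c i * u (X i \<omega>)) \<in> borel_measurable M" if "i \<in> S" for i
    using m[OF that] by measurable
  have I: "integrable M (\<lambda>\<omega>. (u (X i \<omega>))\<^sup>2)" if "i \<in> S" for i
    using integrable_X_iff[of "\<lambda>x. (u x)\<^sup>2" i] sq S that by auto
  have I': "integrable M (\<lambda>\<omega>. (c i * u (X i \<omega>))\<^sup>2)" if "i \<in> S" for i
    using I[OF that] by (simp add: power_mult_distrib)
  have orth: "expectation (\<lambda>\<omega>. (c i * u (X i \<omega>)) * (c j * u (X j \<omega>))) = 0" if ij: "i \<in> S" "j \<in> S" "i \<noteq> j" for i j
  proof -
    \<comment> \<open>A function of one observation is regarded as a kernel that ignores its other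
      argument, so that orthogonality of centred variables becomes a case of the degenerate-kernel
      lemma.\<close>
    have "expectation (\<lambda>\<omega>. u (X j \<omega>) * u (X i \<omega>)) = 0"
      using ij S mean I m
      by (intro expectation_degenerate_mult[where u = "\<lambda>_. u" and v = "\<lambda>x _. u x" and b = i and i = i]
            integrable_mult_of_square_integrable) auto
    then have "expectation (\<lambda>\<omega>. c i * c j * (u (X j \<omega>) * u (X i \<omega>))) = 0" by simp
    then show ?thesis by (simp add: mult_ac)
  qed
  show "integrable M (\<lambda>\<omega>. (\<Sum>i\<in>S. c i * u (X i \<omega>))\<^sup>2)"
    by (rule integral_sum_orthogonal(1)[OF S(1) m' I' orth])
  have "expectation (\<lambda>\<omega>. (\<Sum>i\<in>S. c i * u (X i \<omega>))\<^sup>2) = (\<Sum>i\<in>S. expectation (\<lambda>\<omega>. (c i * u (X i \<omega>))\<^sup>2))"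
    by (rule integral_sum_orthogonal(2)[OF S(1) m' I' orth])
  also have "\<dots> = (\<Sum>i\<in>S. (c i)\<^sup>2 * (\<integral>x. (u x)\<^sup>2 \<partial>F))"
    using S expectation_X[of "\<lambda>x. (u x)\<^sup>2"] by (intro sum.cong refl) (auto simp: power_mult_distrib)
  finally show "expectation (\<lambda>\<omega>. (\<Sum>i\<in>S. c i * u (X i \<omega>))\<^sup>2) = (\<Sum>i\<in>S. (c i)\<^sup>2) * (\<integral>x. (u x)\<^sup>2 \<partial>F)"
    by (simp add: sum_distrib_right)
qed

end

section \<open>Symmetric kernels with a given projection and their Hoeffding decomposition\<close>

text \<open>The projection \<open>g\<close> and the centre \<open>\<theta>\<close> are parameters so
  that two different kernels can be instantiated with the same pair. The projection identity is
  required at every point, not merely almost everywhere, so that inner integrals can be replaced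
  without handling null sets.\<close>

locale iid_kernel = iid_sample M X F
  for M :: "'w measure" and X :: "nat \<Rightarrow> 'w \<Rightarrow> 'a::second_countable_topology" and F +
  fixes h :: "'a \<Rightarrow> 'a \<Rightarrow> real" and g :: "'a \<Rightarrow> real" and \<theta> :: real
  assumes h_meas [measurable]: "(\<lambda>(x, y). h x y) \<in> borel_measurable (borel \<Otimes>\<^sub>M borel)"
    and h_sym: "h x y = h y x"
    and h_int: "integrable F (h x)"
    and h_sq: "integrable (F \<Otimes>\<^sub>M F) (\<lambda>(x, y). (h x y)\<^sup>2)"
    and g_meas [measurable]: "g \<in> borel_measurable borel"
    and g_sq: "integrable F (\<lambda>x. (g x)\<^sup>2)"
    and g_mean: "(\<integral>x. g x \<partial>F) = 0"
    and h_proj: "(\<integral>y. h x y \<partial>F) = \<theta> + g x"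
begin

text \<open>\<open>\<psi>\<close> is centred in its second argument only, which suffices when the
  first observation is held fixed. \<open>\<phi>\<close> is the completely degenerate part of the
  Hoeffding decomposition.\<close>

definition \<psi> :: "'a \<Rightarrow> 'a \<Rightarrow> real" where "\<psi> x y = h x y - \<theta> - g x"
definition \<phi> :: "'a \<Rightarrow> 'a \<Rightarrow> real" where "\<phi> x y = h x y - \<theta> - g x - g y"

lemma measurable_\<psi> [measurable]: "(\<lambda>(x, y). \<psi> x y) \<in> borel_measurable (borel \<Otimes>\<^sub>M borel)"
  and measurable_\<phi> [measurable]: "(\<lambda>(x, y). \<phi> x y) \<in> borel_measurable (borel \<Otimes>\<^sub>M borel)"
  unfolding \<psi>_def \<phi>_def by measurable

lemma integrable_g: "integrable F g"
  by (rule F.square_integrable_imp_integrable[OF _ g_sq]) (simp add: measurable_cong_sets[OF sets_F])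

lemma degenerate_\<psi>: "(\<integral>y. \<psi> x y \<partial>F) = 0"
  using h_int h_proj[of x] F.prob_space by (simp add: \<psi>_def)

lemma degenerate_\<phi>: "(\<integral>y. \<phi> x y \<partial>F) = 0"
  using h_int h_proj[of x] F.prob_space integrable_g g_mean by (simp add: \<phi>_def)

lemma square_integrable_pairs:
  assumes "i \<ge> 1" "j \<ge> 1" "i \<noteq> j"
  shows "integrable M (\<lambda>\<omega>. (\<psi> (X i \<omega>) (X j \<omega>))\<^sup>2)" "integrable M (\<lambda>\<omega>. (\<phi> (X i \<omega>) (X j \<omega>))\<^sup>2)"
proof -
  note [measurable] = measurable_X[OF assms(1)] measurable_X[OF assms(2)]
  have 1: "integrable M (\<lambda>\<omega>. (h (X i \<omega>) (X j \<omega>))\<^sup>2)"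
    using h_sq by (subst integrable_pair_iff[OF _ assms]) auto
  have 2: "integrable M (\<lambda>\<omega>. (- \<theta> - g (X i \<omega>))\<^sup>2)" if "i \<ge> 1" for i
  proof (subst integrable_X_iff[OF _ that, of "\<lambda>x. (- \<theta> - g x)\<^sup>2"])
    show "integrable F (\<lambda>x. (- \<theta> - g x)\<^sup>2)"
      using g_sq integrable_g by (simp add: power2_diff)
  qed measurable
  have 3: "integrable M (\<lambda>\<omega>. (- g (X j \<omega>))\<^sup>2)"
    using g_sq integrable_X_iff[OF _ assms(2), of "\<lambda>x. (g x)\<^sup>2"] by simp
  have "integrable M (\<lambda>\<omega>. (h (X i \<omega>) (X j \<omega>) + (- \<theta> - g (X i \<omega>)))\<^sup>2)"
    by (intro square_integrable_add 1 2 assms) measurable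
  then show \<psi>: "integrable M (\<lambda>\<omega>. (\<psi> (X i \<omega>) (X j \<omega>))\<^sup>2)" by (simp add: \<psi>_def diff_diff_eq algebra_simps)
  have "integrable M (\<lambda>\<omega>. (\<psi> (X i \<omega>) (X j \<omega>) + (- g (X j \<omega>)))\<^sup>2)"
    by (intro square_integrable_add \<psi> 3) measurable
  then show "integrable M (\<lambda>\<omega>. (\<phi> (X i \<omega>) (X j \<omega>))\<^sup>2)" by (simp add: \<psi>_def \<phi>_def algebra_simps)
qed

abbreviation residual :: "nat \<Rightarrow> nat \<Rightarrow> 'w \<Rightarrow> real" where
  "residual m i \<omega> \<equiv> leave_one_mean h (\<lambda>i. X i \<omega>) m i - \<theta> - g (X i \<omega>)"

text \<open>The residual is an average of \<open>m - 1\<close> terms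
  \<open>\<psi> (X i \<omega>) (X k \<omega>)\<close>. Two of them with different \<open>k\<close>
  are orthogonal, since one of the two second observations can be integrated out, and this yields
  the factor \<open>1 / (real m - 1)\<close>.\<close>

lemma residual_square:
  assumes m: "m \<ge> 2" and i: "i \<in> {1..m}"
  shows "integrable M (\<lambda>\<omega>. (residual m i \<omega>)\<^sup>2)"
    and "expectation (\<lambda>\<omega>. (residual m i \<omega>)\<^sup>2) = (\<integral>(x, y). (\<psi> x y)\<^sup>2 \<partial>(F \<Otimes>\<^sub>M F)) / (real m - 1)"
proof -
  let ?J = "{1..m} - {i}"
  have c: "real (card ?J) = real m - 1" using i m by (simp add: of_nat_diff)
  have eq: "residual m i \<omega> = (\<Sum>k\<in>?J. \<psi> (X i \<omega>) (X k \<omega>)) / (real m - 1)" for \<omega>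
  proof -
    have "(\<Sum>k\<in>?J. \<psi> (X i \<omega>) (X k \<omega>)) = (\<Sum>k\<in>?J. h (X i \<omega>) (X k \<omega>)) - (real m - 1) * (\<theta> + g (X i \<omega>))"
      unfolding \<psi>_def sum_subtractf sum_constant c by (simp add: algebra_simps)
    then show ?thesis using m by (simp add: leave_one_mean_def field_simps)
  qed
  have meas: "(\<lambda>\<omega>. \<psi> (X i \<omega>) (X k \<omega>)) \<in> borel_measurable M" if "k \<in> ?J" for k
  proof -
    have [measurable]: "X i \<in> borel_measurable M" "X k \<in> borel_measurable M"
      using i that by (auto intro: measurable_X)
    show ?thesis by measurable
  qed
  have sq: "integrable M (\<lambda>\<omega>. (\<psi> (X i \<omega>) (X k \<omega>))\<^sup>2)" if "k \<in> ?J" for k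
    using that i by (intro square_integrable_pairs) auto
  have orth: "expectation (\<lambda>\<omega>. \<psi> (X i \<omega>) (X k \<omega>) * \<psi> (X i \<omega>) (X l \<omega>)) = 0"
    if "k \<in> ?J" "l \<in> ?J" "k \<noteq> l" for k l
    using that i
    by (intro expectation_degenerate_mult degenerate_\<psi> integrable_mult_of_square_integrable meas sq)
      (auto intro: measurable_\<psi>)
  have "finite ?J" by simp
  note sums = integral_sum_orthogonal[OF this meas sq orth]
  show "integrable M (\<lambda>\<omega>. (residual m i \<omega>)\<^sup>2)"
    unfolding eq power_divide using sums(1) by simp
  have "expectation (\<lambda>\<omega>. (residual m i \<omega>)\<^sup>2) = (\<Sum>k\<in>?J. expectation (\<lambda>\<omega>. (\<psi> (X i \<omega>) (X k \<omega>))\<^sup>2)) / (real m - 1)\<^sup>2"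
    unfolding eq power_divide using sums(2) by simp
  also have "\<dots> = (\<Sum>k\<in>?J. \<integral>(x, y). (\<psi> x y)\<^sup>2 \<partial>(F \<Otimes>\<^sub>M F)) / (real m - 1)\<^sup>2"
    using i by (intro arg_cong2[where f = "(/)"] sum.cong refl expectation_pair) auto
  also have "\<dots> = (\<integral>(x, y). (\<psi> x y)\<^sup>2 \<partial>(F \<Otimes>\<^sub>M F)) / (real m - 1)"
    unfolding sum_constant c using m by (simp add: power2_eq_square)
  finally show "expectation (\<lambda>\<omega>. (residual m i \<omega>)\<^sup>2) = (\<integral>(x, y). (\<psi> x y)\<^sup>2 \<partial>(F \<Otimes>\<^sub>M F)) / (real m - 1)" .
qed

text \<open>After subtraction of both projections an average of \<open>\<phi>\<close> over
  increasing pairs is left. Different pairs are orthogonal even if they share an index, so the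
  second moment is of order \<open>1 / m^2\<close>, one order smaller than that of the projection
  part.\<close>

lemma U_stat_projection_error:
  fixes m :: nat
  assumes m: "m \<ge> 2"
  defines "E \<equiv> \<lambda>\<omega>. U_stat h (\<lambda>i. X i \<omega>) {1..m} - \<theta> - 2 * ((\<Sum>i=1..m. g (X i \<omega>)) / real m)"
  shows "integrable M (\<lambda>\<omega>. (E \<omega>)\<^sup>2)"
    and "expectation (\<lambda>\<omega>. (E \<omega>)\<^sup>2) = 2 * (\<integral>(x, y). (\<phi> x y)\<^sup>2 \<partial>(F \<Otimes>\<^sub>M F)) / (real m * (real m - 1))"
proof -
  let ?P = "{(j, k). j \<in> {1..m} \<and> k \<in> {1..m} \<and> j < k}"
  have fin: "finite ?P" by (rule finite_subset[of _ "{1..m} \<times> {1..m}"]) auto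
  have c: "real (card ?P) = real m * (real m - 1) / 2"
  proof -
    have "2 * real (card ?P) = (\<Sum>(j, k)\<in>?P. 1 + 1)" by (simp add: split_def)
    also have "\<dots> = (\<Sum>j\<in>{1..m}. \<Sum>k\<in>{1..m} - {j}. 1)"
      using sum_ordered_pairs[of "{1..m}" "\<lambda>_ _. 1"] by simp
    also have "\<dots> = real m * (real m - 1)" using m by (simp add: of_nat_diff)
    finally show ?thesis by simp
  qed
  have eq: "E \<omega> = (\<Sum>p\<in>?P. \<phi> (X (fst p) \<omega>) (X (snd p) \<omega>)) * (2 / (real m * (real m - 1)))" for \<omega>
  proof -
    have "(\<Sum>p\<in>?P. g (X (fst p) \<omega>) + g (X (snd p) \<omega>)) = (\<Sum>j\<in>{1..m}. \<Sum>k\<in>{1..m} - {j}. g (X j \<omega>))"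
      using sum_ordered_pairs[of "{1..m}" "\<lambda>j k. g (X j \<omega>)"] by (simp add: split_def)
    also have "\<dots> = (real m - 1) * (\<Sum>j=1..m. g (X j \<omega>))"
      using m by (simp add: of_nat_diff sum_distrib_left)
    finally have g: "(\<Sum>p\<in>?P. g (X (fst p) \<omega>) + g (X (snd p) \<omega>)) = (real m - 1) * (\<Sum>j=1..m. g (X j \<omega>))" .
    have "(\<Sum>p\<in>?P. \<phi> (X (fst p) \<omega>) (X (snd p) \<omega>)) = (\<Sum>p\<in>?P. h (X (fst p) \<omega>) (X (snd p) \<omega>))
        - real (card ?P) * \<theta> - (\<Sum>p\<in>?P. g (X (fst p) \<omega>) + g (X (snd p) \<omega>))"
      by (simp add: \<phi>_def sum_subtractf sum.distrib)
    then have "(\<Sum>p\<in>?P. \<phi> (X (fst p) \<omega>) (X (snd p) \<omega>)) = (\<Sum>p\<in>?P. h (X (fst p) \<omega>) (X (snd p) \<omega>))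
        - real m * (real m - 1) / 2 * \<theta> - (real m - 1) * (\<Sum>j=1..m. g (X j \<omega>))"
      unfolding g c .
    moreover have "U_stat h (\<lambda>i. X i \<omega>) {1..m} = (\<Sum>p\<in>?P. h (X (fst p) \<omega>) (X (snd p) \<omega>)) * (2 / (real m * (real m - 1)))"
      unfolding U_stat_def real_choose_two by (simp add: split_def)
    moreover have "(a - r * (r - 1) / 2 * \<theta> - (r - 1) * b) * (2 / (r * (r - 1))) = a * (2 / (r * (r - 1))) - \<theta> - 2 * (b / r)"
      if "r \<ge> 2" for a b r :: real
    proof -
      have "r * (r - 1) / 2 * \<theta> * (2 / (r * (r - 1))) = \<theta>" "(r - 1) * b * (2 / (r * (r - 1))) = 2 * (b / r)"
        using that by simp_all
      then show ?thesis by (simp only: left_diff_distrib)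
    qed
    ultimately show ?thesis
      using m unfolding E_def by simp
  qed
  have meas: "(\<lambda>\<omega>. \<phi> (X (fst p) \<omega>) (X (snd p) \<omega>)) \<in> borel_measurable M" if "p \<in> ?P" for p
  proof -
    have [measurable]: "X (fst p) \<in> borel_measurable M" "X (snd p) \<in> borel_measurable M"
      using that by (auto intro: measurable_X)
    show ?thesis by measurable
  qed
  have sq: "integrable M (\<lambda>\<omega>. (\<phi> (X (fst p) \<omega>) (X (snd p) \<omega>))\<^sup>2)" if "p \<in> ?P" for p
    using that by (intro square_integrable_pairs) auto
  have \<phi>_sym: "\<phi> x y = \<phi> y x" for x y by (simp add: \<phi>_def h_sym)
  have orth: "expectation (\<lambda>\<omega>. \<phi> (X (fst p) \<omega>) (X (snd p) \<omega>) * \<phi> (X (fst q) \<omega>) (X (snd q) \<omega>)) = 0"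
    if pq: "p \<in> ?P" "q \<in> ?P" "p \<noteq> q" for p q
  proof -
    have int: "integrable M (\<lambda>\<omega>. \<phi> (X (fst p) \<omega>) (X (snd p) \<omega>) * \<phi> (X (fst q) \<omega>) (X (snd q) \<omega>))"
      by (intro integrable_mult_of_square_integrable meas sq pq)
    \<comment> \<open>Two different increasing pairs cannot contain the same two indices, so some
      entry of \<open>p\<close> is missing from \<open>q\<close>; that observation is integrated
      out.\<close>
    have "snd p \<notin> {fst p, fst q, snd q} \<or> fst p \<notin> {snd p, fst q, snd q}"
      using pq by (cases p; cases q; simp; arith)
    then consider "snd p \<notin> {fst p, fst q, snd q}" | "fst p \<notin> {snd p, fst q, snd q}" by blast
    then show ?thesis
    proof cases
      case 1
      then show ?thesis
        using pq int
        by (intro expectation_degenerate_mult[OF measurable_\<phi> measurable_\<phi> _ _ _ _ _ degenerate_\<phi>]) auto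
    next
      case 2
      \<comment> \<open>Symmetry moves the free index into the second slot, where degeneracy is
        stated.\<close>
      have "expectation (\<lambda>\<omega>. \<phi> (X (snd p) \<omega>) (X (fst p) \<omega>) * \<phi> (X (fst q) \<omega>) (X (snd q) \<omega>)) = 0"
        using pq int 2 unfolding \<phi>_sym[of "X (fst p) _" "X (snd p) _"]
        by (intro expectation_degenerate_mult[OF measurable_\<phi> measurable_\<phi> _ _ _ _ _ degenerate_\<phi>]) auto
      then show ?thesis unfolding \<phi>_sym[of "X (fst p) _" "X (snd p) _"] .
    qed
  qed
  note sums = integral_sum_orthogonal[OF fin meas sq orth]
  show "integrable M (\<lambda>\<omega>. (E \<omega>)\<^sup>2)"
    unfolding eq power_mult_distrib using sums(1) by simp
  have "expectation (\<lambda>\<omega>. (E \<omega>)\<^sup>2)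
      = (\<Sum>p\<in>?P. expectation (\<lambda>\<omega>. (\<phi> (X (fst p) \<omega>) (X (snd p) \<omega>))\<^sup>2)) * (2 / (real m * (real m - 1)))\<^sup>2"
    unfolding eq power_mult_distrib using sums(2) by simp
  also have "(\<Sum>p\<in>?P. expectation (\<lambda>\<omega>. (\<phi> (X (fst p) \<omega>) (X (snd p) \<omega>))\<^sup>2)) = (\<Sum>p\<in>?P. \<integral>(x, y). (\<phi> x y)\<^sup>2 \<partial>(F \<Otimes>\<^sub>M F))"
    by (intro sum.cong refl expectation_pair) auto
  finally have "expectation (\<lambda>\<omega>. (E \<omega>)\<^sup>2)
      = real m * (real m - 1) / 2 * (\<integral>(x, y). (\<phi> x y)\<^sup>2 \<partial>(F \<Otimes>\<^sub>M F)) * (2 / (real m * (real m - 1)))\<^sup>2"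
    unfolding sum_constant c .
  then show "expectation (\<lambda>\<omega>. (E \<omega>)\<^sup>2) = 2 * (\<integral>(x, y). (\<phi> x y)\<^sup>2 \<partial>(F \<Otimes>\<^sub>M F)) / (real m * (real m - 1))"
    using m by (simp add: power2_eq_square)
qed

end

section \<open>Laws of large numbers for arrays\<close>

text \<open>Row \<open>n\<close> is a sample of its own. For the second block the rows are shifts of
  one sequence by a varying amount, so no row extends another and statements in probability take the
  place of almost sure ones.\<close>

locale iid_array = prob_space M
  for M :: "'w measure" and X :: "nat \<Rightarrow> nat \<Rightarrow> 'w \<Rightarrow> 'a::second_countable_topology"
    and F :: "'a measure" and m :: "nat \<Rightarrow> nat" +
  assumes sample: "iid_sample M (X n) F"
    and m_at_top: "filterlim m at_top sequentially"
begin

sublocale row: iid_sample M "X n" F for n by (rule sample)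

lemma eventually_m_ge: "\<forall>\<^sub>F n in sequentially. k \<le> m n"
  using m_at_top by (simp add: filterlim_at_top)

lemma tendsto_inverse_m: "(\<lambda>n. c / real (m n)) \<longlonglongrightarrow> 0"
  by (rule real_tendsto_divide_at_top[OF tendsto_const filterlim_compose[OF filterlim_real_sequentially m_at_top]])

text \<open>The summands are only integrable, so truncation precedes the second-moment bound.\<close>

lemma weak_law_of_large_numbers:
  fixes u :: "'a \<Rightarrow> real"
  assumes u [measurable]: "u \<in> borel_measurable borel" and int: "integrable F u"
  shows "((\<lambda>x. (\<Sum>i=1..m (fst x). u (X (fst x) i (snd x))) / real (m (fst x))) \<longlongrightarrow> (\<integral>x. u x \<partial>F)) (in_prob M)"
proof -
  define f where "f n \<omega> = (\<Sum>i=1..m n. u (X n i \<omega>)) / real (m n) - (\<integral>x. u x \<partial>F)" for n \<omega>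
  note [measurable_cong] = row.sets_F
  have intX: "integrable M (\<lambda>\<omega>. v (X n i \<omega>))" if "integrable F v" "v \<in> borel_measurable borel" "i \<ge> 1" for v :: "'a \<Rightarrow> real" and n i
    using row.integrable_X_iff[of v i n] that by simp
  have int_mean: "integrable M (\<lambda>\<omega>. (\<Sum>i=1..m n. v (X n i \<omega>)) / real (m n))"
    if "integrable F v" "v \<in> borel_measurable borel" for v :: "'a \<Rightarrow> real" and n
    using that by (intro integrable_divide Bochner_Integration.integrable_sum intX) auto
  have f_int: "integrable M (f n)" for n
    unfolding f_def using int by (intro Bochner_Integration.integrable_diff int_mean) auto
  have "(\<lambda>n. expectation (\<lambda>\<omega>. \<bar>f n \<omega>\<bar>)) \<longlonglongrightarrow> 0"
  proof (rule tendstoI)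
    fix e :: real assume e: "e > 0"
    \<comment> \<open>\<open>w k\<close> is the tail that is cut off; the bounded part is
      \<open>u - w k\<close>. The tail is small in L1 by dominated convergence.\<close>
    define w where "w k x = (if \<bar>u x\<bar> \<le> real k then 0 else u x)" for k :: nat and x
    have [measurable]: "w k \<in> borel_measurable borel" for k unfolding w_def by measurable
    have "(\<lambda>k. \<integral>x. \<bar>w k x\<bar> \<partial>F) \<longlonglongrightarrow> (\<integral>x. 0 \<partial>F)"
    proof (rule integral_dominated_convergence[where w = "\<lambda>x. \<bar>u x\<bar>"])
      show "AE x in F. (\<lambda>k. \<bar>w k x\<bar>) \<longlonglongrightarrow> 0"
      proof (rule AE_I2, rule tendsto_eventually)
        fix x
        show "\<forall>\<^sub>F k in sequentially. \<bar>w k x\<bar> = 0"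
          using eventually_ge_at_top[of "nat \<lceil>\<bar>u x\<bar>\<rceil>"] by eventually_elim (simp add: w_def)
      qed
    qed (use int in \<open>auto simp: w_def\<close>)
    \<comment> \<open>The tail enters twice, through its own average and through the shift of the
      centre from \<open>u\<close> to \<open>u - w k\<close>. Two times \<open>e / 8\<close> leaves
      room for \<open>e / 4\<close> from each of the two terms of the quadratic estimate
      below.\<close>
    then have "\<forall>\<^sub>F k in sequentially. (\<integral>x. \<bar>w k x\<bar> \<partial>F) < e / 8"
      using e order_tendstoD(2)[of _ 0 sequentially "e / 8"] by simp
    then obtain k where k: "(\<integral>x. \<bar>w k x\<bar> \<partial>F) < e / 8"
      by (auto simp: eventually_sequentially)
    have w_int: "integrable F (w k)"
      by (rule Bochner_Integration.integrable_bound[OF int]) (auto simp: w_def)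
    define c where "c = (\<integral>x. u x - w k x \<partial>F)"
    define v where "v x = u x - w k x - c" for x
    have v [measurable]: "v \<in> borel_measurable borel" unfolding v_def by measurable
    have v_mean: "(\<integral>x. v x \<partial>F) = 0"
      using int w_int row.F.prob_space by (simp add: v_def c_def)
    have "\<bar>u x - w k x\<bar> \<le> real k" for x by (simp add: w_def)
    then have "\<bar>v x\<bar> \<le> real k + \<bar>c\<bar>" for x
      unfolding v_def by (metis abs_triangle_ineq4 add_right_mono order_trans)
    then have "(v x)\<^sup>2 \<le> (real k + \<bar>c\<bar>)\<^sup>2" for x
      using power_mono[of "\<bar>v x\<bar>" _ 2] by simp
    then have v_sq: "integrable F (\<lambda>x. (v x)\<^sup>2)"
      by (intro row.F.integrable_const_bound[where B = "(real k + \<bar>c\<bar>)\<^sup>2"]) auto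
    define C where "C = (\<integral>x. (v x)\<^sup>2 \<partial>F)"
    have "\<forall>\<^sub>F n in sequentially. 4 * C / e / real (m n) < e / 4"
      using order_tendstoD(2)[OF tendsto_inverse_m[of "4 * C / e"], of "e / 4"] e by simp
    with eventually_m_ge[of 1] show "\<forall>\<^sub>F n in sequentially. dist (expectation (\<lambda>\<omega>. \<bar>f n \<omega>\<bar>)) 0 < e"
    proof eventually_elim
      case (elim n)
      let ?A = "\<lambda>\<omega>. \<Sum>i=1..m n. (1 / real (m n)) * v (X n i \<omega>)"
      let ?B = "\<lambda>\<omega>. (\<Sum>i=1..m n. \<bar>w k (X n i \<omega>)\<bar>) / real (m n)"
      have A_int: "integrable M (\<lambda>\<omega>. (?A \<omega>)\<^sup>2)"
        by (rule row.expectation_sum_centered_square[OF v v_sq v_mean]) auto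
      have "expectation (\<lambda>\<omega>. (?A \<omega>)\<^sup>2) = (\<Sum>i=1..m n. (1 / real (m n))\<^sup>2) * C"
        unfolding C_def by (rule row.expectation_sum_centered_square[OF v v_sq v_mean]) auto
      then have A: "expectation (\<lambda>\<omega>. (?A \<omega>)\<^sup>2) = C / real (m n)"
        using elim(1) by (simp add: power2_eq_square)
      have wabs: "integrable F (\<lambda>x. \<bar>w k x\<bar>)" using w_int by simp
      have B_int: "integrable M ?B"
        using int_mean[OF wabs] by simp
      have "expectation ?B = (\<Sum>i=1..m n. \<integral>x. \<bar>w k x\<bar> \<partial>F) / real (m n)"
        using intX[OF wabs] row.expectation_X[of "\<lambda>x. \<bar>w k x\<bar>"]
        by (simp add: Bochner_Integration.integral_sum)
      then have B: "expectation ?B = (\<integral>x. \<bar>w k x\<bar> \<partial>F)"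
        using elim(1) by simp
      have c: "\<bar>c - (\<integral>x. u x \<partial>F)\<bar> \<le> (\<integral>x. \<bar>w k x\<bar> \<partial>F)"
        using integral_abs_bound[of F "w k"] int w_int by (simp add: c_def)
      have pt: "\<bar>f n \<omega>\<bar> \<le> e / 4 + 4 / e * (?A \<omega>)\<^sup>2 + (?B \<omega> + (\<integral>x. \<bar>w k x\<bar> \<partial>F))" for \<omega>
      proof -
        have "(\<Sum>i=1..m n. v (X n i \<omega>)) = (\<Sum>i=1..m n. u (X n i \<omega>)) - (\<Sum>i=1..m n. w k (X n i \<omega>)) - real (m n) * c"
          by (simp add: v_def sum_subtractf)
        then have "?A \<omega> = (\<Sum>i=1..m n. u (X n i \<omega>)) / real (m n) - (\<Sum>i=1..m n. w k (X n i \<omega>)) / real (m n) - c"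
          using elim(1) by (simp add: diff_divide_distrib flip: sum_divide_distrib)
        then have "f n \<omega> = ?A \<omega> + (\<Sum>i=1..m n. w k (X n i \<omega>)) / real (m n) + (c - (\<integral>x. u x \<partial>F))"
          by (simp add: f_def)
        moreover have "\<bar>(\<Sum>i=1..m n. w k (X n i \<omega>)) / real (m n)\<bar> \<le> ?B \<omega>"
          by (simp add: divide_right_mono)
        \<comment> \<open>A completed square, with weights balanced by \<open>e\<close>, converts
          the second-moment bound into an L1 bound without square roots of expectations.\<close>
        moreover have "\<bar>a\<bar> \<le> e / 4 + 4 / e * a\<^sup>2" for a
        proof -
          have "0 \<le> (\<bar>a\<bar> * 2 / sqrt e - sqrt e / 2)\<^sup>2" by simp
          also have "\<dots> = 4 / e * a\<^sup>2 + e / 4 - 2 * \<bar>a\<bar>"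
            using e by (simp add: power2_diff power_mult_distrib power_divide)
          finally show ?thesis by simp
        qed
        ultimately show ?thesis using c by (smt (verit))
      qed
      have "expectation (\<lambda>\<omega>. \<bar>f n \<omega>\<bar>) \<le> expectation (\<lambda>\<omega>. e / 4 + 4 / e * (?A \<omega>)\<^sup>2 + (?B \<omega> + (\<integral>x. \<bar>w k x\<bar> \<partial>F)))"
        using f_int[of n] A_int B_int pt
        by (intro integral_mono) (auto intro!: Bochner_Integration.integrable_add)
      also have "\<dots> = e / 4 + 4 / e * (C / real (m n)) + ((\<integral>x. \<bar>w k x\<bar> \<partial>F) + (\<integral>x. \<bar>w k x\<bar> \<partial>F))"
      proof -
        have "expectation (\<lambda>\<omega>. a + b * f \<omega> + (g \<omega> + c)) = a + b * expectation f + (expectation g + c)"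
          if "integrable M f" "integrable M g" for a b c and f g :: "'w \<Rightarrow> real"
          using that prob_space by simp
        from this[OF A_int B_int] show ?thesis unfolding A B .
      qed
      also have "4 / e * (C / real (m n)) = 4 * C / e / real (m n)" by simp
      also have "e / 4 + 4 * C / e / real (m n) + ((\<integral>x. \<bar>w k x\<bar> \<partial>F) + (\<integral>x. \<bar>w k x\<bar> \<partial>F)) < e"
        using k elim(2) e by linarith
      finally show ?case by simp
    qed
  qed
  from tendsto_in_prob_of_L1[OF _ _ this, of f] have "((\<lambda>x. f (fst x) (snd x)) \<longlongrightarrow> 0) (in_prob M)"
    using f_int by simp
  then show ?thesis
    unfolding f_def by (rule LIM_zero_cancel)
qed

text \<open>The union bound costs a factor m, but the probability that a single observation exceeds
  \<open>e * sqrt m\<close> is at most the truncated second moment divided by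
  \<open>e^2 * m\<close>. The truncated moment tends to 0 by dominated convergence, so two moments
  suffice for a maximum of smaller order than \<open>sqrt m\<close>.\<close>

lemma eventually_max_small:
  fixes u :: "'a \<Rightarrow> real"
  assumes u [measurable]: "u \<in> borel_measurable borel" and sq: "integrable F (\<lambda>x. (u x)\<^sup>2)" and e: "e > 0"
  shows "\<forall>\<^sub>F x in in_prob M. \<forall>i\<in>{1..m (fst x)}. \<bar>u (X (fst x) i (snd x))\<bar> \<le> e * sqrt (real (m (fst x)))"
proof -
  note [measurable_cong] = row.sets_F
  define q where "q k = (\<integral>x. (if \<bar>u x\<bar> > e * sqrt (real k) then (u x)\<^sup>2 else 0) \<partial>F) / e\<^sup>2" for k :: nat
  have int: "integrable F (\<lambda>x. if \<bar>u x\<bar> > e * sqrt (real k) then (u x)\<^sup>2 else 0)" for k :: nat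
    by (rule Bochner_Integration.integrable_bound[OF sq]) auto
  have "(\<lambda>k. \<integral>x. (if \<bar>u x\<bar> > e * sqrt (real k) then (u x)\<^sup>2 else 0) \<partial>F) \<longlonglongrightarrow> (\<integral>x. 0 \<partial>F)"
  proof (rule integral_dominated_convergence[where w = "\<lambda>x. (u x)\<^sup>2"])
    show "AE x in F. (\<lambda>k. if \<bar>u x\<bar> > e * sqrt (real k) then (u x)\<^sup>2 else 0) \<longlonglongrightarrow> 0"
    proof (rule AE_I2, rule tendsto_eventually)
      fix x
      have "\<forall>\<^sub>F k in sequentially. \<bar>u x\<bar> / e \<le> sqrt (real k)"
        using filterlim_compose[OF sqrt_at_top filterlim_real_sequentially] by (simp add: filterlim_at_top)
      then show "\<forall>\<^sub>F k in sequentially. (if \<bar>u x\<bar> > e * sqrt (real k) then (u x)\<^sup>2 else 0) = 0"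
        by eventually_elim (use e in \<open>auto simp: field_simps\<close>)
    qed
  qed (use sq in auto)
  then have "q \<longlonglongrightarrow> 0" unfolding q_def by (intro tendsto_divide_zero) simp
  then have q: "(\<lambda>n. q (m n)) \<longlonglongrightarrow> 0" using m_at_top by (rule filterlim_compose)
  define P where "P z \<longleftrightarrow> (\<forall>i\<in>{1..m (fst z)}. \<bar>u (X (fst z) i (snd z))\<bar> \<le> e * sqrt (real (m (fst z))))" for z
  have Pi: "{\<omega>\<in>space M. e * sqrt (real (m n)) < \<bar>u (X n i \<omega>)\<bar>} \<in> sets M" if "i \<ge> 1" for n i
  proof -
    note [measurable] = row.measurable_X[OF that]
    show ?thesis by measurable
  qed
  have eq: "{\<omega>\<in>space M. \<not> P (n, \<omega>)} = (\<Union>i\<in>{1..m n}. {\<omega>\<in>space M. e * sqrt (real (m n)) < \<bar>u (X n i \<omega>)\<bar>})" for n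
    by (auto simp: P_def not_le)
  have bound: "prob {\<omega>\<in>space M. \<not> P (n, \<omega>)} \<le> q (m n)" if n: "m n \<ge> 1" for n
  proof -
    let ?t = "e * sqrt (real (m n))"
    have "prob {\<omega>\<in>space M. \<not> P (n, \<omega>)} \<le> (\<Sum>i=1..m n. prob {\<omega>\<in>space M. ?t < \<bar>u (X n i \<omega>)\<bar>})"
      unfolding eq using Pi by (intro measure_UNION_le) auto
    also have "\<dots> = (\<Sum>i=1..m n. measure F {x. ?t < \<bar>u x\<bar>})"
    proof (intro sum.cong refl)
      fix i assume i: "i \<in> {1..m n}"
      note [measurable] = row.measurable_X[of i n]
      have "measure F {x. ?t < \<bar>u x\<bar>} = measure (distr M borel (X n i)) {x. ?t < \<bar>u x\<bar>}"
        using i row.ident[of i n] by simp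
      also have "\<dots> = prob {\<omega>\<in>space M. ?t < \<bar>u (X n i \<omega>)\<bar>}"
        using i by (subst measure_distr) (auto intro!: arg_cong[where f = prob])
      finally show "prob {\<omega>\<in>space M. ?t < \<bar>u (X n i \<omega>)\<bar>} = measure F {x. ?t < \<bar>u x\<bar>}" by simp
    qed
    finally have 1: "prob {\<omega>\<in>space M. \<not> P (n, \<omega>)} \<le> real (m n) * measure F {x. ?t < \<bar>u x\<bar>}" by simp
    \<comment> \<open>Markov's inequality is applied to the truncated square: with the full square
      the bound would stay of constant order after multiplication by the sample size.\<close>
    have "measure F {x. ?t < \<bar>u x\<bar>} \<le> measure F {x\<in>space F. ?t\<^sup>2 \<le> (if \<bar>u x\<bar> > ?t then (u x)\<^sup>2 else 0)}"
    proof (rule row.F.finite_measure_mono)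
      show "{x. ?t < \<bar>u x\<bar>} \<subseteq> {x\<in>space F. ?t\<^sup>2 \<le> (if \<bar>u x\<bar> > ?t then (u x)\<^sup>2 else 0)}"
      proof
        fix x assume "x \<in> {x. ?t < \<bar>u x\<bar>}"
        then have x: "?t < \<bar>u x\<bar>" by simp
        then have "?t\<^sup>2 \<le> \<bar>u x\<bar>\<^sup>2" using e by (intro power_mono) auto
        with x show "x \<in> {x\<in>space F. ?t\<^sup>2 \<le> (if \<bar>u x\<bar> > ?t then (u x)\<^sup>2 else 0)}" by simp
      qed
    qed measurable
    also have "\<dots> \<le> (\<integral>x. (if \<bar>u x\<bar> > ?t then (u x)\<^sup>2 else 0) \<partial>F) / ?t\<^sup>2"
      using e n by (intro integral_Markov_inequality_measure[where A = "{}"] int) auto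
    also have "\<dots> = q (m n) / real (m n)"
      using n e by (simp add: q_def power_mult_distrib)
    finally have "measure F {x. ?t < \<bar>u x\<bar>} \<le> q (m n) / real (m n)" .
    then have "real (m n) * measure F {x. ?t < \<bar>u x\<bar>} \<le> q (m n)"
      using n by (simp add: field_simps)
    with 1 show ?thesis by linarith
  qed
  have "eventually P (in_prob M)"
  proof (rule eventually_in_probI)
    show "{\<omega>\<in>space M. \<not> P (n, \<omega>)} \<in> sets M" for n
      unfolding eq using Pi by (intro sets.finite_UN) auto
    have "\<forall>\<^sub>F n in sequentially. prob {\<omega>\<in>space M. \<not> P (n, \<omega>)} \<le> q (m n)"
      using eventually_m_ge[of 1] by eventually_elim (rule bound)
    then show "(\<lambda>n. prob {\<omega>\<in>space M. \<not> P (n, \<omega>)}) \<longlonglongrightarrow> 0"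
      by (rule tendsto_sandwich[OF _ _ tendsto_const q, rotated]) simp
  qed
  then show ?thesis by (simp only: P_def[abs_def])
qed

end

section \<open>Limits of jackknife statistics\<close>

locale kernel_array = prob_space M
  for M :: "'w measure" and X :: "nat \<Rightarrow> nat \<Rightarrow> 'w \<Rightarrow> 'a::second_countable_topology"
    and F :: "'a measure" and m :: "nat \<Rightarrow> nat" and h :: "'a \<Rightarrow> 'a \<Rightarrow> real" and g :: "'a \<Rightarrow> real" and \<theta> :: real +
  assumes kernel: "iid_kernel M (X n) F h g \<theta>"
    and size_at_top: "filterlim m at_top sequentially"
begin

sublocale krow: iid_kernel M "X n" F h g \<theta> for n by (rule kernel)

sublocale iid_array M X F m
  by unfold_locales (simp_all add: krow.iid_sample_axioms size_at_top)

definition U :: "nat \<times> 'w \<Rightarrow> real" where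
  "U z = U_stat h (\<lambda>i. X (fst z) i (snd z)) {1..m (fst z)}"

definition V :: "nat \<times> 'w \<Rightarrow> nat \<Rightarrow> real" where
  "V z i = pseudo_value h (\<lambda>i. X (fst z) i (snd z)) (m (fst z)) i"

definition gbar :: "nat \<times> 'w \<Rightarrow> real" where
  "gbar z = (\<Sum>i=1..m (fst z). g (X (fst z) i (snd z))) / real (m (fst z))"

definition res :: "nat \<times> 'w \<Rightarrow> nat \<Rightarrow> real" where
  "res z i = leave_one_mean h (\<lambda>i. X (fst z) i (snd z)) (m (fst z)) i - \<theta> - g (X (fst z) i (snd z))"

definition res2 :: "nat \<times> 'w \<Rightarrow> real" where
  "res2 z = (\<Sum>i=1..m (fst z). (res z i)\<^sup>2) / real (m (fst z))"

lemma eventually_m_ge_in_prob: "\<forall>\<^sub>F z in in_prob M. k \<le> m (fst z)"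
  using filterlim_fst_in_prob eventually_m_ge[of k] by (auto simp: filterlim_iff)

lemma gbar_tendsto: "(gbar \<longlongrightarrow> 0) (in_prob M)"
  using weak_law_of_large_numbers[OF krow.g_meas krow.integrable_g]
  unfolding krow.g_mean gbar_def[abs_def] .

lemma gbar2_tendsto:
  "((\<lambda>z. (\<Sum>i=1..m (fst z). (g (X (fst z) i (snd z)))\<^sup>2) / real (m (fst z))) \<longlongrightarrow> (\<integral>x. (g x)\<^sup>2 \<partial>F)) (in_prob M)"
  by (rule weak_law_of_large_numbers[OF _ krow.g_sq]) measurable

text \<open>The difference of the two U-statistics is itself of order \<open>1 / sqrt m\<close>, so
  consistency of the projection is not enough; the remainder has to vanish after this
  scaling.\<close>

lemma U_linearization: "((\<lambda>z. sqrt (real (m (fst z))) * (U z - \<theta> - 2 * gbar z)) \<longlongrightarrow> 0) (in_prob M)"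
proof -
  define E where "E n \<omega> = sqrt (real (m n)) * (U (n, \<omega>) - \<theta> - 2 * gbar (n, \<omega>))" for n \<omega>
  define C where "C = (\<integral>(x, y). (krow.\<phi> x y)\<^sup>2 \<partial>(F \<Otimes>\<^sub>M F))"
  have "((\<lambda>z. E (fst z) (snd z)) \<longlongrightarrow> 0) (in_prob M)"
  proof (rule tendsto_in_prob_of_L2)
    note err = krow.U_stat_projection_error[of "m n" n for n, folded C_def]
    have eq: "(E n \<omega>)\<^sup>2 = real (m n) * (U_stat h (\<lambda>i. X n i \<omega>) {1..m n} - \<theta> - 2 * ((\<Sum>i=1..m n. g (X n i \<omega>)) / real (m n)))\<^sup>2" for n \<omega>
      by (simp add: E_def U_def gbar_def power_mult_distrib)
    show "\<forall>\<^sub>F n in sequentially. integrable M (\<lambda>\<omega>. (E n \<omega>)\<^sup>2)"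
      using eventually_m_ge[of 2] by eventually_elim (simp only: eq integrable_mult_right[OF err(1)])
    show "\<forall>\<^sub>F n in sequentially. expectation (\<lambda>\<omega>. (E n \<omega>)\<^sup>2) \<le> 4 * C / real (m n)"
      using eventually_m_ge[of 2]
    proof eventually_elim
      case (elim n)
      have C: "C \<ge> 0" unfolding C_def by (intro Bochner_Integration.integral_nonneg) auto
      have "expectation (\<lambda>\<omega>. (E n \<omega>)\<^sup>2) = real (m n) * (2 * C / (real (m n) * (real (m n) - 1)))"
        unfolding eq using err(2)[OF elim] by simp
      also have "\<dots> = 2 * C / (real (m n) - 1)" using elim by simp
      also have "\<dots> \<le> 2 * C / (real (m n) / 2)" using elim C by (intro divide_left_mono) auto
      finally show ?case by (simp add: mult.commute)
    qed
    show "(\<lambda>n. 4 * C / real (m n)) \<longlonglongrightarrow> 0" by (rule tendsto_inverse_m)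
  qed
  then show ?thesis by (simp add: E_def)
qed

lemma res2_tendsto: "(res2 \<longlongrightarrow> 0) (in_prob M)"
proof -
  define E where "E n \<omega> = res2 (n, \<omega>)" for n \<omega>
  define C where "C = (\<integral>(x, y). (krow.\<psi> x y)\<^sup>2 \<partial>(F \<Otimes>\<^sub>M F))"
  have "((\<lambda>z. E (fst z) (snd z)) \<longlongrightarrow> 0) (in_prob M)"
  proof (rule tendsto_in_prob_of_L1)
    note err = krow.residual_square[of "m n" _ n for n, folded C_def]
    have int: "integrable M (E n)" if "m n \<ge> 2" for n
      unfolding E_def[abs_def] res2_def res_def fst_conv snd_conv using err(1)[OF that]
      by (intro integrable_divide Bochner_Integration.integrable_sum) auto
    then show "\<forall>\<^sub>F n in sequentially. integrable M (E n)"
      using eventually_m_ge[of 2] by (rule eventually_mono[rotated])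
    show "\<forall>\<^sub>F n in sequentially. expectation (\<lambda>\<omega>. \<bar>E n \<omega>\<bar>) \<le> 2 * C / real (m n)"
      using eventually_m_ge[of 2]
    proof eventually_elim
      case (elim n)
      have C: "C \<ge> 0" unfolding C_def by (intro Bochner_Integration.integral_nonneg) auto
      have "\<bar>E n \<omega>\<bar> = E n \<omega>" for \<omega> by (simp add: E_def res2_def sum_nonneg)
      then have "expectation (\<lambda>\<omega>. \<bar>E n \<omega>\<bar>) = expectation (E n)" by simp
      also have "\<dots> = (\<Sum>i=1..m n. C / (real (m n) - 1)) / real (m n)"
        unfolding E_def[abs_def] res2_def res_def fst_conv snd_conv using err[OF elim]
        by (simp add: Bochner_Integration.integral_sum)
      also have "\<dots> = C / (real (m n) - 1)" using elim by simp
      also have "\<dots> \<le> C / (real (m n) / 2)" using elim C by (intro divide_left_mono) auto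
      finally show ?case by (simp add: mult.commute)
    qed
    show "(\<lambda>n. 2 * C / real (m n)) \<longlonglongrightarrow> 0" by (rule tendsto_inverse_m)
  qed
  then show ?thesis by (simp add: E_def)
qed

lemma U_eq: "m (fst z) \<ge> 2 \<Longrightarrow> U z = \<theta> + gbar z + (\<Sum>i=1..m (fst z). res z i) / real (m (fst z))"
  unfolding U_def gbar_def res_def
  by (subst U_stat_eq_mean[OF krow.h_sym])
    (simp_all add: sum.distrib sum_subtractf diff_divide_distrib)

lemma mean_res_sq_le: "((\<Sum>i=1..m (fst z). res z i) / real (m (fst z)))\<^sup>2 \<le> res2 z"
proof (cases "m (fst z) = 0")
  case False
  have "(\<Sum>i=1..m (fst z). 1 * res z i)\<^sup>2 \<le> (\<Sum>i=1..m (fst z). 1\<^sup>2) * (\<Sum>i=1..m (fst z). (res z i)\<^sup>2)"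
    by (rule Cauchy_Schwarz_ineq_sum)
  then show ?thesis using False by (simp add: res2_def power_divide power2_eq_square field_simps)
qed (simp add: res2_def)

lemma tendsto_zero_of_square_le:
  fixes f b :: "'b \<Rightarrow> real"
  assumes "\<And>z. (f z)\<^sup>2 \<le> b z" "(b \<longlongrightarrow> 0) G"
  shows "(f \<longlongrightarrow> 0) G"
proof (rule Lim_null_comparison)
  show "\<forall>\<^sub>F z in G. norm (f z) \<le> sqrt (b z)"
    using assms(1) by (auto intro!: always_eventually real_le_rsqrt)
  show "((\<lambda>z. sqrt (b z)) \<longlongrightarrow> 0) G" using tendsto_real_sqrt[OF assms(2)] by simp
qed

lemma mean_res_tendsto: "((\<lambda>z. (\<Sum>i=1..m (fst z). res z i) / real (m (fst z))) \<longlongrightarrow> 0) (in_prob M)"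
  by (rule tendsto_zero_of_square_le[OF mean_res_sq_le res2_tendsto])

lemma U_tendsto: "(U \<longlongrightarrow> \<theta>) (in_prob M)"
proof -
  have "((\<lambda>z. \<theta> + gbar z + (\<Sum>i=1..m (fst z). res z i) / real (m (fst z))) \<longlongrightarrow> \<theta> + 0 + 0) (in_prob M)"
    by (intro tendsto_add tendsto_const gbar_tendsto mean_res_tendsto)
  then have "((\<lambda>z. \<theta> + gbar z + (\<Sum>i=1..m (fst z). res z i) / real (m (fst z))) \<longlongrightarrow> \<theta>) (in_prob M)" by simp
  then show ?thesis
    by (rule Lim_transform_eventually)
      (use eventually_m_ge_in_prob[of 2] in \<open>eventually_elim, simp add: U_eq\<close>)
qed

lemma mean_V: "m (fst z) \<ge> 3 \<Longrightarrow> (\<Sum>i=1..m (fst z). V z i) / real (m (fst z)) = U z"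
  unfolding V_def U_def by (rule mean_pseudo_value[OF krow.h_sym])

lemma V_deviation:
  assumes "m (fst z) \<ge> 3" "i \<in> {1..m (fst z)}"
  shows "V z i - U z = 2 * (real (m (fst z)) - 1) / (real (m (fst z)) - 2) * (g (X (fst z) i (snd z)) + res z i - (U z - \<theta>))"
  unfolding V_def U_def using pseudo_value_deviation[of h, OF krow.h_sym assms]
  by (simp add: res_def)

text \<open>By \<open>V_deviation\<close> there are three contributions: the values of
  \<open>g\<close>, which the maximal inequality controls, the residuals, which their mean square
  controls, and the common error of \<open>U\<close>.\<close>

lemma V_max_deviation:
  assumes e: "e > 0"
  shows "\<forall>\<^sub>F z in in_prob M. \<forall>i\<in>{1..m (fst z)}. \<bar>V z i - U z\<bar> \<le> e * sqrt (real (m (fst z)))"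
proof -
  \<comment> \<open>The 9 is 3 times 3: three contributions of size \<open>d * sqrt m\<close>, and a
    jackknife factor \<open>2 * (m - 1) / (m - 2)\<close> that is at most 3 for
    \<open>m \<ge> 4\<close>.\<close>
  define d where "d = e / 9"
  have d: "d > 0" using e by (simp add: d_def)
  have "\<forall>\<^sub>F z in in_prob M. \<bar>U z - \<theta>\<bar> < d"
    using tendstoD[OF U_tendsto d] by (simp add: dist_real_def)
  moreover have "\<forall>\<^sub>F z in in_prob M. res2 z < d\<^sup>2"
    using order_tendstoD(2)[OF res2_tendsto, of "d\<^sup>2"] d by simp
  ultimately show ?thesis
    using eventually_max_small[OF krow.g_meas krow.g_sq d] eventually_m_ge_in_prob[of 4]
  proof eventually_elim
    case (elim z)
    let ?m = "real (m (fst z))"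
    have m: "?m \<ge> 4" using elim(4) by simp
    \<comment> \<open>One squared residual is at most the sum of all of them, and their mean square
      tends to 0, so the maximum of the residuals needs no union bound.\<close>
    have r: "\<bar>res z i\<bar> \<le> d * sqrt ?m" if "i \<in> {1..m (fst z)}" for i
    proof -
      have "(res z i)\<^sup>2 \<le> (\<Sum>i=1..m (fst z). (res z i)\<^sup>2)"
        using that by (intro member_le_sum) auto
      also have "\<dots> = ?m * res2 z" using m by (simp add: res2_def)
      also have "\<dots> \<le> ?m * d\<^sup>2" using elim(2) by (intro mult_left_mono) auto
      also have "\<dots> = (d * sqrt ?m)\<^sup>2" by (simp add: power_mult_distrib)
      finally show ?thesis
        using d by (intro abs_le_square_iff[THEN iffD2, of "res z i" "d * sqrt ?m", simplified abs_mult, THEN order_trans]) auto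
    qed
    have s: "1 \<le> sqrt ?m" using m by simp
    have c: "0 \<le> 2 * (?m - 1) / (?m - 2)" "2 * (?m - 1) / (?m - 2) \<le> 3"
      using m by (auto simp: field_simps)
    show ?case
    proof
      fix i assume i: "i \<in> {1..m (fst z)}"
      have "\<bar>U z - \<theta>\<bar> \<le> d * sqrt ?m" using elim(1) s d mult_left_mono[OF s, of d] by linarith
      then have "\<bar>g (X (fst z) i (snd z)) + res z i - (U z - \<theta>)\<bar> \<le> 3 * (d * sqrt ?m)"
        using r[OF i] bspec[OF elim(3) i] by linarith
      then have "2 * (?m - 1) / (?m - 2) * \<bar>g (X (fst z) i (snd z)) + res z i - (U z - \<theta>)\<bar> \<le> 3 * (3 * (d * sqrt ?m))"
        using c by (intro mult_mono) auto
      then show "\<bar>V z i - U z\<bar> \<le> e * sqrt ?m"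
        using V_deviation[OF _ i] m c(1) by (simp add: abs_mult d_def)
    qed
  qed
qed

text \<open>Turns the uniform smallness of the deviations into one random variable that can enter
  products and limits. The inserted 0 makes the maximum meaningful for an empty sample.\<close>

definition vmax :: "nat \<times> 'w \<Rightarrow> real" where
  "vmax z = Max (insert 0 ((\<lambda>i. \<bar>V z i - U z\<bar>) ` {1..m (fst z)})) / sqrt (real (m (fst z)))"

lemma V_deviation_le_vmax: "i \<in> {1..m (fst z)} \<Longrightarrow> \<bar>V z i - U z\<bar> \<le> vmax z * sqrt (real (m (fst z)))"
proof -
  assume i: "i \<in> {1..m (fst z)}"
  then have "\<bar>V z i - U z\<bar> \<le> Max (insert 0 ((\<lambda>i. \<bar>V z i - U z\<bar>) ` {1..m (fst z)}))"
    by (intro Max_ge) auto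
  then show ?thesis using i by (simp only: vmax_def) simp
qed

lemma vmax_tendsto: "(vmax \<longlongrightarrow> 0) (in_prob M)"
proof (rule tendstoI)
  fix e :: real assume e: "e > 0"
  then have "e / 2 > 0" by simp
  from V_max_deviation[OF this] eventually_m_ge_in_prob[of 1]
  show "\<forall>\<^sub>F z in in_prob M. dist (vmax z) 0 < e"
  proof eventually_elim
    case (elim z)
    let ?S = "insert 0 ((\<lambda>i. \<bar>V z i - U z\<bar>) ` {1..m (fst z)})"
    have pos: "sqrt (real (m (fst z))) > 0" using elim(2) by simp
    have "Max ?S \<le> e / 2 * sqrt (real (m (fst z)))"
      using elim(1) e by (subst Max_le_iff) auto
    then have "vmax z \<le> e / 2" unfolding vmax_def using pos by (simp only: pos_divide_le_eq)
    moreover have "0 \<le> vmax z" unfolding vmax_def by (intro divide_nonneg_nonneg Max_ge) auto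
    ultimately show ?case using e by simp
  qed
qed

text \<open>Expanding the square leaves the mean square of \<open>g\<close>; the cross term vanishes
  by Cauchy-Schwarz against the residuals, and the centring error because \<open>U\<close> is
  consistent.\<close>

lemma V_variance_tendsto:
  "((\<lambda>z. (\<Sum>i=1..m (fst z). (V z i - U z)\<^sup>2) / real (m (fst z))) \<longlongrightarrow> 4 * (\<integral>x. (g x)\<^sup>2 \<partial>F)) (in_prob M)"
proof -
  define A where "A z = (\<Sum>i=1..m (fst z). (g (X (fst z) i (snd z)))\<^sup>2) / real (m (fst z))" for z
  define B where "B z = (\<Sum>i=1..m (fst z). g (X (fst z) i (snd z)) * res z i) / real (m (fst z))" for z
  define c where "c k = 2 * (real k - 1) / (real k - 2)" for k :: nat
  have A: "(A \<longlongrightarrow> (\<integral>x. (g x)\<^sup>2 \<partial>F)) (in_prob M)"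
    unfolding A_def by (rule gbar2_tendsto)
  have B: "(B \<longlongrightarrow> 0) (in_prob M)"
  proof (rule tendsto_zero_of_square_le)
    fix z
    show "(B z)\<^sup>2 \<le> A z * res2 z"
      using Cauchy_Schwarz_ineq_sum[of "\<lambda>i. g (X (fst z) i (snd z))" "res z" "{1..m (fst z)}"]
      by (simp add: A_def B_def res2_def power_divide power2_eq_square divide_right_mono)
    show "((\<lambda>z. A z * res2 z) \<longlongrightarrow> 0) (in_prob M)"
      using tendsto_mult[OF A res2_tendsto] by simp
  qed
  have "c \<longlonglongrightarrow> 2" unfolding c_def by real_asymp
  then have c: "((\<lambda>z. c (m (fst z))) \<longlongrightarrow> 2) (in_prob M)"
    by (rule filterlim_compose[OF _ filterlim_compose[OF m_at_top filterlim_fst_in_prob]])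
  have "((\<lambda>z. (c (m (fst z)))\<^sup>2 * (A z + 2 * B z + res2 z - (U z - \<theta>)\<^sup>2)) \<longlongrightarrow>
      2\<^sup>2 * ((\<integral>x. (g x)\<^sup>2 \<partial>F) + 2 * 0 + 0 - (\<theta> - \<theta>)\<^sup>2)) (in_prob M)"
    by (intro tendsto_intros A B c res2_tendsto U_tendsto)
  then have "((\<lambda>z. (c (m (fst z)))\<^sup>2 * (A z + 2 * B z + res2 z - (U z - \<theta>)\<^sup>2)) \<longlongrightarrow> 4 * (\<integral>x. (g x)\<^sup>2 \<partial>F)) (in_prob M)"
    by simp
  then show ?thesis
  proof (rule Lim_transform_eventually)
    show "\<forall>\<^sub>F z in in_prob M. (c (m (fst z)))\<^sup>2 * (A z + 2 * B z + res2 z - (U z - \<theta>)\<^sup>2)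
        = (\<Sum>i=1..m (fst z). (V z i - U z)\<^sup>2) / real (m (fst z))"
      using eventually_m_ge_in_prob[of 3]
    proof eventually_elim
      case (elim z)
      define k where "k = m (fst z)"
      define a b where "a i = g (X (fst z) i (snd z))" and "b i = res z i" for i
      define u where "u = U z - \<theta>"
      have k: "k \<ge> 3" using elim by (simp add: k_def)
      \<comment> \<open>The mean of \<open>a i + b i\<close> is exactly \<open>u\<close>, so the two
        terms of the expansion containing \<open>u\<close> combine into
        \<open>- real k * u\<^sup>2\<close>.\<close>
      have mean: "(\<Sum>i=1..k. a i + b i) = real k * u"
        using U_eq[of z] k by (simp add: u_def k_def a_def b_def gbar_def sum.distrib field_simps)
      have "(\<Sum>i=1..k. (V z i - U z)\<^sup>2) = (\<Sum>i=1..k. (c k)\<^sup>2 * (a i + b i - u)\<^sup>2)"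
        using V_deviation[of z] k by (intro sum.cong refl) (simp add: c_def k_def a_def b_def u_def power_mult_distrib power_divide)
      also have "\<dots> = (c k)\<^sup>2 * ((\<Sum>i=1..k. (a i)\<^sup>2) + 2 * (\<Sum>i=1..k. a i * b i) + (\<Sum>i=1..k. (b i)\<^sup>2)
          - 2 * u * (\<Sum>i=1..k. a i + b i) + real k * u\<^sup>2)"
        by (simp add: sum_distrib_left sum.distrib sum_subtractf power2_eq_square algebra_simps)
      also have "\<dots> = real k * ((c k)\<^sup>2 * (A z + 2 * B z + res2 z - u\<^sup>2))"
        using k unfolding mean
        by (simp add: A_def B_def res2_def k_def[symmetric] a_def[symmetric] b_def[symmetric] power2_eq_square field_simps)
      finally show ?case using k by (simp add: k_def u_def)
    qed
  qed
qed

end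

section \<open>Two-sample central limit theorem\<close>

text \<open>Powers of numbers in the unit disc differ by at most m times the difference of their
  bases, and this factor is offset by the bound on \<open>real (m n) * (t n)\<^sup>2\<close>. The
  comparison is with a Gaussian factor that varies with n, so this product need only be bounded, not
  convergent.\<close>

lemma (in real_distribution) char_power_approx:
  assumes int: "integrable M (\<lambda>x. x\<^sup>2)" and mean: "expectation (\<lambda>x. x) = 0"
    and var: "expectation (\<lambda>x. x\<^sup>2) = \<sigma>\<^sup>2"
    and t: "\<And>n. real (m n) * (t n)\<^sup>2 \<le> C" and t0: "t \<longlonglongrightarrow> 0"
  shows "(\<lambda>n. char M (t n) ^ m n - exp (- (\<sigma>\<^sup>2 * real (m n) * (t n)\<^sup>2 / 2))) \<longlonglongrightarrow> 0"
proof (rule Lim_null_comparison)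
  \<comment> \<open>The Taylor remainder of the characteristic function with
    \<open>s\<^sup>2 / 6\<close> taken out. It tends to 0 with \<open>s\<close> by dominated
    convergence, without a third moment.\<close>
  define r where "r s = expectation (\<lambda>x. min (6 * x\<^sup>2) (\<bar>s\<bar> * \<bar>x\<bar> ^ 3))" for s
  have int1: "integrable M (\<lambda>x. x)"
    by (rule square_integrable_imp_integrable[OF _ int]) simp
  have C: "C \<ge> 0" using t[of 0] by (meson mult_nonneg_nonneg of_nat_0_le_iff order_trans zero_le_power2)
  have "(\<lambda>n. r (t n)) \<longlonglongrightarrow> expectation (\<lambda>x. 0)"
    unfolding r_def
  proof (rule integral_dominated_convergence[where w = "\<lambda>x. 6 * x\<^sup>2"])
    show "AE x in M. (\<lambda>n. min (6 * x\<^sup>2) (\<bar>t n\<bar> * \<bar>x\<bar> ^ 3)) \<longlonglongrightarrow> 0"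
    proof (rule AE_I2)
      fix x
      have "(\<lambda>n. min (6 * x\<^sup>2) (\<bar>t n\<bar> * \<bar>x\<bar> ^ 3)) \<longlonglongrightarrow> min (6 * x\<^sup>2) (\<bar>0\<bar> * \<bar>x\<bar> ^ 3)"
        by (intro tendsto_intros t0)
      then show "(\<lambda>n. min (6 * x\<^sup>2) (\<bar>t n\<bar> * \<bar>x\<bar> ^ 3)) \<longlonglongrightarrow> 0" by simp
    qed
  qed (use int in auto)
  then have "(\<lambda>n. C * (r (t n) / 6 + \<sigma> ^ 4 * (t n)\<^sup>2)) \<longlonglongrightarrow> C * (0 / 6 + \<sigma> ^ 4 * 0\<^sup>2)"
    by (intro tendsto_intros t0) simp_all
  then show "(\<lambda>n. C * (r (t n) / 6 + \<sigma> ^ 4 * (t n)\<^sup>2)) \<longlonglongrightarrow> 0" by simp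
  have r0: "0 \<le> r s" for s unfolding r_def by (intro Bochner_Integration.integral_nonneg) simp
  have key: "cmod (char M s - exp (- (\<sigma>\<^sup>2 * s\<^sup>2 / 2))) \<le> s\<^sup>2 * (r s / 6 + \<sigma> ^ 4 * s\<^sup>2)" if s: "\<sigma>\<^sup>2 * s\<^sup>2 / 2 \<le> 1" for s
  proof -
    let ?y = "- (\<sigma>\<^sup>2 * s\<^sup>2 / 2)"
    have 1: "cmod (char M s - (1 - s\<^sup>2 * \<sigma>\<^sup>2 / 2)) \<le> s\<^sup>2 / 6 * r s"
      unfolding r_def by (rule char_approx3[OF int1 mean int]) (simp add: mean var)
    have "exp ?y \<ge> 1 + ?y" by (rule exp_ge_add_one_self)
    moreover have "exp ?y \<le> 1 + ?y + ?y\<^sup>2"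
    proof -
      have "exp ?y = inverse (exp (\<sigma>\<^sup>2 * s\<^sup>2 / 2))" by (rule exp_minus)
      also have "\<dots> \<le> inverse (1 + \<sigma>\<^sup>2 * s\<^sup>2 / 2)"
        by (intro le_imp_inverse_le exp_ge_add_one_self) (simp add: add_pos_nonneg)
      also have "\<dots> \<le> 1 + ?y + ?y\<^sup>2"
      proof -
        have "inverse (1 + z) \<le> 1 - z + z\<^sup>2" if "0 \<le> z" for z :: real
        proof -
          have "1 \<le> (1 - z + z\<^sup>2) * (1 + z)" using that by (simp add: algebra_simps power2_eq_square)
          then show ?thesis using that by (simp add: field_simps)
        qed
        from this[of "\<sigma>\<^sup>2 * s\<^sup>2 / 2"] show ?thesis by simp
      qed
      finally show ?thesis .
    qed
    ultimately have 2: "\<bar>exp ?y - (1 + ?y)\<bar> \<le> ?y\<^sup>2" by simp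
    have "cmod (char M s - exp ?y) = cmod ((char M s - (1 - s\<^sup>2 * \<sigma>\<^sup>2 / 2)) - complex_of_real (exp ?y - (1 + ?y)))"
      by (simp add: mult.commute)
    also have "\<dots> \<le> cmod (char M s - (1 - s\<^sup>2 * \<sigma>\<^sup>2 / 2)) + \<bar>exp ?y - (1 + ?y)\<bar>"
      by (metis norm_triangle_ineq4 norm_of_real)
    also have "\<dots> \<le> s\<^sup>2 / 6 * r s + ?y\<^sup>2" using 1 2 by linarith
    also have "?y\<^sup>2 \<le> \<sigma> ^ 4 * s ^ 4"
      by (simp add: power_divide power_mult_distrib flip: power_mult)
    finally show ?thesis by (simp add: algebra_simps power4_eq_xxxx power2_eq_square)
  qed
  have "(\<lambda>n. \<sigma>\<^sup>2 * (t n)\<^sup>2 / 2) \<longlonglongrightarrow> \<sigma>\<^sup>2 * 0\<^sup>2 / 2"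
    by (intro tendsto_intros t0) simp_all
  then have "\<forall>\<^sub>F n in sequentially. \<sigma>\<^sup>2 * (t n)\<^sup>2 / 2 < 1"
    by (rule order_tendstoD(2)) simp
  then show "\<forall>\<^sub>F n in sequentially. norm (char M (t n) ^ m n - exp (- (\<sigma>\<^sup>2 * real (m n) * (t n)\<^sup>2 / 2)))
      \<le> C * (r (t n) / 6 + \<sigma> ^ 4 * (t n)\<^sup>2)"
  proof eventually_elim
    case (elim n)
    have "exp (- (\<sigma>\<^sup>2 * real (m n) * (t n)\<^sup>2 / 2)) = exp (- (\<sigma>\<^sup>2 * (t n)\<^sup>2 / 2)) ^ m n"
      by (simp flip: exp_of_nat_mult add: algebra_simps)
    then have "norm (char M (t n) ^ m n - exp (- (\<sigma>\<^sup>2 * real (m n) * (t n)\<^sup>2 / 2)))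
        = norm (char M (t n) ^ m n - complex_of_real (exp (- (\<sigma>\<^sup>2 * (t n)\<^sup>2 / 2))) ^ m n)"
      by simp
    also have "\<dots> \<le> real (m n) * norm (char M (t n) - exp (- (\<sigma>\<^sup>2 * (t n)\<^sup>2 / 2)))"
      by (rule norm_power_diff) (auto simp: cmod_char_le_1)
    also have "\<dots> \<le> real (m n) * ((t n)\<^sup>2 * (r (t n) / 6 + \<sigma> ^ 4 * (t n)\<^sup>2))"
      using elim by (intro mult_left_mono key) auto
    also have "\<dots> \<le> C * (r (t n) / 6 + \<sigma> ^ 4 * (t n)\<^sup>2)"
      unfolding mult.assoc[symmetric] using r0 by (intro mult_right_mono t) auto
    finally show ?case .
  qed
qed

context iid_sample
begin

lemma char_weighted_sum:
  fixes u :: "'a \<Rightarrow> real"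
  assumes u [measurable]: "u \<in> borel_measurable borel" and S: "S \<subseteq> {1..}"
  shows "char (distr M borel (\<lambda>\<omega>. \<Sum>i\<in>S. c i * u (X i \<omega>))) t = (\<Prod>i\<in>S. char (distr F borel u) (t * c i))"
proof -
  have iv: "indep_vars (\<lambda>_. borel) (\<lambda>i \<omega>. c i * u (X i \<omega>)) S"
    by (rule indep_vars_compose2[OF indep_vars_subset[OF indep S], where Y = "\<lambda>i x. c i * u x"]) measurable
  have "char (distr M borel (\<lambda>\<omega>. c i * u (X i \<omega>))) t = char (distr F borel u) (t * c i)" if "i \<in> S" for i
  proof -
    have i: "i \<ge> 1" using that S by auto
    note [measurable] = measurable_X[OF i]
    have "distr F borel u = distr M borel (\<lambda>\<omega>. u (X i \<omega>))"
      unfolding ident[OF i, symmetric] by (subst distr_distr) (auto simp: o_def)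
    then show ?thesis
      by (simp add: char_def integral_distr mult.assoc)
  qed
  then show ?thesis
    by (simp add: char_distr_sum[OF iv])
qed

text \<open>With \<open>c = 1 / (\<sigma> sqrt (1/m1 + 1/m2))\<close>, the weights \<open>c/m1\<close> and \<open>-c/m2\<close> satisfy
  \<open>\<sigma>\<^sup>2 (m1 (c/m1)\<^sup>2 + m2 (c/m2)\<^sup>2) = 1\<close> exactly, so the product of the two Gaussian
  characteristic functions is constant in \<open>n\<close>.\<close>

lemma two_sample_clt:
  fixes u :: "'a \<Rightarrow> real" and m1 m2 :: "nat \<Rightarrow> nat"
  assumes u [measurable]: "u \<in> borel_measurable borel" and sq: "integrable F (\<lambda>x. (u x)\<^sup>2)"
    and mean: "(\<integral>x. u x \<partial>F) = 0" and var: "(\<integral>x. (u x)\<^sup>2 \<partial>F) = \<sigma>\<^sup>2" and \<sigma>: "\<sigma> > 0"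
    and m1: "filterlim m1 at_top sequentially" "\<And>n. m1 n \<ge> 1"
    and m2: "filterlim m2 at_top sequentially" "\<And>n. m2 n \<ge> 1"
  defines "Z \<equiv> \<lambda>n \<omega>. ((\<Sum>i=1..m1 n. u (X i \<omega>)) / real (m1 n) - (\<Sum>i=1..m2 n. u (X (m1 n + i) \<omega>)) / real (m2 n))
      / (\<sigma> * sqrt (1 / real (m1 n) + 1 / real (m2 n)))"
  shows "\<And>n. Z n \<in> borel_measurable M"
    and "\<And>n. integrable M (\<lambda>\<omega>. (Z n \<omega>)\<^sup>2)"
    and "\<And>n. expectation (\<lambda>\<omega>. (Z n \<omega>)\<^sup>2) = 1"
    and "weak_conv_m (\<lambda>n. distr M borel (Z n)) std_normal_distribution"
proof -
  define s where "s n = \<sigma> * sqrt (1 / real (m1 n) + 1 / real (m2 n))" for n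
  have s2: "(s n)\<^sup>2 = \<sigma>\<^sup>2 * (1 / real (m1 n) + 1 / real (m2 n))" for n
    by (simp add: s_def power_mult_distrib)
  have s: "s n > 0" for n
    using m1(2)[of n] m2(2)[of n] \<sigma> by (simp add: s_def add_pos_pos)
  \<comment> \<open>The difference of the two means becomes a single weighted sum over the
    concatenated sample, so one independent family carries both blocks.\<close>
  define c where "c n i = (if i \<le> m1 n then 1 / (real (m1 n) * s n) else - (1 / (real (m2 n) * s n)))" for n i
  let ?S = "\<lambda>n. {1..m1 n + m2 n}"
  have split: "?S n = {1..m1 n} \<union> {m1 n + 1..m1 n + m2 n}" "{1..m1 n} \<inter> {m1 n + 1..m1 n + m2 n} = {}" for n
    by auto
  have Z: "Z n = (\<lambda>\<omega>. \<Sum>i\<in>?S n. c n i * u (X i \<omega>))" for n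
  proof
    fix \<omega>
    have "(\<Sum>i\<in>?S n. c n i * u (X i \<omega>)) = (\<Sum>i\<in>{1..m1 n}. c n i * u (X i \<omega>)) + (\<Sum>i\<in>{m1 n + 1..m1 n + m2 n}. c n i * u (X i \<omega>))"
      unfolding split(1) using split(2) by (intro sum.union_disjoint) auto
    also have "(\<Sum>i\<in>{m1 n + 1..m1 n + m2 n}. c n i * u (X i \<omega>)) = (\<Sum>i=1..m2 n. c n (m1 n + i) * u (X (m1 n + i) \<omega>))"
      by (rule sum.reindex_bij_witness[where i = "\<lambda>i. m1 n + i" and j = "\<lambda>i. i - m1 n"]) auto
    also have "(\<Sum>i\<in>{1..m1 n}. c n i * u (X i \<omega>)) + (\<Sum>i=1..m2 n. c n (m1 n + i) * u (X (m1 n + i) \<omega>))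
        = (\<Sum>i\<in>{1..m1 n}. 1 / (real (m1 n) * s n) * u (X i \<omega>)) + (\<Sum>i=1..m2 n. - (1 / (real (m2 n) * s n)) * u (X (m1 n + i) \<omega>))"
      by (intro arg_cong2[where f = "(+)"] sum.cong) (auto simp: c_def)
    finally show "Z n \<omega> = (\<Sum>i\<in>?S n. c n i * u (X i \<omega>))"
      unfolding Z_def s_def[symmetric] sum_distrib_left[symmetric] by (simp add: diff_divide_distrib)
  qed
  have c2: "(\<Sum>i\<in>?S n. (c n i)\<^sup>2) * \<sigma>\<^sup>2 = 1" for n
  proof -
    have "(\<Sum>i\<in>?S n. (c n i)\<^sup>2) = (\<Sum>i\<in>{1..m1 n}. (c n i)\<^sup>2) + (\<Sum>i\<in>{m1 n + 1..m1 n + m2 n}. (c n i)\<^sup>2)"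
      unfolding split(1) using split(2) by (intro sum.union_disjoint) auto
    also have "\<dots> = real (m1 n) * (1 / (real (m1 n) * s n))\<^sup>2 + real (m2 n) * (1 / (real (m2 n) * s n))\<^sup>2"
      by (simp add: c_def)
    also have "\<dots> = (1 / real (m1 n) + 1 / real (m2 n)) / (s n)\<^sup>2"
      using m1(2)[of n] m2(2)[of n] by (simp add: power_mult_distrib power_divide add_divide_distrib power2_eq_square mult_ac)
    also have "\<dots> = 1 / \<sigma>\<^sup>2"
      unfolding s2 using \<sigma> m1(2)[of n] m2(2)[of n] add_pos_pos[of "1 / real (m1 n)" "1 / real (m2 n)"] by simp
    finally show ?thesis using \<sigma> by simp
  qed
  show Zm: "Z n \<in> borel_measurable M" for n
    unfolding Z by (intro borel_measurable_sum borel_measurable_times borel_measurable_const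
      measurable_compose[OF measurable_X u]) auto
  note sums = expectation_sum_centered_square[OF u sq mean, of "?S n" "c n" for n]
  show "integrable M (\<lambda>\<omega>. (Z n \<omega>)\<^sup>2)" for n
    unfolding Z by (rule sums) auto
  show "expectation (\<lambda>\<omega>. (Z n \<omega>)\<^sup>2) = 1" for n
    unfolding Z using sums(2)[of n] c2[of n] by (simp add: var)
  define \<mu> where "\<mu> = distr F borel u"
  have uF: "u \<in> F \<rightarrow>\<^sub>M borel" by measurable
  interpret \<mu>: real_distribution \<mu> unfolding \<mu>_def by (rule F.real_distribution_distr[OF uF])
  have \<mu>: "integrable \<mu> (\<lambda>x. x\<^sup>2)" "\<mu>.expectation (\<lambda>x. x) = 0" "\<mu>.expectation (\<lambda>x. x\<^sup>2) = \<sigma>\<^sup>2"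
    unfolding \<mu>_def using sq mean var uF by (simp_all add: integrable_distr_eq integral_distr)
  show "weak_conv_m (\<lambda>n. distr M borel (Z n)) std_normal_distribution"
  proof (rule levy_continuity)
    show "real_distribution (distr M borel (Z n))" for n
      using Zm by (rule real_distribution_distr)
    show "real_distribution std_normal_distribution" by (rule real_dist_normal_dist)
    fix t :: real
    define a b where "a n = t * (1 / (real (m1 n) * s n))" and "b n = t * (- (1 / (real (m2 n) * s n)))" for n
    have char: "char (distr M borel (Z n)) t = char \<mu> (a n) ^ m1 n * char \<mu> (b n) ^ m2 n" for n
    proof -
      have "char (distr M borel (Z n)) t = (\<Prod>i\<in>?S n. char \<mu> (t * c n i))"
        unfolding Z \<mu>_def by (rule char_weighted_sum[OF u]) auto
      also have "\<dots> = (\<Prod>i\<in>{1..m1 n}. char \<mu> (t * c n i)) * (\<Prod>i\<in>{m1 n + 1..m1 n + m2 n}. char \<mu> (t * c n i))"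
        unfolding split(1) using split(2) by (intro prod.union_disjoint) auto
      also have "\<dots> = (\<Prod>i\<in>{1..m1 n}. char \<mu> (a n)) * (\<Prod>i\<in>{m1 n + 1..m1 n + m2 n}. char \<mu> (b n))"
        by (intro arg_cong2[where f = "(*)"] prod.cong) (auto simp: c_def a_def b_def)
      finally show ?thesis by simp
    qed
    have eq: "real (m1 n) * (a n)\<^sup>2 + real (m2 n) * (b n)\<^sup>2 = t\<^sup>2 / \<sigma>\<^sup>2" for n
    proof -
      have "real (m1 n) * (a n)\<^sup>2 + real (m2 n) * (b n)\<^sup>2 = t\<^sup>2 * ((1 / real (m1 n) + 1 / real (m2 n)) / (s n)\<^sup>2)"
        using m1(2)[of n] m2(2)[of n] by (simp add: a_def b_def power_mult_distrib power_divide add_divide_distrib power2_eq_square algebra_simps)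
      also have "(1 / real (m1 n) + 1 / real (m2 n)) / (s n)\<^sup>2 = 1 / \<sigma>\<^sup>2"
        unfolding s2 using \<sigma> m1(2)[of n] m2(2)[of n] add_pos_pos[of "1 / real (m1 n)" "1 / real (m2 n)"] by simp
      finally show ?thesis by simp
    qed
    have bd: "real (m1 n) * (a n)\<^sup>2 \<le> t\<^sup>2 / \<sigma>\<^sup>2" "real (m2 n) * (b n)\<^sup>2 \<le> t\<^sup>2 / \<sigma>\<^sup>2" for n
    proof -
      have "0 \<le> real (m1 n) * (a n)\<^sup>2" "0 \<le> real (m2 n) * (b n)\<^sup>2" by simp_all
      with eq[of n] show "real (m1 n) * (a n)\<^sup>2 \<le> t\<^sup>2 / \<sigma>\<^sup>2" "real (m2 n) * (b n)\<^sup>2 \<le> t\<^sup>2 / \<sigma>\<^sup>2" by linarith+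
    qed
    have null: "f \<longlonglongrightarrow> 0" if "\<And>n. real (k n) * (f n)\<^sup>2 \<le> C" "filterlim k at_top sequentially" "\<And>n. k n \<ge> 1"
      for f :: "nat \<Rightarrow> real" and k C
    proof -
      have "(\<lambda>n. C / real (k n)) \<longlonglongrightarrow> 0"
        by (rule real_tendsto_divide_at_top[OF tendsto_const filterlim_compose[OF filterlim_real_sequentially that(2)]])
      moreover have "(f n)\<^sup>2 \<le> C / real (k n)" for n
        using that(1)[of n] that(3)[of n] by (simp add: field_simps)
      ultimately have "(\<lambda>n. (f n)\<^sup>2) \<longlonglongrightarrow> 0"
        by (intro Lim_null_comparison[where f = "\<lambda>n. (f n)\<^sup>2" and g = "\<lambda>n. C / real (k n)"]) simp_all
      then have "(\<lambda>n. sqrt ((f n)\<^sup>2)) \<longlonglongrightarrow> sqrt 0"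
        by (rule tendsto_real_sqrt)
      then show ?thesis by (simp add: tendsto_rabs_zero_iff)
    qed
    define p q where "p n = complex_of_real (exp (- (\<sigma>\<^sup>2 * real (m1 n) * (a n)\<^sup>2 / 2)))"
      and "q n = complex_of_real (exp (- (\<sigma>\<^sup>2 * real (m2 n) * (b n)\<^sup>2 / 2)))" for n
    have A: "(\<lambda>n. char \<mu> (a n) ^ m1 n - p n) \<longlonglongrightarrow> 0" unfolding p_def
      by (rule \<mu>.char_power_approx[OF \<mu> bd(1) null[OF bd(1) m1]])
    have B: "(\<lambda>n. char \<mu> (b n) ^ m2 n - q n) \<longlonglongrightarrow> 0" unfolding q_def
      by (rule \<mu>.char_power_approx[OF \<mu> bd(2) null[OF bd(2) m2]])
    have pq: "p n * q n = exp (- (t\<^sup>2 / 2))" for n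
    proof -
      have "p n * q n = complex_of_real (exp (- (\<sigma>\<^sup>2 * (real (m1 n) * (a n)\<^sup>2 + real (m2 n) * (b n)\<^sup>2) / 2)))"
        unfolding p_def q_def by (simp add: algebra_simps add_divide_distrib flip: of_real_mult exp_add)
      then show ?thesis unfolding eq using \<sigma> by simp
    qed
    \<comment> \<open>The two factors are exchanged one at a time; every factor that stays has norm
      at most 1.\<close>
    have "norm (char \<mu> (a n) ^ m1 n * char \<mu> (b n) ^ m2 n - exp (- (t\<^sup>2 / 2)))
        \<le> norm (char \<mu> (a n) ^ m1 n - p n) + norm (char \<mu> (b n) ^ m2 n - q n)" for n
    proof -
      have "norm (char \<mu> (b n) ^ m2 n) \<le> 1" "norm (p n) \<le> 1"
        by (auto simp: norm_power power_le_one \<mu>.cmod_char_le_1 p_def)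
      then have "norm ((char \<mu> (a n) ^ m1 n - p n) * char \<mu> (b n) ^ m2 n) \<le> norm (char \<mu> (a n) ^ m1 n - p n)"
        "norm (p n * (char \<mu> (b n) ^ m2 n - q n)) \<le> norm (char \<mu> (b n) ^ m2 n - q n)"
        by (simp_all add: norm_mult mult_left_le mult_left_le_one_le)
      moreover have "char \<mu> (a n) ^ m1 n * char \<mu> (b n) ^ m2 n - exp (- (t\<^sup>2 / 2))
          = (char \<mu> (a n) ^ m1 n - p n) * char \<mu> (b n) ^ m2 n + p n * (char \<mu> (b n) ^ m2 n - q n)"
        unfolding pq[of n, symmetric] by (simp add: algebra_simps)
      ultimately show ?thesis
        using norm_triangle_ineq[of "(char \<mu> (a n) ^ m1 n - p n) * char \<mu> (b n) ^ m2 n"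
            "p n * (char \<mu> (b n) ^ m2 n - q n)"] by simp
    qed
    then have "(\<lambda>n. char \<mu> (a n) ^ m1 n * char \<mu> (b n) ^ m2 n - exp (- (t\<^sup>2 / 2))) \<longlonglongrightarrow> 0"
      by (intro Lim_null_comparison[OF _ tendsto_add_zero[OF tendsto_norm_zero[OF A] tendsto_norm_zero[OF B]]]) auto
    then show "(\<lambda>n. char (distr M borel (Z n)) t) \<longlonglongrightarrow> char std_normal_distribution t"
      unfolding char char_std_normal_distribution by (subst (asm) LIM_zero_iff) simp
  qed
qed

end

section \<open>The chi-square limit\<close>

lemma square_root_interval: "{z :: real. z\<^sup>2 \<le> y} = (if y < 0 then {} else {- sqrt y..sqrt y})"
proof -
  have "z\<^sup>2 \<le> y \<longleftrightarrow> - sqrt y \<le> z \<and> z \<le> sqrt y" if "0 \<le> y" for z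
    using that real_sqrt_le_iff[of "z\<^sup>2" y] by (auto simp: abs_le_iff)
  moreover have "\<not> z\<^sup>2 \<le> y" if "y < 0" for z
    using that zero_le_power2[of z] by linarith
  ultimately show ?thesis by (auto simp: not_less)
qed

lemma cdf_chi_square_1: "cdf (chi_square 1) y = measure std_normal_distribution {z. z\<^sup>2 \<le> y}"
proof -
  let ?N = "density lborel (\<lambda>x. ennreal (std_normal_density x))"
  let ?P = "\<Pi>\<^sub>M i\<in>{..<1::nat}. ?N"
  have "prob_space ?N" by (rule prob_space_normal_density) simp
  then have comp: "distr ?P ?N (\<lambda>z. z 0) = ?N"
    by (intro distr_PiM_component) auto
  have m0: "(\<lambda>z. z 0) \<in> ?P \<rightarrow>\<^sub>M ?N"
    by (rule measurable_component_singleton) simp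
  have m: "(\<lambda>z. \<Sum>i<1::nat. (z i)\<^sup>2) \<in> ?P \<rightarrow>\<^sub>M borel"
    using m0 by (simp add: measurable_cong_sets[of ?N borel]) 
  have "cdf (chi_square 1) y = measure ?P {z \<in> space ?P. (z 0)\<^sup>2 \<le> y}"
    unfolding cdf_def chi_square_def
    by (subst measure_distr[OF m]) (auto simp: vimage_def Int_def conj_commute)
  also have "\<dots> = measure (distr ?P ?N (\<lambda>z. z 0)) {z. z\<^sup>2 \<le> y}"
    by (subst measure_distr[OF m0]) (auto simp: vimage_def Int_def conj_commute)
  finally show ?thesis unfolding comp .
qed

text \<open>The set of z with \<open>z\<^sup>2 \<le> y\<close> has a finite frontier, which is null
  for the normal law. The portmanteau theorem thus gives convergence at every real
  \<open>y\<close>.\<close>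

lemma (in prob_space) weak_conv_square_cdf:
  assumes [measurable]: "\<And>n. Z n \<in> borel_measurable M"
    and Z: "weak_conv_m (\<lambda>n. distr M borel (Z n)) std_normal_distribution"
  shows "(\<lambda>n. prob {\<omega>\<in>space M. (Z n \<omega>)\<^sup>2 \<le> y}) \<longlonglongrightarrow> cdf (chi_square 1) y"
proof -
  let ?A = "{z :: real. z\<^sup>2 \<le> y}"
  have "finite (frontier ?A)"
    unfolding square_root_interval by (auto simp: frontier_def)
  then have "frontier ?A \<in> null_sets lborel"
    by (rule finite_imp_null_set_lborel)
  then have "frontier ?A \<in> null_sets std_normal_distribution"
    using absolutely_continuousI_density[of "\<lambda>x. ennreal (std_normal_density x)" lborel]
    unfolding absolutely_continuous_def by auto
  then have "emeasure std_normal_distribution (frontier ?A) = 0" by auto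
  then have lim: "(\<lambda>n. measure (distr M borel (Z n)) ?A) \<longlonglongrightarrow> measure std_normal_distribution ?A"
    by (intro weak_conv_imp_continuity_set_conv[OF _ real_dist_normal_dist Z])
      (auto intro!: real_distribution_distr)
  have "measure (distr M borel (Z n)) ?A = prob {\<omega>\<in>space M. (Z n \<omega>)\<^sup>2 \<le> y}" for n
    by (subst measure_distr) (auto intro!: arg_cong[where f = prob])
  with lim show ?thesis unfolding cdf_chi_square_1 by simp
qed

lemma (in iid_kernel) kernel_shift: "iid_kernel M (\<lambda>i. X (k + i)) F h g \<theta>"
  by (intro iid_kernel.intro shift iid_kernel_axioms[unfolded iid_kernel_def, THEN conjunct2])

section \<open>Moments and projections of the kernels \<open>h1\<close> and
  \<open>h2\<close>\<close>

context
  fixes M :: "'w measure" and X :: "nat \<Rightarrow> 'w \<Rightarrow> 'a::euclidean_space" and F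
  assumes sample: "iid_sample M X F"
    and theta0_finite: "integrable M (\<lambda>\<omega>. norm (X 1 \<omega> - X 2 \<omega>))"
    and g2_sq: "integrable M (\<lambda>\<omega>. (g2 M X (X 1 \<omega>))\<^sup>2)"
begin

interpretation iid_sample M X F by (rule sample)

text \<open>By Fubini the section of the kernel at almost every \<open>x\<close> is integrable. One
  such \<open>x\<close> exists because \<open>F\<close> is a probability measure, and the triangle
  inequality then bounds the norm itself.\<close>

lemma integrable_norm: "integrable F norm"
proof -
  note [measurable_cong] = sets_F
  have "integrable (F \<Otimes>\<^sub>M F) (\<lambda>(x, y). norm (x - y))"
    using theta0_finite by (subst integrable_pair_iff[where i = 1 and j = 2, symmetric]) auto
  from FF.AE_integrable_fst'[OF this] have "AE x in F. integrable F (\<lambda>y. norm (x - y))" by simp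
  then obtain x where x: "integrable F (\<lambda>y. norm (x - y))"
    using F.ae_filter_bot eventually_happens'[OF F.ae_filter_bot] by blast
  show ?thesis
  proof (rule Bochner_Integration.integrable_bound)
    show "integrable F (\<lambda>y. norm (x - y) + norm x)" using x by simp
    show "AE y in F. norm (norm y) \<le> norm (norm (x - y) + norm x)"
    proof (rule AE_I2)
      fix y
      have "norm y \<le> norm (x - y) + norm x" by norm
      then show "norm (norm y) \<le> norm (norm (x - y) + norm x)" by simp
    qed
  qed measurable
qed

lemma integrable_norm_shift: "integrable F (\<lambda>y. norm (x - y))" "integrable F (\<lambda>y. norm (x + y))"
proof -
  note [measurable_cong] = sets_F
  have bd: "integrable F (\<lambda>y. norm x + norm y)" using integrable_norm by simp
  show "integrable F (\<lambda>y. norm (x - y))"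
    by (rule Bochner_Integration.integrable_bound[OF bd]) (auto intro!: norm_triangle_ineq4)
  show "integrable F (\<lambda>y. norm (x + y))"
    by (rule Bochner_Integration.integrable_bound[OF bd]) (auto intro!: norm_triangle_ineq)
qed

lemma g2_eq: "g2 M X x = (\<integral>y. norm (x - y) \<partial>F) - theta0 M X"
  unfolding g2_def by (subst expectation_X[of "\<lambda>y. norm (x - y)"]) auto

lemma g1_eq: "g1 M X x = (\<integral>y. norm (x + y) \<partial>F) - theta0 M X"
  unfolding g1_def by (subst expectation_X[of "\<lambda>y. norm (x + y)"]) auto

lemma g2_measurable: "g2 M X \<in> borel_measurable borel"
proof -
  note [measurable_cong] = sets_F
  show ?thesis unfolding g2_eq[abs_def] by measurable
qed

lemma g2_square_integrable: "integrable F (\<lambda>x. (g2 M X x)\<^sup>2)"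
proof -
  note [measurable] = g2_measurable
  show ?thesis using g2_sq by (subst integrable_X_iff[of _ 1, symmetric]) auto
qed

text \<open>Averaging the triangle inequality over y bounds the norm of \<open>x\<close> by
  \<open>g2 M X x\<close> plus a constant, so a second moment of the projection already forces one
  of the observations. Square integrability of both kernels follows.\<close>

lemma integrable_norm_square: "integrable F (\<lambda>x. (norm x)\<^sup>2)"
proof (rule Bochner_Integration.integrable_bound)
  note [measurable_cong] = sets_F
  note [measurable] = g2_measurable
  define c where "c = theta0 M X + (\<integral>y. norm y \<partial>F)"
  show "integrable F (\<lambda>x. (g2 M X x + c)\<^sup>2)"
    by (rule square_integrable_add) (auto intro: g2_square_integrable)
  have "norm x \<le> g2 M X x + c" for x
  proof -
    have "norm x = (\<integral>y. norm x \<partial>F)" using F.prob_space by simp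
    also have "\<dots> \<le> (\<integral>y. norm (x - y) + norm y \<partial>F)"
    proof (rule integral_mono)
      show "norm x \<le> norm (x - y) + norm y" for y by norm
    qed (use integrable_norm integrable_norm_shift in auto)
    also have "\<dots> = g2 M X x + c"
      using integrable_norm integrable_norm_shift by (simp add: g2_eq c_def)
    finally show ?thesis .
  qed
  then show "AE x in F. norm ((norm x)\<^sup>2) \<le> norm ((g2 M X x + c)\<^sup>2)"
    by (auto intro!: power_mono)
  show "(\<lambda>x. (norm x)\<^sup>2) \<in> borel_measurable F" by measurable
qed

lemma kernel_square_integrable:
  fixes h :: "'a \<Rightarrow> 'a \<Rightarrow> real"
  assumes [measurable]: "(\<lambda>(x, y). h x y) \<in> borel_measurable (borel \<Otimes>\<^sub>M borel)"
    and h: "\<And>x y. \<bar>h x y\<bar> \<le> norm x + norm y"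
  shows "integrable (F \<Otimes>\<^sub>M F) (\<lambda>(x, y). (h x y)\<^sup>2)"
proof -
  note [measurable] = measurable_X[of 1] measurable_X[of 2]
  have "integrable M (\<lambda>\<omega>. (h (X 1 \<omega>) (X 2 \<omega>))\<^sup>2)"
  proof (rule Bochner_Integration.integrable_bound)
    show "integrable M (\<lambda>\<omega>. (norm (X 1 \<omega>) + norm (X 2 \<omega>))\<^sup>2)"
      using integrable_norm_square integrable_X_iff[of "\<lambda>x. (norm x)\<^sup>2"]
      by (intro square_integrable_add) auto
    show "AE \<omega> in M. norm ((h (X 1 \<omega>) (X 2 \<omega>))\<^sup>2) \<le> norm ((norm (X 1 \<omega>) + norm (X 2 \<omega>))\<^sup>2)"
    proof (rule AE_I2)
      fix \<omega>
      have "\<bar>h (X 1 \<omega>) (X 2 \<omega>)\<bar>\<^sup>2 \<le> (norm (X 1 \<omega>) + norm (X 2 \<omega>))\<^sup>2"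
        by (intro power_mono h) auto
      then show "norm ((h (X 1 \<omega>) (X 2 \<omega>))\<^sup>2) \<le> norm ((norm (X 1 \<omega>) + norm (X 2 \<omega>))\<^sup>2)" by simp
    qed
  qed measurable
  then show ?thesis
    by (subst integrable_pair_iff[where i = 1 and j = 2, symmetric]) auto
qed

lemma g2_mean: "(\<integral>x. g2 M X x \<partial>F) = 0"
proof -
  note [measurable_cong] = sets_F
  have "integrable (F \<Otimes>\<^sub>M F) (\<lambda>(x, y). norm (x - y))"
    using theta0_finite by (subst integrable_pair_iff[where i = 1 and j = 2, symmetric]) auto
  from FF.integral_fst'[OF this] FF.integrable_fst'[OF this]
  have "(\<integral>x. \<integral>y. norm (x - y) \<partial>F \<partial>F) = (\<integral>(x, y). norm (x - y) \<partial>(F \<Otimes>\<^sub>M F))"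
    and int: "integrable F (\<lambda>x. \<integral>y. norm (x - y) \<partial>F)" by simp_all
  moreover have "theta0 M X = (\<integral>(x, y). norm (x - y) \<partial>(F \<Otimes>\<^sub>M F))"
    unfolding theta0_def by (rule expectation_pair) auto
  ultimately show ?thesis using F.prob_space by (simp add: g2_eq)
qed

lemma h2_kernel: "iid_kernel M X F h2 (g2 M X) (theta0 M X)"
proof (unfold_locales, goal_cases)
  case 1 show ?case by (simp add: h2_def)
next
  case 2 show ?case by (simp add: h2_def norm_minus_commute)
next
  case 3 show ?case by (simp add: h2_def[abs_def] integrable_norm_shift)
next
  case 4 show ?case by (rule kernel_square_integrable) (auto simp: h2_def norm_triangle_ineq4)
qed (rule g2_measurable g2_square_integrable g2_mean | simp add: g2_eq h2_def)+

context
  assumes H0: "distr M borel (X 1) = distr M borel (\<lambda>\<omega>. - X 1 \<omega>)"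
begin

text \<open>This is where the null hypothesis enters: under a symmetric law the integration variable
  may change its sign.\<close>

lemma g1_eq_g2: "g1 M X = g2 M X"
proof
  fix x
  note [measurable] = measurable_X[of 1]
  have "(\<integral>y. norm (x + y) \<partial>F) = (\<integral>y. norm (x + y) \<partial>distr M borel (\<lambda>\<omega>. - X 1 \<omega>))"
    using ident[of 1] H0 by simp
  also have "\<dots> = expectation (\<lambda>\<omega>. norm (x - X 1 \<omega>))"
    by (subst integral_distr) auto
  also have "\<dots> = (\<integral>y. norm (x - y) \<partial>F)"
    by (rule expectation_X) auto
  finally show "g1 M X x = g2 M X x" by (simp add: g1_eq g2_eq)
qed

text \<open>Stated with \<open>g2\<close>, so that both kernels carry literally the same projection
  and its contributions from the two samples can be compared directly.\<close>

lemma h1_kernel: "iid_kernel M X F h1 (g2 M X) (theta0 M X)"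
proof (unfold_locales, goal_cases)
  case 1 show ?case by (simp add: h1_def)
next
  case 2 show ?case by (simp add: h1_def add.commute)
next
  case 3 show ?case by (simp add: h1_def[abs_def] integrable_norm_shift)
next
  case 4 show ?case by (rule kernel_square_integrable) (auto simp: h1_def norm_triangle_ineq)
next
  case (8 x) show ?case
    using g1_eq[of x] by (simp add: h1_def g1_eq_g2)
qed (simp_all add: g2_measurable g2_square_integrable g2_mean)

end

end

section \<open>The studentized difference of the U-statistics and its chi-square limit\<close>

theorem theorem2p1:
  fixes M :: "'w measure"
    and F :: "(real ^ 'd) measure"
    and X :: "nat \<Rightarrow> 'w \<Rightarrow> real ^ 'd"
    and n1 n2 :: "nat \<Rightarrow> nat"
    and \<alpha>1 \<alpha>2 :: real
  assumes prob: "prob_space M"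
    and F: "prob_space F" "sets F = sets borel"
    and indep: "prob_space.indep_vars M (\<lambda>_. borel) X {1..}"
    and ident: "\<And>i. i \<ge> 1 \<Longrightarrow> distr M borel (X i) = F"
    and split: "\<And>n. n \<ge> 2 \<Longrightarrow> n1 n > 0 \<and> n2 n > 0 \<and> n1 n + n2 n = n"
    and theta0_finite: "integrable M (\<lambda>\<omega>. norm (X 1 \<omega> - X 2 \<omega>))"
    and C1_finite: "integrable M (\<lambda>\<omega>. (g1 M X (X 1 \<omega>))\<^sup>2)"
                   "integrable M (\<lambda>\<omega>. (g2 M X (X 1 \<omega>))\<^sup>2)"
    and C1_pos: "prob_space.variance M (\<lambda>\<omega>. g1 M X (X 1 \<omega>)) > 0"
                "prob_space.variance M (\<lambda>\<omega>. g2 M X (X 1 \<omega>)) > 0"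
    and C2: "(\<lambda>n. real (n1 n) / real n) \<longlonglongrightarrow> \<alpha>1" "\<alpha>1 > 0"
            "(\<lambda>n. real (n2 n) / real n) \<longlonglongrightarrow> \<alpha>2" "\<alpha>2 > 0"
            "\<alpha>1 + \<alpha>2 = 1"
    and H0: "distr M borel (X 1) = distr M borel (\<lambda>\<omega>. - X 1 \<omega>)"
  shows "converges_in_distr M (\<lambda>n \<omega>. jel_ratio (n1 n) (n2 n) (\<lambda>i. X i \<omega>)) (chi_square 1)"
proof -
  have sample: "iid_sample M X F"
    using prob indep ident by (simp add: iid_sample_def iid_sample_axioms_def)
  interpret iid_sample M X F by (rule sample)
  define g where "g = g2 M X"
  define \<theta> where "\<theta> = theta0 M X"
  have k1: "iid_kernel M X F h1 g \<theta>" unfolding g_def \<theta>_def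
    by (rule h1_kernel[OF sample theta0_finite C1_finite(2) H0])
  have k2: "iid_kernel M X F h2 g \<theta>" unfolding g_def \<theta>_def
    by (rule h2_kernel[OF sample theta0_finite C1_finite(2)])
  have size_at_top: "filterlim k at_top sequentially"
    if "(\<lambda>n. real (k n) / real n) \<longlonglongrightarrow> a" "a > 0" for k :: "nat \<Rightarrow> nat" and a :: real
  proof -
    have "filterlim (\<lambda>n. real (k n) / real n * real n) at_top sequentially"
      by (rule filterlim_tendsto_pos_mult_at_top[OF that filterlim_real_sequentially])
    then have "filterlim (\<lambda>n. real (k n)) at_top sequentially"
    proof (rule filterlim_cong[OF refl refl, THEN iffD1, rotated])
      show "\<forall>\<^sub>F n in sequentially. real (k n) / real n * real n = real (k n)"
        using eventually_gt_at_top[of 0] by eventually_elim simp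
    qed
    then show ?thesis by (simp add: filterlim_sequentially_iff_filterlim_real)
  qed
  note top1 = size_at_top[OF C2(1,2)] and top2 = size_at_top[OF C2(3,4)]
  interpret K1: kernel_array M "\<lambda>n. X" F n1 h1 g \<theta>
    by (intro kernel_array.intro kernel_array_axioms.intro k1 top1 prob)
  interpret K2: kernel_array M "\<lambda>n i. X (n1 n + i)" F n2 h2 g \<theta>
    by (intro kernel_array.intro kernel_array_axioms.intro iid_kernel.kernel_shift[OF k2] top2 prob)
  note g_meas [measurable] = K1.krow.g_meas
  define \<sigma> where "\<sigma> = sqrt (\<integral>x. (g x)\<^sup>2 \<partial>F)"
  have "(\<integral>x. (g x)\<^sup>2 \<partial>F) = expectation (\<lambda>\<omega>. (g (X 1 \<omega>))\<^sup>2)"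
    by (rule expectation_X[symmetric]) auto
  also have "\<dots> = variance (\<lambda>\<omega>. g (X 1 \<omega>))"
    using expectation_X[of g 1] K1.krow.g_mean by simp
  finally have var_pos: "(\<integral>x. (g x)\<^sup>2 \<partial>F) > 0"
    using C1_pos(2) by (simp add: g_def)
  then have \<sigma>: "\<sigma> > 0" "(\<integral>x. (g x)\<^sup>2 \<partial>F) = \<sigma>\<^sup>2" by (simp_all add: \<sigma>_def)

  \<comment> \<open>The central limit theorem asks for nonempty blocks at every n, while the split
    is known only from n = 2 on. The maximum with 1 repairs the early terms and is invisible
    afterwards.\<close>
  define Z where "Z n \<omega> = ((\<Sum>i=1..max 1 (n1 n). g (X i \<omega>)) / real (max 1 (n1 n))
      - (\<Sum>i=1..max 1 (n2 n). g (X (max 1 (n1 n) + i) \<omega>)) / real (max 1 (n2 n)))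
      / (\<sigma> * sqrt (1 / real (max 1 (n1 n)) + 1 / real (max 1 (n2 n))))" for n \<omega>
  have top_max: "filterlim (\<lambda>n. max 1 (k n)) at_top sequentially" if "filterlim k at_top sequentially" for k :: "nat \<Rightarrow> nat"
    using that by (rule filterlim_at_top_mono) simp
  note clt = two_sample_clt[OF g_meas K1.krow.g_sq K1.krow.g_mean \<sigma>(2,1)
      top_max[OF top1] _ top_max[OF top2] _, folded Z_def, simplified]
  have Zm: "Z n \<in> borel_measurable M" for n using clt(1)[of n] by (simp add: Z_def[abs_def])
  have Z2: "integrable M (\<lambda>\<omega>. (Z n \<omega>)\<^sup>2)" "expectation (\<lambda>\<omega>. (Z n \<omega>)\<^sup>2) \<le> 1" for n
    using clt(2)[of n] clt(3)[of n] by (simp_all add: Z_def)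
  have Zlim: "weak_conv_m (\<lambda>n. distr M borel (Z n)) std_normal_distribution"
    using clt(4) by (simp add: Z_def[abs_def])
  note Z_mult = tendsto_in_prob_L2_bounded_mult[OF _ Zm Z2]
  let ?P = "in_prob M"
  define z where "z = (\<lambda>x. Z (fst x) (snd x))"

  \<comment> \<open>With n the sum of the two sizes, \<open>w\<close> equals n / (n1 n2). So
    \<open>1 / n1\<close> is the share of the second sample times \<open>w\<close>, which is why
    \<open>p\<close> and \<open>q\<close> look interchanged.\<close>
  define w p q where "w x = 1 / real (n1 (fst x)) + 1 / real (n2 (fst x))"
    and "p x = real (n2 (fst x)) / real (fst x)" and "q x = real (n1 (fst x)) / real (fst x)" for x :: "nat \<times> 'w"
  have p: "(p \<longlongrightarrow> \<alpha>2) ?P" and q: "(q \<longlongrightarrow> \<alpha>1) ?P"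
    unfolding p_def[abs_def] q_def[abs_def] by (intro tendsto_in_prob_deterministic C2)+
  have big: "\<forall>\<^sub>F x in ?P. n1 (fst x) \<ge> 3 \<and> n2 (fst x) \<ge> 3 \<and> n1 (fst x) + n2 (fst x) = fst x"
  proof -
    have "\<forall>\<^sub>F x in ?P. 2 \<le> fst x"
      using filterlim_fst_in_prob eventually_ge_at_top[of 2] unfolding filterlim_iff by blast
    with K1.eventually_m_ge_in_prob[of 3] K2.eventually_m_ge_in_prob[of 3] show ?thesis
      by eventually_elim (use split in auto)
  qed
  have alg: "w x > 0" "1 / real (n1 (fst x)) = p x * w x" "1 / real (n2 (fst x)) = q x * w x"
      "0 \<le> p x" "0 \<le> q x"
    if "n1 (fst x) \<ge> 3 \<and> n2 (fst x) \<ge> 3 \<and> n1 (fst x) + n2 (fst x) = fst x" for x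
  proof -
    define a b where "a = real (n1 (fst x))" and "b = real (n2 (fst x))"
    have ab: "a > 0" "b > 0" "real (fst x) = a + b" using that by (auto simp: a_def b_def)
    have w: "w x = (a + b) / (a * b)"
      using ab unfolding w_def a_def[symmetric] b_def[symmetric] by (simp add: field_simps)
    have pq: "p x = b / (a + b)" "q x = a / (a + b)"
      unfolding p_def q_def ab(3) a_def b_def by simp_all
    show "w x > 0" "0 \<le> p x" "0 \<le> q x" unfolding w pq using ab by simp_all
    show "1 / real (n1 (fst x)) = p x * w x" "1 / real (n2 (fst x)) = q x * w x"
      unfolding w pq a_def[symmetric] b_def[symmetric] using ab by simp_all
  qed

  define S1 S2 where "S1 x = (\<Sum>i=1..n1 (fst x). (K1.V x i - K1.U x)\<^sup>2) / real (n1 (fst x))"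
    and "S2 x = (\<Sum>i=1..n2 (fst x). (K2.V x i - K2.U x)\<^sup>2) / real (n2 (fst x))" for x
  have S: "(S1 \<longlongrightarrow> 4 * \<sigma>\<^sup>2) ?P" "(S2 \<longlongrightarrow> 4 * \<sigma>\<^sup>2) ?P"
    using K1.V_variance_tendsto K2.V_variance_tendsto unfolding S1_def[abs_def] S2_def[abs_def] \<sigma>(2) by simp_all
  \<comment> \<open>The estimated variance \<open>s\<close> divided by its target
    \<open>4 * \<sigma>\<^sup>2 * w\<close>. The interchanged shares still sum to 1 in the limit, so
    the limit is 1 for any proportions.\<close>
  define \<rho> where "\<rho> x = (p x * S1 x + q x * S2 x) / (4 * \<sigma>\<^sup>2)" for x
  have "(\<rho> \<longlongrightarrow> (\<alpha>2 * (4 * \<sigma>\<^sup>2) + \<alpha>1 * (4 * \<sigma>\<^sup>2)) / (4 * \<sigma>\<^sup>2)) ?P"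
    unfolding \<rho>_def[abs_def] using \<sigma>(1) by (intro tendsto_intros p q S) simp
  also have "\<alpha>2 * (4 * \<sigma>\<^sup>2) + \<alpha>1 * (4 * \<sigma>\<^sup>2) = (\<alpha>1 + \<alpha>2) * (4 * \<sigma>\<^sup>2)"
    by (simp add: algebra_simps)
  also have "(\<alpha>1 + \<alpha>2) * (4 * \<sigma>\<^sup>2) / (4 * \<sigma>\<^sup>2) = 1"
    using \<sigma>(1) C2(5) by simp
  finally have \<rho>: "(\<rho> \<longlongrightarrow> 1) ?P" .
  then have \<rho>_inv: "((\<lambda>x. 1 / \<rho> x) \<longlongrightarrow> 1 / 1) ?P" by (intro tendsto_intros) simp_all

  \<comment> \<open>This is the difference of the linearization errors divided by
    \<open>2 * \<sigma> * sqrt (w x)\<close>. Written with \<open>sqrt n1 * sqrt p\<close> in place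
    of \<open>1 / sqrt w\<close>, it exposes factors with known limits.\<close>
  define e where "e x = (sqrt (real (n1 (fst x))) * (K1.U x - \<theta> - 2 * K1.gbar x) * sqrt (p x)
      - sqrt (real (n2 (fst x))) * (K2.U x - \<theta> - 2 * K2.gbar x) * sqrt (q x)) / (2 * \<sigma>)" for x
  have "(e \<longlongrightarrow> (0 * sqrt \<alpha>2 - 0 * sqrt \<alpha>1) / (2 * \<sigma>)) ?P"
    unfolding e_def[abs_def] using \<sigma>(1)
    by (intro tendsto_divide tendsto_diff tendsto_mult tendsto_real_sqrt tendsto_const p q
        K1.U_linearization K2.U_linearization) simp
  then have e: "(e \<longlongrightarrow> 0) ?P" by simp
  define y where "y x = z x + e x" for x
  have y_eq: "K1.U x - K2.U x = 2 * \<sigma> * sqrt (w x) * y x"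
    if x: "n1 (fst x) \<ge> 3 \<and> n2 (fst x) \<ge> 3 \<and> n1 (fst x) + n2 (fst x) = fst x" for x
  proof -
    note A = alg[OF x]
    have sw: "sqrt (w x) > 0" using A(1) by simp
    have a: "sqrt (real (n1 (fst x))) * sqrt (p x) * sqrt (w x) = 1"
    proof -
      have "real (n1 (fst x)) * p x * w x = 1" using A(2) x by (simp add: field_simps)
      then show ?thesis by (metis real_sqrt_mult real_sqrt_one)
    qed
    have b: "sqrt (real (n2 (fst x))) * sqrt (q x) * sqrt (w x) = 1"
    proof -
      have "real (n2 (fst x)) * q x * w x = 1" using A(3) x by (simp add: field_simps)
      then show ?thesis by (metis real_sqrt_mult real_sqrt_one)
    qed
    have "2 * \<sigma> * sqrt (w x) * e x = (sqrt (real (n1 (fst x))) * sqrt (p x) * sqrt (w x)) * (K1.U x - \<theta> - 2 * K1.gbar x)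
        - (sqrt (real (n2 (fst x))) * sqrt (q x) * sqrt (w x)) * (K2.U x - \<theta> - 2 * K2.gbar x)"
      using \<sigma>(1) by (simp add: e_def field_simps)
    then have "2 * \<sigma> * sqrt (w x) * e x = (K1.U x - K2.U x) - 2 * (K1.gbar x - K2.gbar x)"
      unfolding a b by simp
    moreover have "z x = (K1.gbar x - K2.gbar x) / (\<sigma> * sqrt (w x))"
      using x by (simp add: z_def Z_def K1.gbar_def K2.gbar_def w_def max_absorb2)
    then have "2 * \<sigma> * sqrt (w x) * z x = 2 * (K1.gbar x - K2.gbar x)"
      using \<sigma>(1) sw by simp
    ultimately show ?thesis by (simp add: y_def distrib_left)
  qed

  \<comment> \<open>With \<open>y\<close> the difference of the U-statistics in units of
    \<open>2 * \<sigma> * sqrt w\<close>, division by \<open>\<rho>\<close> replaces the true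
    variance by the estimated one.\<close>
  define Q where "Q x = (y x)\<^sup>2 * (1 / \<rho> x)" for x
  have Z0: "((\<lambda>x. z x * f x) \<longlongrightarrow> 0) ?P" if "(f \<longlongrightarrow> 0) ?P" for f
    unfolding z_def by (rule Z_mult[OF that])
  \<comment> \<open>Since \<open>z\<close> has no limit in probability, the difference is arranged
    so that each \<open>z\<close> multiplies a null quantity; the term quadratic in \<open>z\<close>
    uses this twice.\<close>
  have "((\<lambda>x. z x * (z x * (1 / \<rho> x - 1)) + 2 * (z x * (e x * (1 / \<rho> x))) + (e x)\<^sup>2 * (1 / \<rho> x)) \<longlongrightarrow> 0 + 2 * 0 + 0\<^sup>2 * (1 / 1)) ?P"
  proof (intro tendsto_add Z0 tendsto_mult tendsto_const tendsto_power e \<rho>_inv)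
    show "((\<lambda>x. 1 / \<rho> x - 1) \<longlongrightarrow> 0) ?P" using tendsto_diff[OF \<rho>_inv tendsto_const[of 1]] by simp
    show "((\<lambda>x. e x * (1 / \<rho> x)) \<longlongrightarrow> 0) ?P" using tendsto_mult[OF e \<rho>_inv] by simp
  qed
  moreover have "z x * (z x * (1 / \<rho> x - 1)) + 2 * (z x * (e x * (1 / \<rho> x))) + (e x)\<^sup>2 * (1 / \<rho> x) = Q x - (z x)\<^sup>2" for x
  proof -
    have "a * (a * (r - 1)) + 2 * (a * (b * r)) + b\<^sup>2 * r = (a + b)\<^sup>2 * r - a\<^sup>2" for a b r :: real
      by (simp add: power2_eq_square algebra_simps)
    then show ?thesis unfolding Q_def y_def .
  qed
  ultimately have Qz: "((\<lambda>x. Q x - (z x)\<^sup>2) \<longlongrightarrow> 0) ?P" by simp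

  \<comment> \<open>The multiplier \<open>t\<close> equals
    \<open>y / (2 * \<sigma> * \<rho> * sqrt w)\<close>. Multiplying by
    \<open>sqrt n1 / n1 = sqrt p * sqrt w\<close> cancels \<open>w\<close>, and
    \<open>\<bar>y x\<bar> * \<kappa> x\<close> bounds the tilts of both samples at once.\<close>
  define \<kappa> where "\<kappa> x = (K1.vmax x * sqrt (p x) + K2.vmax x * sqrt (q x)) / (2 * \<sigma>) * (1 / \<rho> x)" for x
  have "(\<kappa> \<longlongrightarrow> (0 * sqrt \<alpha>2 + 0 * sqrt \<alpha>1) / (2 * \<sigma>) * (1 / 1)) ?P"
    unfolding \<kappa>_def[abs_def] using \<sigma>(1)
    by (intro tendsto_mult[OF _ \<rho>_inv] tendsto_divide tendsto_add tendsto_mult tendsto_real_sqrt tendsto_const p q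
        K1.vmax_tendsto K2.vmax_tendsto) simp
  then have \<kappa>: "(\<kappa> \<longlongrightarrow> 0) ?P" by simp
  define \<delta> where "\<delta> x = \<bar>y x\<bar> * \<kappa> x" for x
  have "((\<lambda>x. z x * \<kappa> x + e x * \<kappa> x) \<longlongrightarrow> 0 + 0 * 0) ?P"
    by (intro tendsto_add Z0 tendsto_mult e \<kappa>)
  then have "((\<lambda>x. \<bar>z x * \<kappa> x + e x * \<kappa> x\<bar>) \<longlongrightarrow> 0) ?P"
    by (simp add: tendsto_rabs_zero_iff)
  then have "((\<lambda>x. \<bar>\<delta> x\<bar>) \<longlongrightarrow> 0) ?P"
    by (simp add: \<delta>_def y_def abs_mult flip: distrib_right)
  then have \<delta>: "(\<delta> \<longlongrightarrow> 0) ?P" by (simp add: tendsto_rabs_zero_iff)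
  \<comment> \<open>The relative error is multiplied by \<open>Q\<close>, which does not vanish;
    splitting \<open>Q\<close> into the square of \<open>z\<close> and a null part reduces this
    again to products with \<open>z\<close>.\<close>
  have \<delta>Q: "((\<lambda>x. 2 * \<delta> x * Q x) \<longlongrightarrow> 0) ?P"
  proof -
    have "((\<lambda>x. 2 * (z x * (z x * \<delta> x)) + 2 * \<delta> x * (Q x - (z x)\<^sup>2)) \<longlongrightarrow> 2 * 0 + 2 * 0 * 0) ?P"
      by (intro tendsto_add tendsto_mult tendsto_const Z0 \<delta> Qz)
    then show ?thesis by (simp add: power2_eq_square algebra_simps)
  qed

  define l where "l x = jel_ratio (n1 (fst x)) (n2 (fst x)) (\<lambda>i. X i (snd x))" for x
  \<comment> \<open>The bound on \<open>\<rho>\<close> makes \<open>s\<close> positive, and the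
    bound on \<open>\<delta>\<close> is the range in which the deterministic approximation
    holds.\<close>
  have "\<forall>\<^sub>F x in ?P. 1 / 2 < \<rho> x" by (rule order_tendstoD(1)[OF \<rho>]) simp
  moreover have "\<forall>\<^sub>F x in ?P. \<delta> x < 1 / 2" by (rule order_tendstoD(2)[OF \<delta>]) simp
  ultimately have main: "\<forall>\<^sub>F x in ?P. l x = ereal (real_of_ereal (l x)) \<and> \<bar>real_of_ereal (l x) - Q x\<bar> \<le> 2 * \<delta> x * Q x"
    using big
  proof eventually_elim
    case (elim x)
    note A = alg[OF elim(3)] and Y = y_eq[OF elim(3)]
    define s where "s = S1 x / real (n1 (fst x)) + S2 x / real (n2 (fst x))"
    have s: "s = 4 * \<sigma>\<^sup>2 * w x * \<rho> x"
    proof -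
      have "s = S1 x * (1 / real (n1 (fst x))) + S2 x * (1 / real (n2 (fst x)))" by (simp add: s_def)
      moreover have "4 * \<sigma>\<^sup>2 * \<rho> x = p x * S1 x + q x * S2 x" unfolding \<rho>_def using \<sigma>(1) by simp
      then have "4 * \<sigma>\<^sup>2 * w x * \<rho> x = w x * (p x * S1 x + q x * S2 x)" by (metis mult.assoc mult.commute)
      ultimately show ?thesis unfolding A(2,3) by (simp add: algebra_simps)
    qed
    have s_pos: "s > 0" unfolding s using A(1) \<sigma>(1) elim(1) by simp
    define t where "t = (K1.U x - K2.U x) / s"
    have t: "\<bar>t\<bar> = \<bar>y x\<bar> / (2 * \<sigma> * \<rho> x * sqrt (w x))"
    proof -
      have "s = (2 * \<sigma> * sqrt (w x)) * (2 * \<sigma> * \<rho> x * sqrt (w x))"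
        unfolding s using A(1) by (simp add: power2_eq_square)
      then have "t = y x / (2 * \<sigma> * \<rho> x * sqrt (w x))"
        unfolding t_def Y using \<sigma>(1) A(1) by simp
      then show ?thesis using \<sigma>(1) A(1) elim(1) by (simp add: abs_mult)
    qed
    have Q: "Q x = (K1.U x - K2.U x)\<^sup>2 / s"
      unfolding Y s Q_def using \<sigma>(1) A(1) by (simp add: power_mult_distrib)
    have v0: "0 \<le> K1.vmax x" "0 \<le> K2.vmax x"
      unfolding K1.vmax_def K2.vmax_def by (auto intro!: divide_nonneg_nonneg Max_ge)
    \<comment> \<open>One estimate for both samples, with \<open>k\<close> the sample size,
      \<open>v\<close> the scaled maximal deviation and \<open>r\<close> the share of the other
      sample.\<close>
    have part: "\<bar>t / k * d\<bar> \<le> \<bar>y x\<bar> * (v * sqrt r / (2 * \<sigma>) * (1 / \<rho> x))"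
      if "\<bar>d\<bar> \<le> v * sqrt k" "k > 0" "1 / k = r * w x" for k d v r
    proof -
      have "sqrt k / k = sqrt (1 / k)"
        using that(2) by (simp add: real_sqrt_divide real_div_sqrt field_simps)
      also have "\<dots> = sqrt r * sqrt (w x)" unfolding that(3) by (rule real_sqrt_mult)
      finally have sk: "sqrt k / k = sqrt r * sqrt (w x)" .
      have "\<bar>t / k * d\<bar> = \<bar>t\<bar> / k * \<bar>d\<bar>" using that(2) by (simp add: abs_mult)
      also have "\<dots> \<le> \<bar>t\<bar> / k * (v * sqrt k)" using that by (intro mult_left_mono) auto
      also have "\<dots> = \<bar>t\<bar> * v * (sqrt k / k)" by simp
      also have "\<dots> = \<bar>y x\<bar> * (v * sqrt r / (2 * \<sigma>) * (1 / \<rho> x))"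
        unfolding sk t using A(1) \<sigma>(1) elim(1) by simp
      finally show ?thesis .
    qed
    have \<delta>_eq: "\<delta> x = \<bar>y x\<bar> * (K1.vmax x * sqrt (p x) / (2 * \<sigma>) * (1 / \<rho> x))
        + \<bar>y x\<bar> * (K2.vmax x * sqrt (q x) / (2 * \<sigma>) * (1 / \<rho> x))"
      by (simp add: \<delta>_def \<kappa>_def add_divide_distrib distrib_left distrib_right)
    have nn: "0 \<le> \<bar>y x\<bar> * (K1.vmax x * sqrt (p x) / (2 * \<sigma>) * (1 / \<rho> x))"
      "0 \<le> \<bar>y x\<bar> * (K2.vmax x * sqrt (q x) / (2 * \<sigma>) * (1 / \<rho> x))"
      using v0 A(4,5) \<sigma>(1) elim(1) by simp_all
    have "\<exists>r. log_likelihood_ratio (n1 (fst x)) (n2 (fst x)) (K1.V x) (K2.V x) = ereal r \<and> \<bar>r - Q x\<bar> \<le> 2 * \<delta> x * Q x"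
    proof (rule log_likelihood_ratio_approx[OF _ _ _ _ S1_def S2_def s_def s_pos t_def Q])
      show "K1.U x = (\<Sum>i = 1..n1 (fst x). K1.V x i) / real (n1 (fst x))"
        using elim(3) by (simp only: K1.mean_V)
      show "K2.U x = (\<Sum>i = 1..n2 (fst x). K2.V x i) / real (n2 (fst x))"
        using elim(3) by (simp only: K2.mean_V)
      show "\<bar>t / real (n1 (fst x)) * (K1.V x i - K1.U x)\<bar> \<le> \<delta> x" if "i \<in> {1..n1 (fst x)}" for i
        using part[OF K1.V_deviation_le_vmax[OF that] _ A(2)] elim(3) nn unfolding \<delta>_eq by auto
      show "\<bar>t / real (n2 (fst x)) * (K2.V x i - K2.U x)\<bar> \<le> \<delta> x" if "i \<in> {1..n2 (fst x)}" for i
        using part[OF K2.V_deviation_le_vmax[OF that] _ A(3)] elim(3) nn unfolding \<delta>_eq by auto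
    qed (use elim in auto)
    moreover have "l x = log_likelihood_ratio (n1 (fst x)) (n2 (fst x)) (K1.V x) (K2.V x)"
      by (simp add: l_def jel_ratio_def K1.V_def[abs_def] K2.V_def[abs_def])
    ultimately show ?case by auto
  qed
  have lQ: "((\<lambda>x. real_of_ereal (l x) - Q x) \<longlongrightarrow> 0) ?P"
    by (rule Lim_null_comparison[OF _ \<delta>Q]) (use main in \<open>auto elim: eventually_mono\<close>)
  have diff: "((\<lambda>x. real_of_ereal (l x) - (Z (fst x) (snd x))\<^sup>2) \<longlongrightarrow> 0) ?P"
    using tendsto_add[OF lQ Qz] by (simp add: z_def)

  have meas: "(\<lambda>\<omega>. jel_ratio (n1 n) (n2 n) (\<lambda>i. X i \<omega>)) \<in> borel_measurable M" for n
    unfolding jel_ratio_def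
    by (intro borel_measurable_log_likelihood_ratio borel_measurable_pseudo_value
        K1.krow.h_meas K2.krow.h_meas measurable_X) auto
  show ?thesis
    unfolding converges_in_distr_def weak_conv_def
  proof (intro conjI allI impI)
    fix c assume "isCont (cdf (chi_square 1)) c"
    then show "(\<lambda>n. prob {\<omega>\<in>space M. jel_ratio (n1 n) (n2 n) (\<lambda>i. X i \<omega>) \<le> ereal c}) \<longlonglongrightarrow> cdf (chi_square 1) c"
    proof (rule cdf_tendsto_of_in_prob[rotated 5])
      show "\<forall>\<^sub>F x in ?P. jel_ratio (n1 (fst x)) (n2 (fst x)) (\<lambda>i. X i (snd x)) = ereal (real_of_ereal (l x))"
        using main by eventually_elim (simp add: l_def)
      show "(\<lambda>n. prob {\<omega>\<in>space M. (Z n \<omega>)\<^sup>2 \<le> c}) \<longlonglongrightarrow> cdf (chi_square 1) c" for c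
        by (rule weak_conv_square_cdf[OF Zm Zlim])
    qed (use meas Zm diff in auto)
  qed (rule meas)
qed

end
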